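(* Let $\mathfrak{M}$ be a factor of type I or II on a Hilbert space $\mathcal{H}$, let $\rho$ be a faithful normal semifinite trace on $\mathfrak{M}$, let $\mathfrak{X}$ be a complex vector space and let $\Phi:\mathfrak{X}\times\mathfrak{X}\to(L^2(\rho),|||\cdot|||_2)$ be a positive sesquilinear map. Then for all $x,y\in\mathfrak{X}$, $$|||\Phi(x,y)|||_2\le|||\Phi(x,x)|||_2^{1/2}\;|||\Phi(y,y)|||_2^{1/2}.$$
   Context: For $1\le p<\infty$, $L^p(\rho)$ is the noncommutative $L^p$-space: the completion of $\{X\in\mathfrak{M}:\rho(|X|^p)<\infty\}$ with respect to $\|X\|_p=\rho(|X|^p)^{1/p}$, where $|X|=(X^*X)^{1/2}$; its elements are identified with operators affiliated with $\mathfrak{M}$. $L^\infty(\rho)=\mathfrak{M}$ with $\|\cdot\|_\infty$ the operator norm. For $F\in L^2(\rho)$, $$|||F|||_2=\sup\bigl\{\|WFW\|_1:\ W\in L^\infty(\rho)\cap L^2(\rho),\ W\ge0,\ \|W\|_2\le1,\ \|W\|_\infty\le1\bigr\},$$ which is a norm on $L^2(\rho)$. Sesquilinear means linear in the first variable and conjugate-linear in the second; $\Phi$ is positive if $\Phi(x,x)\ge0$ in $L^2(\rho)$ for every $x\in\mathfrak{X}$. *)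

theory Defs
  imports "HOL-Analysis.Analysis"
begin

section \<open>Complex Hilbert spaces and bounded operators\<close>

text \<open>The real Hilbert space structure underlying a complex Hilbert space is the library one;
  the complex inner product is linear in its first argument.\<close>

class chilbert_space = real_inner + complete_space +
  fixes scaleC :: "complex \<Rightarrow> 'a \<Rightarrow> 'a" (infixr "*\<^sub>C" 75)
    and cinner :: "'a \<Rightarrow> 'a \<Rightarrow> complex"
  assumes scaleC_add_right: "c *\<^sub>C (x + y) = c *\<^sub>C x + c *\<^sub>C y"
    and scaleC_add_left: "(c + d) *\<^sub>C x = c *\<^sub>C x + d *\<^sub>C x"
    and scaleC_scaleC: "c *\<^sub>C (d *\<^sub>C x) = (c * d) *\<^sub>C x"
    and scaleR_scaleC: "r *\<^sub>R x = complex_of_real r *\<^sub>C x"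
    and cinner_commute: "cinner x y = cnj (cinner y x)"
    and cinner_add_left: "cinner (x + y) z = cinner x z + cinner y z"
    and cinner_scaleC_left: "cinner (c *\<^sub>C x) y = c * cinner x y"
    and inner_eq_Re_cinner: "inner x y = Re (cinner x y)"

lemma cinner_self: "cinner x x = complex_of_real (inner x x)"
  for x :: "'h::chilbert_space"
proof (rule complex_eqI)
  have "Im (cinner x x) = Im (cnj (cinner x x))"
    using cinner_commute[of x x] by simp
  then show "Im (cinner x x) = Im (complex_of_real (inner x x))" by simp
qed (simp add: inner_eq_Re_cinner)

lemma cinner_scaleC_right: "cinner x (c *\<^sub>C y) = cnj c * cinner x y"
  by (metis cinner_commute cinner_scaleC_left complex_cnj_mult)

lemma norm_scaleC: "norm (c *\<^sub>C x) = cmod c * norm x"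
  for x :: "'h::chilbert_space"
proof -
  have "cinner (c *\<^sub>C x) (c *\<^sub>C x) = (c * cnj c) * cinner x x"
    by (simp add: cinner_scaleC_left cinner_scaleC_right)
  then have "complex_of_real (inner (c *\<^sub>C x) (c *\<^sub>C x)) =
      complex_of_real ((cmod c)\<^sup>2 * inner x x)"
    by (simp only: cinner_self complex_norm_square of_real_mult)
  then have "inner (c *\<^sub>C x) (c *\<^sub>C x) = (cmod c)\<^sup>2 * inner x x"
    by (simp only: of_real_eq_iff)
  then show ?thesis
    by (simp add: norm_eq_sqrt_inner real_sqrt_mult)
qed

lemma bounded_linear_scaleC: "bounded_linear (\<lambda>x::'h::chilbert_space. c *\<^sub>C x)"
  by (rule bounded_linear_intro[where K = "cmod c"])
    (simp_all add: scaleC_add_right scaleR_scaleC scaleC_scaleC norm_scaleC mult.commute)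

text \<open>The library type \<open>'h \<Rightarrow>\<^sub>L 'h\<close> consists of the bounded \<open>\<real>\<close>-linear maps, normed by the
  operator norm. \<open>bops\<close> is the algebra of bounded operators on the complex Hilbert space.\<close>

type_synonym 'h oper = "'h \<Rightarrow>\<^sub>L 'h"

definition bops :: "'h::chilbert_space oper set" where
  "bops = {A. \<forall>c x. blinfun_apply A (c *\<^sub>C x) = c *\<^sub>C blinfun_apply A x}"

lift_definition op_scaleC :: "complex \<Rightarrow> 'h::chilbert_space oper \<Rightarrow> 'h oper"
  is "\<lambda>c A x. c *\<^sub>C A x"
  by (rule bounded_linear_compose[OF bounded_linear_scaleC])

definition op_adj :: "'h::chilbert_space oper \<Rightarrow> 'h oper" where
  "op_adj A = (THE B. \<forall>x y. cinner (blinfun_apply A x) y = cinner x (blinfun_apply B y))"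

definition op_pos :: "'h::chilbert_space oper \<Rightarrow> bool" where
  "op_pos A \<longleftrightarrow> A \<in> bops \<and> (\<forall>x. cinner (blinfun_apply A x) x \<in> \<real>\<^sub>\<ge>\<^sub>0)"

definition op_le :: "'h::chilbert_space oper \<Rightarrow> 'h oper \<Rightarrow> bool" where
  "op_le A B \<longleftrightarrow> op_pos (B - A)"

definition op_abs :: "'h::chilbert_space oper \<Rightarrow> 'h oper" where
  "op_abs A = (THE R. op_pos R \<and> R o\<^sub>L R = op_adj A o\<^sub>L A)"

definition op_power :: "'h::chilbert_space oper \<Rightarrow> nat \<Rightarrow> 'h oper" where
  "op_power A p = (((o\<^sub>L) A) ^^ p) id_blinfun"

definition unitary_op :: "'h::chilbert_space oper \<Rightarrow> bool" where
  "unitary_op U \<longleftrightarrow> U \<in> bops \<and> op_adj U o\<^sub>L U = id_blinfun \<and> U o\<^sub>L op_adj U = id_blinfun"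


section \<open>Von Neumann algebras and factors of type I and II\<close>

definition commutant :: "'h::chilbert_space oper set \<Rightarrow> 'h oper set" where
  "commutant S = {A \<in> bops. \<forall>B\<in>S. A o\<^sub>L B = B o\<^sub>L A}"

definition von_neumann_algebra :: "'h::chilbert_space oper set \<Rightarrow> bool" where
  "von_neumann_algebra M \<longleftrightarrow>
     M \<subseteq> bops \<and> (\<forall>A\<in>M. op_adj A \<in> M) \<and> commutant (commutant M) = M"

definition factor :: "'h::chilbert_space oper set \<Rightarrow> bool" where
  "factor M \<longleftrightarrow>
     von_neumann_algebra M \<and> M \<inter> commutant M = range (\<lambda>c. op_scaleC c id_blinfun)"

definition projections :: "'h::chilbert_space oper set \<Rightarrow> 'h oper set" where
  "projections M = {P \<in> M. op_adj P = P \<and> P o\<^sub>L P = P}"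

definition murray_von_neumann_equiv ::
    "'h::chilbert_space oper set \<Rightarrow> 'h oper \<Rightarrow> 'h oper \<Rightarrow> bool" where
  "murray_von_neumann_equiv M P Q \<longleftrightarrow> (\<exists>V\<in>M. op_adj V o\<^sub>L V = P \<and> V o\<^sub>L op_adj V = Q)"

definition finite_projection :: "'h::chilbert_space oper set \<Rightarrow> 'h oper \<Rightarrow> bool" where
  "finite_projection M P \<longleftrightarrow> P \<in> projections M \<and>
     (\<forall>Q\<in>projections M. op_le Q P \<and> murray_von_neumann_equiv M P Q \<longrightarrow> Q = P)"

definition abelian_projection :: "'h::chilbert_space oper set \<Rightarrow> 'h oper \<Rightarrow> bool" where
  "abelian_projection M P \<longleftrightarrow> P \<in> projections M \<and>
     (\<forall>A\<in>M. \<forall>B\<in>M. (P o\<^sub>L A o\<^sub>L P) o\<^sub>L (P o\<^sub>L B o\<^sub>L P) = (P o\<^sub>L B o\<^sub>L P) o\<^sub>L (P o\<^sub>L A o\<^sub>L P))"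

text \<open>In a factor every nonzero projection has central support \<open>1\<close>, so the usual conditions on
  central supports reduce to nonvanishing.\<close>

definition type_I_factor :: "'h::chilbert_space oper set \<Rightarrow> bool" where
  "type_I_factor M \<longleftrightarrow> factor M \<and> (\<exists>P. abelian_projection M P \<and> P \<noteq> 0)"

definition type_II_factor :: "'h::chilbert_space oper set \<Rightarrow> bool" where
  "type_II_factor M \<longleftrightarrow> factor M \<and> \<not> (\<exists>P. abelian_projection M P \<and> P \<noteq> 0) \<and>
     (\<exists>P. finite_projection M P \<and> P \<noteq> 0)"


section \<open>Traces\<close>

definition pos_part :: "'h::chilbert_space oper set \<Rightarrow> 'h oper set" where
  "pos_part M = {A \<in> M. op_pos A}"

text \<open>A trace is a \<open>[0,\<infinity>]\<close>-valued function on the positive cone of \<open>M\<close>; the values of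
  \<open>\<rho>\<close> off \<open>pos_part M\<close> play no role.\<close>

definition is_trace :: "'h::chilbert_space oper set \<Rightarrow> ('h oper \<Rightarrow> ennreal) \<Rightarrow> bool" where
  "is_trace M \<rho> \<longleftrightarrow>
     (\<forall>A\<in>pos_part M. \<forall>B\<in>pos_part M. \<rho> (A + B) = \<rho> A + \<rho> B) \<and>
     (\<forall>A\<in>pos_part M. \<forall>r\<ge>0. \<rho> (r *\<^sub>R A) = ennreal r * \<rho> A) \<and>
     (\<forall>A\<in>M. \<rho> (op_adj A o\<^sub>L A) = \<rho> (A o\<^sub>L op_adj A))"

definition faithful_trace :: "'h::chilbert_space oper set \<Rightarrow> ('h oper \<Rightarrow> ennreal) \<Rightarrow> bool" where
  "faithful_trace M \<rho> \<longleftrightarrow> (\<forall>A\<in>pos_part M. \<rho> A = 0 \<longrightarrow> A = 0)"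

text \<open>Normality is stated for upward directed subsets, which is the same as for increasing nets.\<close>

definition normal_trace :: "'h::chilbert_space oper set \<Rightarrow> ('h oper \<Rightarrow> ennreal) \<Rightarrow> bool" where
  "normal_trace M \<rho> \<longleftrightarrow>
     (\<forall>D S. D \<subseteq> pos_part M \<and> D \<noteq> {} \<and>
        (\<forall>A\<in>D. \<forall>B\<in>D. \<exists>C\<in>D. op_le A C \<and> op_le B C) \<and>
        S \<in> pos_part M \<and> (\<forall>A\<in>D. op_le A S) \<and>
        (\<forall>B\<in>pos_part M. (\<forall>A\<in>D. op_le A B) \<longrightarrow> op_le S B)
        \<longrightarrow> \<rho> S = (SUP A\<in>D. \<rho> A))"

definition semifinite_trace :: "'h::chilbert_space oper set \<Rightarrow> ('h oper \<Rightarrow> ennreal) \<Rightarrow> bool" where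
  "semifinite_trace M \<rho> \<longleftrightarrow>
     (\<forall>A\<in>pos_part M. A \<noteq> 0 \<longrightarrow> (\<exists>B\<in>pos_part M. B \<noteq> 0 \<and> op_le B A \<and> \<rho> B < \<infinity>))"


section \<open>Noncommutative \<open>L\<^sup>p\<close>-spaces\<close>

text \<open>Only integer exponents \<open>p \<ge> 1\<close> are covered; \<open>p = 1\<close> and \<open>p = 2\<close> are used.
  \<open>Lp_core\<close> is the dense subspace of which \<open>Lp\<close> is the completion, and it is also the
  intersection of \<open>L\<^sup>p\<close> with \<open>L\<^sup>\<infinity>\<close>.\<close>

definition Lp_core :: "'h::chilbert_space oper set \<Rightarrow> ('h oper \<Rightarrow> ennreal) \<Rightarrow> nat \<Rightarrow> 'h oper set"
  where "Lp_core M \<rho> p = {X \<in> M. \<rho> (op_power (op_abs X) p) < \<infinity>}"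

definition core_norm :: "('h::chilbert_space oper \<Rightarrow> ennreal) \<Rightarrow> nat \<Rightarrow> 'h oper \<Rightarrow> real" where
  "core_norm \<rho> p X = root p (enn2real (\<rho> (op_power (op_abs X) p)))"

text \<open>The completion is realised as the set of classes of Cauchy sequences modulo null sequences;
  an element of \<open>Lp\<close> is such a class.\<close>

type_synonym 'h lp_elem = "(nat \<Rightarrow> 'h oper) set"

definition Lp_Cauchy ::
    "'h::chilbert_space oper set \<Rightarrow> ('h oper \<Rightarrow> ennreal) \<Rightarrow> nat \<Rightarrow> (nat \<Rightarrow> 'h oper) set" where
  "Lp_Cauchy M \<rho> p = {f. (\<forall>n. f n \<in> Lp_core M \<rho> p) \<and>
     (\<forall>e>0. \<exists>N. \<forall>m\<ge>N. \<forall>n\<ge>N. core_norm \<rho> p (f m - f n) < e)}"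

definition Lp_rel ::
    "'h::chilbert_space oper set \<Rightarrow> ('h oper \<Rightarrow> ennreal) \<Rightarrow> nat \<Rightarrow> (nat \<Rightarrow> 'h oper) rel" where
  "Lp_rel M \<rho> p = {(f, g). f \<in> Lp_Cauchy M \<rho> p \<and> g \<in> Lp_Cauchy M \<rho> p \<and>
     (\<lambda>n. core_norm \<rho> p (f n - g n)) \<longlonglongrightarrow> 0}"

definition Lp ::
    "'h::chilbert_space oper set \<Rightarrow> ('h oper \<Rightarrow> ennreal) \<Rightarrow> nat \<Rightarrow> 'h lp_elem set" where
  "Lp M \<rho> p = Lp_Cauchy M \<rho> p // Lp_rel M \<rho> p"

definition Lp_norm :: "('h::chilbert_space oper \<Rightarrow> ennreal) \<Rightarrow> nat \<Rightarrow> 'h lp_elem \<Rightarrow> real" where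
  "Lp_norm \<rho> p F = (THE r. \<forall>f\<in>F. (\<lambda>n. core_norm \<rho> p (f n)) \<longlonglongrightarrow> r)"

definition Lp_add :: "'h::chilbert_space oper set \<Rightarrow> ('h oper \<Rightarrow> ennreal) \<Rightarrow> nat \<Rightarrow>
    'h lp_elem \<Rightarrow> 'h lp_elem \<Rightarrow> 'h lp_elem" where
  "Lp_add M \<rho> p F G = (\<Union>f\<in>F. \<Union>g\<in>G. Lp_rel M \<rho> p `` {\<lambda>n. f n + g n})"

definition Lp_scaleC :: "'h::chilbert_space oper set \<Rightarrow> ('h oper \<Rightarrow> ennreal) \<Rightarrow> nat \<Rightarrow>
    complex \<Rightarrow> 'h lp_elem \<Rightarrow> 'h lp_elem" where
  "Lp_scaleC M \<rho> p c F = (\<Union>f\<in>F. Lp_rel M \<rho> p `` {\<lambda>n. op_scaleC c (f n)})"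

text \<open>For \<open>W\<close> in \<open>Lp_core M \<rho> 2\<close>, Hoelder's inequality makes \<open>X \<mapsto> W X W\<close> continuous
  from the norm with exponent 2 to the norm with exponent 1; the product \<open>W F W\<close>, an element
  of \<open>L\<^sup>1\<close>, is given by its continuous extension.\<close>

definition L2_sandwich :: "'h::chilbert_space oper set \<Rightarrow> ('h oper \<Rightarrow> ennreal) \<Rightarrow>
    'h oper \<Rightarrow> 'h lp_elem \<Rightarrow> 'h lp_elem" where
  "L2_sandwich M \<rho> W F = (\<Union>f\<in>F. Lp_rel M \<rho> 1 `` {\<lambda>n. W o\<^sub>L f n o\<^sub>L W})"

definition triple_norm :: "'h::chilbert_space oper set \<Rightarrow> ('h oper \<Rightarrow> ennreal) \<Rightarrow>
    'h lp_elem \<Rightarrow> real" where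
  "triple_norm M \<rho> F = Sup {Lp_norm \<rho> 1 (L2_sandwich M \<rho> W F) | W.
     W \<in> Lp_core M \<rho> 2 \<and> op_pos W \<and> core_norm \<rho> 2 W \<le> 1 \<and> norm W \<le> 1}"


section \<open>Elements of \<open>L\<^sup>p\<close> as affiliated operators, and positivity\<close>

text \<open>Unbounded operators are given by their graphs.\<close>

definition closed_densely_defined :: "('h::chilbert_space \<times> 'h) set \<Rightarrow> bool" where
  "closed_densely_defined T \<longleftrightarrow>
     (0, 0) \<in> T \<and>
     (\<forall>x y x' y'. (x, y) \<in> T \<and> (x', y') \<in> T \<longrightarrow> (x + x', y + y') \<in> T) \<and>
     (\<forall>c x y. (x, y) \<in> T \<longrightarrow> (c *\<^sub>C x, c *\<^sub>C y) \<in> T) \<and>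
     single_valued T \<and> closed T \<and> closure (Domain T) = UNIV"

definition affiliated :: "'h::chilbert_space oper set \<Rightarrow> ('h \<times> 'h) set \<Rightarrow> bool" where
  "affiliated M T \<longleftrightarrow> closed_densely_defined T \<and>
     (\<forall>U\<in>commutant M. unitary_op U \<longrightarrow>
        (\<lambda>(x, y). (blinfun_apply U x, blinfun_apply U y)) ` T = T)"

definition graph_adj :: "('h::chilbert_space \<times> 'h) set \<Rightarrow> ('h \<times> 'h) set" where
  "graph_adj T = {(u, v). \<forall>(x, y)\<in>T. cinner y u = cinner x v}"

definition positive_graph :: "('h::chilbert_space \<times> 'h) set \<Rightarrow> bool" where
  "positive_graph T \<longleftrightarrow> graph_adj T = T \<and> (\<forall>(x, y)\<in>T. cinner y x \<in> \<real>\<^sub>\<ge>\<^sub>0)"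

text \<open>The identification of an element \<open>F\<close> of the completion with an affiliated operator \<open>T\<close>:
  Cauchy sequences in the norm of \<open>L\<^sup>p\<close> are Cauchy in measure, and \<open>T\<close> is the limit in
  measure (in the sense of Nelson) of the sequences representing \<open>F\<close>. Such a \<open>T\<close> exists
  and is unique.\<close>

definition Lp_operator :: "'h::chilbert_space oper set \<Rightarrow> ('h oper \<Rightarrow> ennreal) \<Rightarrow>
    'h lp_elem \<Rightarrow> ('h \<times> 'h) set \<Rightarrow> bool" where
  "Lp_operator M \<rho> F T \<longleftrightarrow> affiliated M T \<and>
     (\<forall>f\<in>F. \<forall>e>0. \<forall>d>0. \<exists>N. \<forall>n\<ge>N. \<exists>P\<in>projections M.
        \<rho> (id_blinfun - P) \<le> ennreal d \<and>
        (\<forall>x. \<exists>y. (blinfun_apply P x, y) \<in> T \<and>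
              norm (y - blinfun_apply (f n) (blinfun_apply P x)) \<le> e * norm x))"

definition Lp_positive :: "'h::chilbert_space oper set \<Rightarrow> ('h oper \<Rightarrow> ennreal) \<Rightarrow>
    'h lp_elem \<Rightarrow> bool" where
  "Lp_positive M \<rho> F \<longleftrightarrow> (\<exists>T. Lp_operator M \<rho> F T \<and> positive_graph T)"


section \<open>Positive sesquilinear maps\<close>

definition sesquilinear_L2 :: "'h::chilbert_space oper set \<Rightarrow> ('h oper \<Rightarrow> ennreal) \<Rightarrow>
    (complex \<Rightarrow> 'x::ab_group_add \<Rightarrow> 'x) \<Rightarrow> ('x \<Rightarrow> 'x \<Rightarrow> 'h lp_elem) \<Rightarrow> bool" where
  "sesquilinear_L2 M \<rho> sc \<Phi> \<longleftrightarrow>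
     (\<forall>x y. \<Phi> x y \<in> Lp M \<rho> 2) \<and>
     (\<forall>x x' y. \<Phi> (x + x') y = Lp_add M \<rho> 2 (\<Phi> x y) (\<Phi> x' y)) \<and>
     (\<forall>c x y. \<Phi> (sc c x) y = Lp_scaleC M \<rho> 2 c (\<Phi> x y)) \<and>
     (\<forall>x y y'. \<Phi> x (y + y') = Lp_add M \<rho> 2 (\<Phi> x y) (\<Phi> x y')) \<and>
     (\<forall>c x y. \<Phi> x (sc c y) = Lp_scaleC M \<rho> 2 (cnj c) (\<Phi> x y))"

definition positive_L2_map :: "'h::chilbert_space oper set \<Rightarrow> ('h oper \<Rightarrow> ennreal) \<Rightarrow>
    ('x \<Rightarrow> 'x \<Rightarrow> 'h lp_elem) \<Rightarrow> bool" where
  "positive_L2_map M \<rho> \<Phi> \<longleftrightarrow> (\<forall>x. Lp_positive M \<rho> (\<Phi> x x))"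

end

theory Submission
  imports Defs
begin

text \<open>Write \<open>\<rho>\<close> for the linear extension of the trace to its ideal of definition as well. The inequality
  already holds for each admissible \<open>W\<close> separately:
  \<open>\<parallel>W \<Phi>(x,y) W\<parallel>\<^sub>1 \<le> \<parallel>W \<Phi>(x,x) W\<parallel>\<^sub>1\<^sup>1\<^sup>/\<^sup>2 \<parallel>W \<Phi>(y,y) W\<parallel>\<^sub>1\<^sup>1\<^sup>/\<^sup>2\<close>, and the supremum over \<open>W\<close> is taken at
  the end. By polar decomposition the trace norm is \<open>\<bar>\<rho>(T W \<Phi>(x,y) W)\<bar>\<close> for some contraction
  \<open>T \<in> M\<close>, so it suffices to bound this number for every contraction \<open>T\<close>.

  If \<open>T\<close> is replaced by a positive \<open>Q = C\<^sup>2\<close>, then \<open>\<rho>(Q W F W) = \<rho>((W C)\<^sup>* F (W C))\<close> is nonnegative for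
  positive \<open>F\<close>. Hence \<open>(x, y) \<mapsto> \<rho>(Q W \<Phi>(x,y) W)\<close> is a positive sesquilinear form with complex values,
  and the scalar Cauchy--Schwarz inequality applies (\<open>hermitian_form_bound\<close>). As \<open>\<Phi>\<close> need not be
  completely positive, this argument does not apply to an arbitrary contraction \<open>T\<close> directly; instead \<open>T\<close> is
  decomposed into positive elements with phases. The Fejer means
  \<open>\<Sum>\<^sub>|\<^sub>j\<^sub>|\<^sub><\<^sub>N (1 - |j|/N) e\<^sup>i\<^sup>j\<^sup>\<theta> T\<^sub>j\<close>, with \<open>T\<^sub>j = T\<^sup>j\<close> and \<open>T\<^sub>-\<^sub>j = (T\<^sup>*)\<^sup>j\<close> for \<open>j \<ge> 0\<close>, are positive because \<open>T\<close> is a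
  contraction (\<open>fejer_sum_pos\<close>); averaging them over finitely many angles \<open>\<theta>\<close> gives positive
  \<open>Q\<^sub>m\<close> with \<open>\<Sum> Q\<^sub>m = 1\<close> and unimodular \<open>\<lambda>\<^sub>m\<close> with \<open>\<Sum> \<lambda>\<^sub>m Q\<^sub>m = (1 - 1/N) T\<close> (\<open>fejer_decomposition\<close>).
  Applying the scalar inequality to each \<open>Q\<^sub>m\<close>, summing with the Cauchy--Schwarz inequality for finite sums and
  letting \<open>N \<longlonglongrightarrow> \<infinity>\<close> yields
  \<open>\<bar>\<rho>(T W \<Phi>(x,y) W)\<bar> \<le> \<rho>(W \<Phi>(x,x) W)\<^sup>1\<^sup>/\<^sup>2 \<rho>(W \<Phi>(y,y) W)\<^sup>1\<^sup>/\<^sup>2\<close> (\<open>functional_domination\<close>).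

  The elements of \<open>L\<^sup>2\<close> are classes of Cauchy sequences, so the functionals above are limits along
  representatives (\<open>lim_tr\<close>). Positivity of an element is positivity of the affiliated operator that is its limit in
  measure; it is transported to the functionals by cutting with a projection whose complement
  has small trace and on whose range the representatives are uniformly close to that operator (\<open>lim_tr_positive\<close>).
  The sections before that develop adjoints, square roots, polar decomposition, the linear
  extension of the trace and the two norms from the Riesz representation theorem on.\<close>

section \<open>Complex Hilbert spaces\<close>

lemma scaleC_one [simp]: "1 *\<^sub>C x = (x::'h::chilbert_space)"
  using scaleR_scaleC[of 1 x] by simp

lemma scaleC_minus_one: "(-1) *\<^sub>C x = - (x::'h::chilbert_space)"
  using scaleR_scaleC[of "-1" x] by simp

lemma scaleC_additive: "Modules.additive (\<lambda>x::'h::chilbert_space. c *\<^sub>C x)"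
  by standard (rule scaleC_add_right)

lemmas scaleC_zero_right [simp] = Modules.additive.zero[OF scaleC_additive]
  and scaleC_minus_right = Modules.additive.minus[OF scaleC_additive]
  and scaleC_diff_right = Modules.additive.diff[OF scaleC_additive]

lemma cinner_add_right: "cinner x (y + z) = cinner x y + cinner x (z::'h::chilbert_space)"
  by (metis cinner_add_left cinner_commute complex_cnj_add)

lemma cinner_additive_left: "Modules.additive (\<lambda>x::'h::chilbert_space. cinner x y)"
  by standard (rule cinner_add_left)

lemma cinner_additive_right: "Modules.additive (\<lambda>y::'h::chilbert_space. cinner x y)"
  by standard (rule cinner_add_right)

lemmas cinner_zero_left [simp] = Modules.additive.zero[OF cinner_additive_left]
  and cinner_zero_right [simp] = Modules.additive.zero[OF cinner_additive_right]
  and cinner_minus_left = Modules.additive.minus[OF cinner_additive_left]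
  and cinner_minus_right = Modules.additive.minus[OF cinner_additive_right]
  and cinner_diff_left = Modules.additive.diff[OF cinner_additive_left]
  and cinner_diff_right = Modules.additive.diff[OF cinner_additive_right]

lemma cinner_scaleR_left: "cinner (r *\<^sub>R x) y = of_real r * cinner x (y::'h::chilbert_space)"
  by (simp add: scaleR_scaleC cinner_scaleC_left)

lemma cinner_scaleR_right: "cinner x (r *\<^sub>R y) = of_real r * cinner x (y::'h::chilbert_space)"
  by (simp add: scaleR_scaleC cinner_scaleC_right)

lemmas cinner_simps = cinner_add_left cinner_add_right cinner_diff_left cinner_diff_right
  cinner_minus_left cinner_minus_right cinner_scaleC_left cinner_scaleC_right
  cinner_scaleR_left cinner_scaleR_right

lemma cinner_eq_inner: "cinner x y = Complex (inner x y) (inner ((-\<i>) *\<^sub>C x) y)"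
  for x :: "'h::chilbert_space"
  by (rule complex_eqI) (simp_all add: inner_eq_Re_cinner cinner_scaleC_left)

lemma inner_scaleC_right: "inner x (c *\<^sub>C y) = inner (cnj c *\<^sub>C x) (y::'h::chilbert_space)"
  by (simp add: inner_eq_Re_cinner cinner_simps)

lemma cinner_Cauchy_Schwarz: "cmod (cinner x y) \<le> norm x * norm (y::'h::chilbert_space)"
proof -
  define c where "c = cnj (sgn (cinner x y))"
  have "cnj (sgn z) * z = of_real (cmod z)" for z :: complex
    by (cases "z = 0")
      (simp_all add: sgn_div_norm scaleR_conv_of_real field_simps complex_norm_square
        flip: power2_eq_square, simp add: mult.commute complex_norm_square[symmetric]
        power2_eq_square)
  then have "cinner (c *\<^sub>C x) y = of_real (cmod (cinner x y))"
    by (simp add: c_def cinner_scaleC_left)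
  then have "cmod (cinner x y) = inner (c *\<^sub>C x) y"
    by (simp add: inner_eq_Re_cinner)
  also have "\<dots> \<le> norm (c *\<^sub>C x) * norm y"
    by (rule norm_cauchy_schwarz)
  also have "\<dots> \<le> norm x * norm y"
    by (rule mult_right_mono) (auto simp: norm_scaleC c_def norm_sgn)
  finally show ?thesis .
qed

lemma cinner_ext_right: "(\<And>x. cinner x y = cinner x z) \<Longrightarrow> y = (z::'h::chilbert_space)"
  by (metis cinner_diff_right cinner_self diff_self eq_iff_diff_eq_0 inner_eq_zero_iff of_real_0
      of_real_eq_iff)

section \<open>Riesz representation\<close>

text \<open>The representing vector is the limit of \<open>R x\<^sub>n\<close> for a minimizing sequence of
  \<open>\<parallel>R x\<parallel>\<^sup>2 - 2 g x\<close>, which is Cauchy by the parallelogram law. The functional lives on the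
  parameter space of \<open>R\<close> so that one lemma yields both adjoints (\<open>R\<close> the identity) and polar
  decompositions (\<open>R = |X|\<close>), where the range of \<open>R\<close> need not be closed.\<close>

lemma Riesz_on_range:
  fixes R :: "'a::real_vector \<Rightarrow> 'h::{real_inner,complete_space}" and g :: "'a \<Rightarrow> real"
  assumes R: "linear R" and g: "linear g" and K: "0 \<le> K" and bd: "\<And>x. \<bar>g x\<bar> \<le> K * norm (R x)"
  shows "\<exists>z\<in>closure (range R). norm z \<le> K \<and> (\<forall>x. inner (R x) z = g x)"
proof -
  define J where "J x = (norm (R x))\<^sup>2 - 2 * g x" for x
  have J_lower: "- K\<^sup>2 \<le> J x" for x
  proof -
    have "0 \<le> (norm (R x) - K)\<^sup>2" by simp
    moreover have "g x \<le> K * norm (R x)" using bd[of x] by simp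
    ultimately show ?thesis
      by (simp add: J_def power2_diff algebra_simps)
  qed
  define m where "m = Inf (range J)"
  have bdd: "bdd_below (range J)"
    by (rule bdd_belowI2[OF J_lower])
  have m_le: "m \<le> J x" for x
    unfolding m_def by (rule cInf_lower[OF _ bdd]) simp
  have "\<exists>x. J x < m + 1 / real (Suc n)" for n
  proof -
    have "\<exists>y\<in>range J. y < m + 1 / real (Suc n)"
      unfolding m_def by (rule cInf_lessD) auto
    then show ?thesis by auto
  qed
  then obtain u where u: "\<And>n. J (u n) < m + 1 / real (Suc n)"
    by metis
  have par: "(norm (R a - R b))\<^sup>2 = 2 * J a + 2 * J b - 4 * J ((1/2) *\<^sub>R (a + b))" for a b
    by (simp add: J_def linear_add[OF R] linear_scale[OF R] linear_add[OF g] linear_scale[OF g]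
        power2_norm_eq_inner inner_add_left inner_add_right inner_diff_left inner_diff_right
        inner_commute algebra_simps)
  have J_lim: "(\<lambda>n. J (u n)) \<longlonglongrightarrow> m"
  proof (rule tendsto_sandwich)
    show "(\<lambda>n. m) \<longlonglongrightarrow> m" by simp
    show "(\<lambda>n. m + 1 / real (Suc n)) \<longlonglongrightarrow> m"
      using tendsto_add[OF tendsto_const LIMSEQ_inverse_real_of_nat, of m]
      by (simp add: inverse_eq_divide)
    show "eventually (\<lambda>n. m \<le> J (u n)) sequentially"
      by (intro always_eventually allI m_le)
    show "eventually (\<lambda>n. J (u n) \<le> m + 1 / real (Suc n)) sequentially"
      by (intro always_eventually allI less_imp_le[OF u])
  qed
  have "Cauchy (\<lambda>n. R (u n))"
  proof (rule metric_CauchyI)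
    fix e :: real assume e: "0 < e"
    have "eventually (\<lambda>n. J (u n) < m + e\<^sup>2 / 4) sequentially"
      using J_lim e by (intro order_tendstoD) auto
    then obtain N where N: "\<And>n. N \<le> n \<Longrightarrow> J (u n) < m + e\<^sup>2 / 4"
      by (auto simp: eventually_sequentially)
    have "dist (R (u k)) (R (u l)) < e" if "N \<le> k" "N \<le> l" for k l
    proof -
      have "(norm (R (u k) - R (u l)))\<^sup>2 < e\<^sup>2"
        using par[of "u k" "u l"] N[OF that(1)] N[OF that(2)] m_le[of "(1/2) *\<^sub>R (u k + u l)"]
        by linarith
      with e show ?thesis
        by (simp add: dist_norm power2_less_imp_less)
    qed
    then show "\<exists>N. \<forall>k\<ge>N. \<forall>l\<ge>N. dist (R (u k)) (R (u l)) < e" by blast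
  qed
  then obtain z where z: "(\<lambda>n. R (u n)) \<longlonglongrightarrow> z"
    using Cauchy_convergent convergentD by blast
  have z_cl: "z \<in> closure (range R)"
    unfolding closure_sequential using z by (intro exI[of _ "\<lambda>n. R (u n)"]) auto
  have rep: "inner (R x) z = g x" for x
  proof -
    define s where "s = inner (R x) z - g x"
    define q where "q = (norm (R x))\<^sup>2"
    have quad: "0 \<le> 2 * t * s + t\<^sup>2 * q" for t
    proof -
      have eq: "J (u n + t *\<^sub>R x) = J (u n) + 2 * t * (inner (R x) (R (u n)) - g x) + t\<^sup>2 * q" for n
      proof -
        have "(norm (R (u n) + t *\<^sub>R R x))\<^sup>2 = (norm (R (u n)))\<^sup>2 + 2 * t * inner (R x) (R (u n)) + t\<^sup>2 * q"
          unfolding q_def power2_norm_eq_inner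
          by (simp add: inner_add_left inner_add_right inner_commute power2_eq_square)
        then show ?thesis
          by (simp add: J_def linear_add[OF R] linear_scale[OF R] linear_add[OF g]
            linear_scale[OF g] algebra_simps)
      qed
      have "(\<lambda>n. J (u n) + 2 * t * (inner (R x) (R (u n)) - g x) + t\<^sup>2 * q)
          \<longlonglongrightarrow> m + 2 * t * s + t\<^sup>2 * q"
        unfolding s_def by (intro tendsto_intros J_lim z)
      moreover have "m \<le> J (u n) + 2 * t * (inner (R x) (R (u n)) - g x) + t\<^sup>2 * q" for n
        using m_le[of "u n + t *\<^sub>R x"] eq by simp
      ultimately have "m \<le> m + 2 * t * s + t\<^sup>2 * q"
        by (intro LIMSEQ_le_const) auto
      then show ?thesis by simp
    qed
    have q0: "0 \<le> q" by (simp add: q_def)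
    have "s = 0"
    proof (rule ccontr)
      assume "s \<noteq> 0"
      \<comment> \<open>The quadratic is tested near its minimum; \<open>q + 1\<close> replaces \<open>q\<close>, which may vanish.\<close>
      define w where "w = s\<^sup>2 / (q + 1)"
      have w: "0 < w" using \<open>s \<noteq> 0\<close> q0 by (simp add: w_def)
      have "0 \<le> 2 * (- s / (q + 1)) * s + (- s / (q + 1))\<^sup>2 * q" by (rule quad)
      also have "\<dots> = w * (q / (q + 1)) - 2 * w"
        by (simp add: w_def power2_eq_square)
      also have "w * (q / (q + 1)) \<le> w * 1"
        using w q0 by (intro mult_left_mono) auto
      finally show False using w by simp
    qed
    then show ?thesis by (simp add: s_def)
  qed
  have "norm z \<le> K"
  proof (cases "z = 0")
    case False
    have "(\<lambda>n. inner (R (u n)) z) \<longlonglongrightarrow> inner z z" "(\<lambda>n. K * norm (R (u n))) \<longlonglongrightarrow> K * norm z"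
      by (intro tendsto_intros z)+
    moreover have "inner (R (u n)) z \<le> K * norm (R (u n))" for n
      using rep[of "u n"] bd[of "u n"] by simp
    ultimately have "inner z z \<le> K * norm z"
      by (intro LIMSEQ_le) auto
    with False show ?thesis
      by (simp add: dot_square_norm power2_eq_square)
  qed (simp add: K)
  with z_cl rep show ?thesis by blast
qed

text \<open>Every algebraic property of an operator defined pointwise by \<open>Riesz_on_range\<close> (linearity,
  complex homogeneity, membership in the von Neumann algebra) is read off from this uniqueness.\<close>

lemma closure_range_unique:
  fixes R :: "'a \<Rightarrow> 'h::real_inner"
  assumes "z \<in> closure (range R)" "z' \<in> closure (range R)"
    and eq: "\<And>x. inner (R x) z = inner (R x) z'"
  shows "z = z'"
proof -
  have "closure (range R) \<subseteq> {s. inner s (z - z') = 0}"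
    by (rule closure_minimal) (auto simp: inner_diff_right eq intro!: closed_Collect_eq continuous_intros)
  with assms(1,2) have "inner z (z - z') = 0" "inner z' (z - z') = 0"
    by auto
  then have "inner (z - z') (z - z') = 0"
    by (simp add: inner_diff_left)
  then show ?thesis by simp
qed

text \<open>Formally \<open>R\<^sup>* T = X\<^sup>*\<close>: for \<open>R\<close> the identity, \<open>T\<close> is the adjoint of \<open>X\<close>; for \<open>R = |X|\<close> it is the
  adjoint of the partial isometry in the polar decomposition of \<open>X\<close>.\<close>

lemma weak_factorization:
  fixes R X :: "'h::{real_inner,complete_space} \<Rightarrow>\<^sub>L 'h"
  assumes K: "0 \<le> K" and bd: "\<And>x. norm (X x) \<le> K * norm (R x)"
  shows "\<exists>T. norm T \<le> K \<and>
    (\<forall>y. blinfun_apply T y \<in> closure (range R) \<and> (\<forall>x. inner (R x) (T y) = inner (X x) y))"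
proof -
  have "\<exists>z\<in>closure (range R). norm z \<le> K * norm y \<and> (\<forall>x. inner (R x) z = inner (X x) y)" for y
  proof (rule Riesz_on_range)
    show "linear (blinfun_apply R)"
      by (simp add: blinfun.bounded_linear_right bounded_linear.linear)
    show "linear (\<lambda>x. inner (X x) y)"
      by (rule linearI) (simp_all add: blinfun.bilinear_simps inner_add_left)
    show "\<bar>inner (X x) y\<bar> \<le> K * norm y * norm (R x)" for x
    proof -
      have "\<bar>inner (X x) y\<bar> \<le> norm (X x) * norm y" by (rule Cauchy_Schwarz_ineq2)
      also have "\<dots> \<le> K * norm (R x) * norm y" by (intro mult_right_mono bd) simp
      finally show ?thesis by (simp add: ac_simps)
    qed
  qed (simp add: K)
  then obtain t where t_cl: "\<And>y. t y \<in> closure (range R)" and t_norm: "\<And>y. norm (t y) \<le> K * norm y"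
    and t: "\<And>x y. inner (R x) (t y) = inner (X x) y"
    by metis
  have cl: "h v \<in> closure (range R)"
    if "v \<in> closure (range R)" "continuous_on UNIV h" "\<And>x. h (R x) \<in> closure (range R)" for h v
  proof -
    have "h ` closure (range R) \<subseteq> closure (range R)"
      using that by (intro image_closure_subset) (auto intro: continuous_on_subset)
    with that(1) show ?thesis by blast
  qed
  have cl_add_range: "v + R x \<in> closure (range R)" if "v \<in> closure (range R)" for v x
  proof (rule cl[OF that, where h = "\<lambda>v. v + R x"])
    show "R x' + R x \<in> closure (range R)" for x'
      by (rule subsetD[OF closure_subset]) (simp flip: blinfun.add_right)
  qed (intro continuous_intros)
  have cl_add: "v + w \<in> closure (range R)" if "v \<in> closure (range R)" "w \<in> closure (range R)" for v w
    by (rule cl[OF that(2), where h = "\<lambda>w. v + w"]) (intro continuous_intros cl_add_range that)+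
  have cl_scale: "r *\<^sub>R v \<in> closure (range R)" if "v \<in> closure (range R)" for r v
  proof (rule cl[OF that, where h = "\<lambda>v. r *\<^sub>R v"])
    show "r *\<^sub>R R x' \<in> closure (range R)" for x'
      by (rule subsetD[OF closure_subset]) (simp flip: blinfun.scaleR_right)
  qed (intro continuous_intros)
  have t_add: "t (a + b) = t a + t b" for a b
    by (rule closure_range_unique[of _ R]) (simp_all add: t_cl cl_add t inner_add_right)
  have t_scale: "t (r *\<^sub>R a) = r *\<^sub>R t a" for r a
    by (rule closure_range_unique[of _ R]) (simp_all add: t_cl cl_scale t)
  have bl: "bounded_linear t"
    by (rule bounded_linear_intro[where K = K]) (simp_all add: t_add t_scale t_norm mult.commute)
  show ?thesis
  proof (intro exI[of _ "Blinfun t"] conjI allI)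
    show "norm (Blinfun t) \<le> K"
      by (rule norm_blinfun_bound) (simp_all add: K bounded_linear_Blinfun_apply[OF bl] t_norm)
  qed (simp_all add: bounded_linear_Blinfun_apply[OF bl] t_cl t)
qed

section \<open>The algebra of bounded operators\<close>

lemma bops_apply: "A \<in> bops \<Longrightarrow> blinfun_apply A (c *\<^sub>C x) = c *\<^sub>C A x"
  by (simp add: bops_def)

lemma op_scaleC_apply [simp]: "blinfun_apply (op_scaleC c A) x = c *\<^sub>C A x"
  by (simp add: op_scaleC.rep_eq)

lemma bops_closed [simp, intro]:
  shows "0 \<in> bops" "id_blinfun \<in> bops"
    and "A \<in> bops \<Longrightarrow> B \<in> bops \<Longrightarrow> A + B \<in> bops"
    and "A \<in> bops \<Longrightarrow> B \<in> bops \<Longrightarrow> A - B \<in> bops"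
    and "A \<in> bops \<Longrightarrow> - A \<in> bops"
    and "A \<in> bops \<Longrightarrow> B \<in> bops \<Longrightarrow> A o\<^sub>L B \<in> bops"
    and "A \<in> bops \<Longrightarrow> r *\<^sub>R A \<in> bops"
    and "A \<in> bops \<Longrightarrow> op_scaleC c A \<in> bops"
  by (auto simp: bops_def blinfun.bilinear_simps scaleC_add_right scaleC_diff_right
      scaleC_minus_right scaleR_scaleC scaleC_scaleC mult.commute)

lemma closed_bops: "closed (bops :: 'h::chilbert_space oper set)"
proof -
  have "closed {A::'h oper. \<forall>c x. blinfun_apply A (c *\<^sub>C x) = c *\<^sub>C blinfun_apply A x}"
    by (intro closed_Collect_all closed_Collect_eq
        bounded_linear.continuous_on[OF bounded_linear_scaleC] continuous_intros)
  then show ?thesis by (simp add: bops_def)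
qed

lemma op_compose_assoc: "(A o\<^sub>L B) o\<^sub>L C = A o\<^sub>L (B o\<^sub>L C)"
  by (rule blinfun_eqI) simp

lemma op_compose_eq_apply: "A o\<^sub>L B = C o\<^sub>L D \<Longrightarrow> blinfun_apply A (blinfun_apply B x) = C (D x)"
  by (metis blinfun_apply_blinfun_compose)

lemma op_compose_id [simp]: "A o\<^sub>L id_blinfun = A" "id_blinfun o\<^sub>L A = A"
  by (rule blinfun_eqI, simp)+

lemma op_compose_0 [simp]: "A o\<^sub>L 0 = 0" "0 o\<^sub>L A = 0"
  by (rule blinfun_eqI, simp)+

lemma weak_factorization_bops:
  fixes R X :: "'h::chilbert_space oper"
  assumes R: "R \<in> bops" and X: "X \<in> bops" and K: "0 \<le> K"
    and bd: "\<And>x. norm (X x) \<le> K * norm (R x)"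
  shows "\<exists>T\<in>bops. norm T \<le> K \<and> (\<forall>y. blinfun_apply T y \<in> closure (range R)) \<and>
    (\<forall>x y. cinner (R x) (T y) = cinner (X x) y)"
proof -
  obtain T where T: "norm T \<le> K" and T_cl: "\<And>y. blinfun_apply T y \<in> closure (range R)"
    and T_eq: "\<And>x y. inner (R x) (T y) = inner (X x) y"
    using weak_factorization[OF K bd] by blast
  have "T (c *\<^sub>C y) = c *\<^sub>C T y" for c y
  proof (rule closure_range_unique[of _ R])
    have "(\<lambda>v. c *\<^sub>C v) ` closure (range R) \<subseteq> closure (range R)"
    proof (rule image_closure_subset)
      show "continuous_on (closure (range R)) (\<lambda>v. c *\<^sub>C v)"
        by (rule bounded_linear.continuous_on[OF bounded_linear_scaleC continuous_on_id])
      show "(\<lambda>v. c *\<^sub>C v) ` range R \<subseteq> closure (range R)"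
        using closure_subset[of "range R"] by (auto simp flip: bops_apply[OF R])
    qed simp
    then show "c *\<^sub>C T y \<in> closure (range R)"
      using T_cl by blast
    show "inner (R x) (T (c *\<^sub>C y)) = inner (R x) (c *\<^sub>C T y)" for x
      by (simp add: T_eq inner_scaleC_right flip: bops_apply[OF R] bops_apply[OF X])
  qed (rule T_cl)
  then have "T \<in> bops" by (simp add: bops_def)
  moreover have "cinner (R x) (T y) = cinner (X x) y" for x y
    by (simp add: cinner_eq_inner T_eq flip: bops_apply[OF R] bops_apply[OF X])
  ultimately show ?thesis using T T_cl by blast
qed

lemma op_adj_eqI:
  assumes "\<And>x y. cinner (blinfun_apply A x) y = cinner x (blinfun_apply B y)"
  shows "op_adj A = B"
  unfolding op_adj_def
proof (rule the_equality)
  show "C = B" if "\<forall>x y. cinner (blinfun_apply A x) y = cinner x (blinfun_apply C y)" for C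
    by (rule blinfun_eqI, rule cinner_ext_right) (simp flip: that[rule_format] assms)
qed (simp add: assms)

lemma op_adj_exists:
  fixes A :: "'h::chilbert_space oper"
  assumes "A \<in> bops"
  shows "op_adj A \<in> bops \<and> norm (op_adj A) \<le> norm A \<and>
    (\<forall>x y. cinner (A x) y = cinner x (op_adj A y))"
proof -
  have "\<exists>T\<in>bops. norm T \<le> norm A \<and> (\<forall>y. blinfun_apply T y \<in> closure (range (id_blinfun :: 'h oper))) \<and>
    (\<forall>x y. cinner ((id_blinfun :: 'h oper) x) (T y) = cinner (A x) y)"
    by (rule weak_factorization_bops) (simp_all add: assms norm_blinfun)
  then obtain T where T: "T \<in> bops" "norm T \<le> norm A" "\<And>x y. cinner (A x) y = cinner x (T y)"
    by (auto simp: id_blinfun.rep_eq)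
  then show ?thesis
    using op_adj_eqI[of A T] by simp
qed

lemma op_adj_bops [simp, intro]: "A \<in> bops \<Longrightarrow> op_adj A \<in> bops"
  using op_adj_exists by blast

lemma norm_op_adj_le: "A \<in> bops \<Longrightarrow> norm (op_adj A) \<le> norm A"
  using op_adj_exists by blast

lemma cinner_op_adj_right: "A \<in> bops \<Longrightarrow> cinner x (blinfun_apply (op_adj A) y) = cinner (A x) y"
  using op_adj_exists[of A] by simp

lemma cinner_op_adj_left: "A \<in> bops \<Longrightarrow> cinner (blinfun_apply (op_adj A) x) y = cinner x (A y)"
  by (metis cinner_op_adj_right cinner_commute)

lemma op_adj_simps [simp]:
  shows "op_adj 0 = 0" "op_adj id_blinfun = id_blinfun"
    and "A \<in> bops \<Longrightarrow> op_adj (op_adj A) = A"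
    and "A \<in> bops \<Longrightarrow> B \<in> bops \<Longrightarrow> op_adj (A + B) = op_adj A + op_adj B"
    and "A \<in> bops \<Longrightarrow> B \<in> bops \<Longrightarrow> op_adj (A - B) = op_adj A - op_adj B"
    and "A \<in> bops \<Longrightarrow> op_adj (- A) = - op_adj A"
    and "A \<in> bops \<Longrightarrow> B \<in> bops \<Longrightarrow> op_adj (A o\<^sub>L B) = op_adj B o\<^sub>L op_adj A"
    and "A \<in> bops \<Longrightarrow> op_adj (r *\<^sub>R A) = r *\<^sub>R op_adj A"
    and "A \<in> bops \<Longrightarrow> op_adj (op_scaleC c A) = op_scaleC (cnj c) (op_adj A)"
  by (rule op_adj_eqI, simp add: blinfun.bilinear_simps cinner_simps cinner_op_adj_left
      cinner_op_adj_right)+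

lemma norm_op_adj: "A \<in> bops \<Longrightarrow> norm (op_adj A) = norm A"
  by (metis norm_op_adj_le op_adj_bops op_adj_simps(3) order_antisym)

lemma inner_op_adj_right: "A \<in> bops \<Longrightarrow> inner x (blinfun_apply (op_adj A) y) = inner (A x) y"
  by (simp add: inner_eq_Re_cinner cinner_op_adj_right)

section \<open>Positive operators\<close>

lemma op_posD:
  assumes "op_pos A"
  shows "A \<in> bops" "op_adj A = A" "0 \<le> inner (A x) x"
proof -
  show A: "A \<in> bops" using assms by (simp add: op_pos_def)
  have real: "Im (cinner (A x) x) = 0" "0 \<le> Re (cinner (A x) x)" for x
    using assms by (auto simp: op_pos_def complex_nonneg_Reals_iff)
  then show "0 \<le> inner (A x) x" by (simp add: inner_eq_Re_cinner)
  have "cinner (A x) y = cinner x (A y)" for x y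
  proof -
    have 1: "Im (cinner (A x) y) + Im (cinner (A y) x) = 0"
      using real(1)[of "x + y"] real(1)[of x] real(1)[of y]
      by (simp add: blinfun.bilinear_simps cinner_simps)
    have 2: "Re (cinner (A y) x) = Re (cinner (A x) y)"
      using real(1)[of "x + \<i> *\<^sub>C y"] real(1)[of x] real(1)[of y]
      by (simp add: blinfun.bilinear_simps cinner_simps bops_apply[OF A])
    have "cinner (A x) y = cnj (cinner (A y) x)"
      using 1 2 by (intro complex_eqI) auto
    then show ?thesis by (metis cinner_commute)
  qed
  then show "op_adj A = A" by (rule op_adj_eqI)
qed

lemma op_posI:
  assumes "A \<in> bops" "op_adj A = A" "\<And>x. 0 \<le> inner (A x) x"
  shows "op_pos A"
proof -
  have "cinner (A x) x = cnj (cinner (A x) x)" for x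
    by (metis assms(1,2) cinner_op_adj_right cinner_commute)
  then have "Im (cinner (A x) x) = 0" for x
    by (metis Reals_cnj_iff complex_is_Real_iff)
  then show ?thesis
    using assms by (simp add: op_pos_def complex_nonneg_Reals_iff inner_eq_Re_cinner)
qed

lemma op_pos_0 [simp]: "op_pos 0"
  by (rule op_posI) auto

lemma op_pos_id [simp]: "op_pos id_blinfun"
  by (rule op_posI) auto

lemma op_pos_add: "op_pos A \<Longrightarrow> op_pos B \<Longrightarrow> op_pos (A + B)"
  by (rule op_posI) (auto simp: op_posD blinfun.bilinear_simps inner_add_left)

lemma op_pos_scaleR: "op_pos A \<Longrightarrow> 0 \<le> r \<Longrightarrow> op_pos (r *\<^sub>R A)"
  by (rule op_posI) (auto simp: op_posD blinfun.bilinear_simps)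

lemma op_pos_conj:
  assumes "op_pos A" "X \<in> bops"
  shows "op_pos (op_adj X o\<^sub>L A o\<^sub>L X)"
proof (rule op_posI)
  show "0 \<le> inner ((op_adj X o\<^sub>L A o\<^sub>L X) x) x" for x
    using op_posD(3)[OF assms(1), of "X x"] assms(2)
    by (simp add: inner_eq_Re_cinner cinner_op_adj_left)
qed (use assms in \<open>auto simp: op_posD op_compose_assoc\<close>)

lemma op_pos_adj_compose: "X \<in> bops \<Longrightarrow> op_pos (op_adj X o\<^sub>L X)"
  using op_pos_conj[OF op_pos_id] by fastforce

lemma op_pos_square: "op_pos A \<Longrightarrow> op_pos (A o\<^sub>L A)"
  using op_pos_adj_compose[of A] by (simp add: op_posD)

text \<open>This replaces the Cauchy--Schwarz inequality for the form of \<open>A\<close>; it comes from testing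
  the positivity of \<open>A\<close> on \<open>x - A x\<close>.\<close>

lemma op_pos_norm_le:
  assumes A: "op_pos A" and "norm A \<le> 1"
  shows "(norm (A x))\<^sup>2 \<le> inner (A x) x"
proof -
  have "inner (A (A x)) (A x) \<le> norm (A (A x)) * norm (A x)"
    by (rule norm_cauchy_schwarz)
  also have "\<dots> \<le> (norm A * norm (A x)) * norm (A x)"
    by (intro mult_right_mono norm_blinfun) simp
  also have "\<dots> \<le> (1 * norm (A x)) * norm (A x)"
    by (intro mult_right_mono assms) auto
  finally have 1: "inner (A (A x)) (A x) \<le> (norm (A x))\<^sup>2"
    by (simp add: power2_eq_square)
  have 2: "inner (A (A x)) x = (norm (A x))\<^sup>2"
    using inner_op_adj_right[of A x "A x"] op_posD(1,2)[OF A]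
    by (simp add: inner_commute power2_norm_eq_inner)
  have "0 \<le> inner (A (x - A x)) (x - A x)"
    by (rule op_posD(3)[OF A])
  also have "\<dots> = inner (A x) x - 2 * (norm (A x))\<^sup>2 + inner (A (A x)) (A x)"
    using 2 by (simp add: blinfun.bilinear_simps inner_diff_left inner_diff_right
        power2_norm_eq_inner algebra_simps)
  finally show ?thesis using 1 by simp
qed

lemma op_pos_eq_0:
  assumes A: "op_pos A" and 0: "inner (A x) x = 0"
  shows "A x = 0"
proof -
  define r where "r = inverse (norm A + 1)"
  have r: "0 < r" by (simp add: r_def add_nonneg_pos)
  have "norm (r *\<^sub>R A) \<le> 1"
    using r by (simp add: r_def field_simps add_nonneg_pos)
  then have "(norm ((r *\<^sub>R A) x))\<^sup>2 \<le> inner ((r *\<^sub>R A) x) x"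
    using r by (intro op_pos_norm_le op_pos_scaleR A) auto
  then show ?thesis using 0 r by (simp add: blinfun.bilinear_simps)
qed

instance chilbert_space \<subseteq> banach
  by standard

section \<open>Square roots\<close>

text \<open>If \<open>\<parallel>B\<parallel> \<le> 1\<close>, the fixed point \<open>Y = (B + Y\<^sup>2)/2\<close> reached from \<open>0\<close> satisfies \<open>(1 - Y)\<^sup>2 = 1 - B\<close>.\<close>

primrec sqrt_iter :: "'h::chilbert_space oper \<Rightarrow> nat \<Rightarrow> 'h oper" where
  "sqrt_iter B 0 = 0"
| "sqrt_iter B (Suc n) = (1/2) *\<^sub>R (B + (sqrt_iter B n o\<^sub>L sqrt_iter B n))"

text \<open>The same iteration for the number \<open>1\<close>. It increases to \<open>1\<close>, and its increments dominate those of
  the operator iteration, which therefore converges in norm; so the square root inherits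
  everything that is stable under norm limits of polynomials.\<close>

primrec sqrt_majorant :: "nat \<Rightarrow> real" where
  "sqrt_majorant 0 = 0"
| "sqrt_majorant (Suc n) = (1 + (sqrt_majorant n)\<^sup>2) / 2"

lemma sqrt_majorant_bounds: "0 \<le> sqrt_majorant n \<and> sqrt_majorant n \<le> 1"
  by (induction n) (auto simp: power_le_one_iff)

lemma sqrt_majorant_convergent: "convergent sqrt_majorant"
proof -
  have "incseq sqrt_majorant"
  proof (rule incseq_SucI)
    show "sqrt_majorant n \<le> sqrt_majorant (Suc n)" for n
      using zero_le_power2[of "sqrt_majorant n - 1"] by (simp add: power2_diff)
  qed
  moreover have "Bseq sqrt_majorant"
    by (rule BseqI'[of _ 1]) (use sqrt_majorant_bounds in auto)
  ultimately show ?thesis by (simp add: Bseq_mono_convergent incseq_def)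
qed

lemma sqrt_iter_bounds:
  assumes "norm B \<le> 1"
  shows "norm (sqrt_iter B n) \<le> sqrt_majorant n"
    and "norm (sqrt_iter B (Suc n) - sqrt_iter B n) \<le> sqrt_majorant (Suc n) - sqrt_majorant n"
proof -
  show *: "norm (sqrt_iter B n) \<le> sqrt_majorant n" for n
  proof (induction n)
    case (Suc n)
    let ?Y = "sqrt_iter B n"
    have "norm (?Y o\<^sub>L ?Y) \<le> norm ?Y * norm ?Y" by (rule norm_blinfun_compose)
    also have "\<dots> \<le> (sqrt_majorant n)\<^sup>2"
      unfolding power2_eq_square by (intro mult_mono Suc norm_ge_zero) (use sqrt_majorant_bounds in auto)
    finally have "norm (B + (?Y o\<^sub>L ?Y)) \<le> 1 + (sqrt_majorant n)\<^sup>2"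
      using assms by (intro norm_triangle_le add_mono)
    then show ?case by simp
  qed simp
  show "norm (sqrt_iter B (Suc n) - sqrt_iter B n) \<le> sqrt_majorant (Suc n) - sqrt_majorant n"
  proof (induction n)
    case (Suc n)
    let ?Y = "sqrt_iter B (Suc n)" and ?Z = "sqrt_iter B n"
    let ?y = "sqrt_majorant (Suc n)" and ?z = "sqrt_majorant n"
    have eq: "sqrt_iter B (Suc (Suc n)) - ?Y = (1/2) *\<^sub>R ((?Y o\<^sub>L (?Y - ?Z)) + ((?Y - ?Z) o\<^sub>L ?Z))"
      by (rule blinfun_eqI) (simp add: blinfun.bilinear_simps algebra_simps)
    have "(1 + y\<^sup>2) / 2 - (1 + z\<^sup>2) / 2 = (1/2) * (y * (y - z) + (y - z) * z)" for y z :: real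
      by (simp add: power2_eq_square field_simps)
    then have y2: "sqrt_majorant (Suc (Suc n)) - ?y = (1/2) * (?y * (?y - ?z) + (?y - ?z) * ?z)"
      by (metis sqrt_majorant.simps(2))
    have "norm ((?Y o\<^sub>L (?Y - ?Z)) + ((?Y - ?Z) o\<^sub>L ?Z)) \<le>
        norm ?Y * norm (?Y - ?Z) + norm (?Y - ?Z) * norm ?Z"
      by (intro norm_triangle_le add_mono norm_blinfun_compose)
    also have "\<dots> \<le> ?y * (?y - ?z) + (?y - ?z) * ?z"
      using Suc.IH *[of "Suc n"] *[of n] order_trans[OF norm_ge_zero Suc.IH]
      by (intro add_mono mult_mono norm_ge_zero) (use sqrt_majorant_bounds in auto)
    finally show ?case
      unfolding eq norm_scaleR y2 by (simp del: sqrt_iter.simps sqrt_majorant.simps)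
  qed (simp add: assms)
qed

lemma sqrt_iter_convergent:
  fixes B :: "'h::chilbert_space oper"
  assumes "norm B \<le> 1"
  shows "convergent (sqrt_iter B)"
proof -
  have step: "norm (sqrt_iter B (n + k) - sqrt_iter B n) \<le> sqrt_majorant (n + k) - sqrt_majorant n" for n k
  proof (induction k)
    case (Suc k)
    have "norm (sqrt_iter B (n + Suc k) - sqrt_iter B n) \<le>
      norm (sqrt_iter B (Suc (n + k)) - sqrt_iter B (n + k)) + norm (sqrt_iter B (n + k) - sqrt_iter B n)"
      using norm_triangle_ineq[of "sqrt_iter B (Suc (n + k)) - sqrt_iter B (n + k)"
          "sqrt_iter B (n + k) - sqrt_iter B n"] by (simp del: sqrt_iter.simps)
    with Suc sqrt_iter_bounds(2)[OF assms, of "n + k"] show ?case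
      by (simp del: sqrt_iter.simps sqrt_majorant.simps)
  qed simp
  have "Cauchy (sqrt_iter B)"
  proof (rule CauchyI')
    fix e :: real assume "0 < e"
    then obtain N where N: "\<And>m n. N \<le> m \<Longrightarrow> N \<le> n \<Longrightarrow> norm (sqrt_majorant m - sqrt_majorant n) < e"
      using CauchyD[OF convergent_Cauchy[OF sqrt_majorant_convergent]] by blast
    have "dist (sqrt_iter B m) (sqrt_iter B n) < e" if "N \<le> m" "m < n" for m n
    proof -
      have "norm (sqrt_iter B n - sqrt_iter B m) \<le> sqrt_majorant n - sqrt_majorant m"
        using step[of m "n - m"] that by simp
      also have "\<dots> < e" using N[of n m] that by simp
      finally show ?thesis by (simp add: dist_norm norm_minus_commute)
    qed
    then show "\<exists>M. \<forall>m\<ge>M. \<forall>n>m. dist (sqrt_iter B m) (sqrt_iter B n) < e" by blast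
  qed
  then show ?thesis by (rule Cauchy_convergent)
qed

lemma op_sqrt_exists_contraction:
  fixes A :: "'h::chilbert_space oper"
  assumes A: "op_pos A" and "norm A \<le> 1"
  shows "\<exists>S. op_pos S \<and> S o\<^sub>L S = A \<and> (\<forall>C. C o\<^sub>L A = A o\<^sub>L C \<longrightarrow> C o\<^sub>L S = S o\<^sub>L C)"
proof -
  \<comment> \<open>The iteration is run on \<open>1 - A\<close>, which is a contraction because \<open>A\<^sup>2 \<le> A\<close> as forms.\<close>
  define B where "B = id_blinfun - A"
  have B: "B \<in> bops" "op_adj B = B"
    using A by (simp_all add: B_def op_posD)
  have "(norm (B x))\<^sup>2 \<le> (norm x)\<^sup>2" for x
    using op_pos_norm_le[OF assms, of x] op_posD(3)[OF A, of x]
    by (simp add: B_def power2_norm_eq_inner blinfun.bilinear_simps inner_diff_left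
        inner_diff_right inner_commute)
  then have nB: "norm B \<le> 1"
    by (intro norm_blinfun_bound) (auto simp: abs_le_square_iff[symmetric])
  obtain Y where Y: "sqrt_iter B \<longlonglongrightarrow> Y"
    using sqrt_iter_convergent[OF nB] convergentD by blast
  have lim: "Y \<in> S" if "closed S" "\<And>n. sqrt_iter B n \<in> S" for S
    using closed_sequentially[OF that(1) _ Y] that(2) by blast
  have "sqrt_iter B n \<in> bops \<and> op_adj (sqrt_iter B n) = sqrt_iter B n" for n
    by (induction n) (simp_all add: B)
  then have inv: "sqrt_iter B n \<in> bops" "cinner (sqrt_iter B n x) y = cinner x (sqrt_iter B n y)" for n x y
    by (simp, metis cinner_op_adj_left)
  have Yb: "Y \<in> bops"
    by (rule lim[OF closed_bops]) (rule inv)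
  have nY: "norm Y \<le> 1"
    using lim[OF closed_cball[of 0 1]] order_trans[OF sqrt_iter_bounds(1)[OF nB]] sqrt_majorant_bounds
    by fastforce
  have Ysa: "op_adj Y = Y"
  proof (rule op_adj_eqI)
    fix x y
    have c: "(\<lambda>n. blinfun_apply (sqrt_iter B n) z) \<longlonglongrightarrow> Y z" for z
      by (intro tendsto_intros Y)
    have "inner (Y x) y = inner x (Y y)" for x y
    proof (rule LIMSEQ_unique)
      show "(\<lambda>n. inner (sqrt_iter B n x) y) \<longlonglongrightarrow> inner (Y x) y"
        by (intro tendsto_intros c)
      show "(\<lambda>n. inner (sqrt_iter B n x) y) \<longlonglongrightarrow> inner x (Y y)"
        unfolding inner_eq_Re_cinner inv(2) unfolding inner_eq_Re_cinner[symmetric]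
        by (intro tendsto_intros c)
    qed
    then show "cinner (Y x) y = cinner x (Y y)"
      by (simp add: cinner_eq_inner flip: bops_apply[OF Yb])
  qed
  have "(\<lambda>n. sqrt_iter B (Suc n)) \<longlonglongrightarrow> (1/2) *\<^sub>R (B + (Y o\<^sub>L Y))"
    unfolding sqrt_iter.simps
    by (intro tendsto_intros Y bounded_bilinear.tendsto[OF bounded_bilinear_blinfun_compose])
  then have fix_eq: "Y = (1/2) *\<^sub>R (B + (Y o\<^sub>L Y))"
    using LIMSEQ_unique LIMSEQ_Suc[OF Y] by blast
  define S where "S = id_blinfun - Y"
  have "S o\<^sub>L S = id_blinfun - 2 *\<^sub>R Y + (Y o\<^sub>L Y)"
    by (rule blinfun_eqI) (simp add: S_def blinfun.bilinear_simps scaleR_2)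
  also have "2 *\<^sub>R Y = B + (Y o\<^sub>L Y)"
    using arg_cong[OF fix_eq, of "\<lambda>T. 2 *\<^sub>R T"] by simp
  finally have SS: "S o\<^sub>L S = A"
    by (simp add: B_def)
  have "op_pos S"
  proof (rule op_posI)
    fix x
    have "inner (Y x) x \<le> norm (Y x) * norm x" by (rule norm_cauchy_schwarz)
    also have "\<dots> \<le> (norm Y * norm x) * norm x" by (intro mult_right_mono norm_blinfun) simp
    also have "\<dots> \<le> (1 * norm x) * norm x" by (intro mult_right_mono nY) auto
    finally show "0 \<le> inner (S x) x"
      by (simp add: S_def blinfun.bilinear_simps inner_diff_left dot_square_norm power2_eq_square)
  qed (simp_all add: S_def Yb Ysa)
  moreover have "C o\<^sub>L S = S o\<^sub>L C" if C: "C o\<^sub>L A = A o\<^sub>L C" for C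
  proof -
    have CA: "C (A x) = A (C x)" for x
      by (rule op_compose_eq_apply[OF C])
    have "C o\<^sub>L sqrt_iter B n = sqrt_iter B n o\<^sub>L C" for n
    proof (induction n)
      case (Suc n)
      then have "C (sqrt_iter B n x) = sqrt_iter B n (C x)" for x
        by (rule op_compose_eq_apply)
      with CA show ?case
        by (intro blinfun_eqI) (simp add: B_def blinfun.bilinear_simps)
    qed simp
    then have "C o\<^sub>L Y = Y o\<^sub>L C"
      by (intro lim[of "{T. C o\<^sub>L T = T o\<^sub>L C}", simplified] closed_Collect_eq
          bounded_bilinear.continuous_on[OF bounded_bilinear_blinfun_compose] continuous_intros)
    then have "C (Y x) = Y (C x)" for x
      by (rule op_compose_eq_apply)
    then show ?thesis
      by (intro blinfun_eqI) (simp add: S_def blinfun.bilinear_simps)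
  qed
  ultimately show ?thesis using SS by blast
qed

lemma op_sqrt_exists:
  assumes A: "op_pos A"
  shows "\<exists>S. op_pos S \<and> S o\<^sub>L S = A \<and> (\<forall>C. C o\<^sub>L A = A o\<^sub>L C \<longrightarrow> C o\<^sub>L S = S o\<^sub>L C)"
proof -
  define r where "r = norm A + 1"
  have r: "0 < r" by (simp add: r_def add_nonneg_pos)
  have "norm (inverse r *\<^sub>R A) \<le> 1"
    using r by (simp add: r_def field_simps)
  moreover have "op_pos (inverse r *\<^sub>R A)"
    using r by (intro op_pos_scaleR A) simp
  ultimately obtain S where S: "op_pos S" "S o\<^sub>L S = inverse r *\<^sub>R A"
    "\<And>C. C o\<^sub>L (inverse r *\<^sub>R A) = (inverse r *\<^sub>R A) o\<^sub>L C \<Longrightarrow> C o\<^sub>L S = S o\<^sub>L C"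
    using op_sqrt_exists_contraction by blast
  show ?thesis
  proof (intro exI[of _ "sqrt r *\<^sub>R S"] conjI allI impI)
    show "op_pos (sqrt r *\<^sub>R S)" using S(1) r by (simp add: op_pos_scaleR)
    have "(sqrt r *\<^sub>R S) o\<^sub>L (sqrt r *\<^sub>R S) = r *\<^sub>R (S o\<^sub>L S)"
      using r by (intro blinfun_eqI) (simp add: blinfun.bilinear_simps)
    then show "(sqrt r *\<^sub>R S) o\<^sub>L (sqrt r *\<^sub>R S) = A" using S(2) r by simp
    fix C assume "C o\<^sub>L A = A o\<^sub>L C"
    then have "C o\<^sub>L S = S o\<^sub>L C"
      by (intro S(3)) (simp add: bounded_bilinear.scaleR_left[OF bounded_bilinear_blinfun_compose]
          bounded_bilinear.scaleR_right[OF bounded_bilinear_blinfun_compose])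
    then show "C o\<^sub>L (sqrt r *\<^sub>R S) = (sqrt r *\<^sub>R S) o\<^sub>L C"
      by (simp add: bounded_bilinear.scaleR_left[OF bounded_bilinear_blinfun_compose]
          bounded_bilinear.scaleR_right[OF bounded_bilinear_blinfun_compose])
  qed
qed

text \<open>For commuting roots, \<open>(R + S)(R - S) = R\<^sup>2 - S\<^sup>2 = 0\<close>, so both positive forms vanish on the range
  of \<open>R - S\<close>.\<close>

lemma op_sqrt_unique_aux:
  assumes R: "op_pos R" and S: "op_pos S" and eq: "R o\<^sub>L R = S o\<^sub>L S" and comm: "R o\<^sub>L S = S o\<^sub>L R"
  shows "R = S"
proof (rule blinfun_eqI)
  fix x
  have comm': "R (S z) = S (R z)" and eq': "R (R z) = S (S z)" for z
    by (rule op_compose_eq_apply, fact)+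
  define y where "y = R x - S x"
  have "R y + S y = 0"
    by (simp add: y_def blinfun.bilinear_simps comm' eq')
  then have "inner (R y) y + inner (S y) y = 0"
    by (metis inner_add_left inner_zero_left)
  with op_posD(3)[OF R, of y] op_posD(3)[OF S, of y]
  have "inner (R y) y = 0" "inner (S y) y = 0" by linarith+
  then have "R y = 0" "S y = 0"
    using op_pos_eq_0 R S by blast+
  then have "inner y (R x) = 0" "inner y (S x) = 0"
    using inner_op_adj_right[of R y x] inner_op_adj_right[of S y x] op_posD(1,2)[OF R] op_posD(1,2)[OF S]
    by simp_all
  then have "inner y y = 0"
    by (subst (2) y_def) (simp add: inner_diff_right)
  then show "R x = S x" by (simp add: y_def)
qed

text \<open>Any positive root commutes with its square, hence with the root constructed by the iteration;
  the commuting case compares both roots with that one.\<close>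

lemma op_sqrt_unique:
  assumes R: "op_pos R" and S: "op_pos S" and eq: "R o\<^sub>L R = S o\<^sub>L S"
  shows "R = S"
proof -
  obtain Q where Q: "op_pos Q" "Q o\<^sub>L Q = S o\<^sub>L S"
    and comm: "\<And>C. C o\<^sub>L (S o\<^sub>L S) = (S o\<^sub>L S) o\<^sub>L C \<Longrightarrow> C o\<^sub>L Q = Q o\<^sub>L C"
    using op_sqrt_exists[OF op_pos_square[OF S]] by blast
  have RQ: "R o\<^sub>L Q = Q o\<^sub>L R"
    by (rule comm) (simp add: op_compose_assoc flip: eq)
  have SQ: "S o\<^sub>L Q = Q o\<^sub>L S"
    by (rule comm) (rule op_compose_assoc[symmetric])
  have "R = Q"
    by (rule op_sqrt_unique_aux[OF R Q(1) _ RQ]) (rule trans[OF eq Q(2)[symmetric]])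
  moreover have "S = Q"
    by (rule op_sqrt_unique_aux[OF S Q(1) _ SQ]) (rule Q(2)[symmetric])
  ultimately show ?thesis by (rule trans[OF _ sym])
qed

definition op_sqrt :: "'h::chilbert_space oper \<Rightarrow> 'h oper" where
  "op_sqrt A = (THE R. op_pos R \<and> R o\<^sub>L R = A)"

lemma op_sqrt_eqI: "op_pos R \<Longrightarrow> R o\<^sub>L R = A \<Longrightarrow> op_sqrt A = R"
  unfolding op_sqrt_def
proof (rule the_equality)
  show "R' = R" if "op_pos R" "R o\<^sub>L R = A" "op_pos R' \<and> R' o\<^sub>L R' = A" for R'
    by (rule op_sqrt_unique) (use that in simp_all)
qed blast

lemma op_sqrt:
  assumes "op_pos A"
  shows "op_pos (op_sqrt A)" "op_sqrt A o\<^sub>L op_sqrt A = A"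
    and "C o\<^sub>L A = A o\<^sub>L C \<Longrightarrow> C o\<^sub>L op_sqrt A = op_sqrt A o\<^sub>L C"
proof -
  obtain S where S: "op_pos S \<and> S o\<^sub>L S = A \<and> (\<forall>C. C o\<^sub>L A = A o\<^sub>L C \<longrightarrow> C o\<^sub>L S = S o\<^sub>L C)"
    using op_sqrt_exists[OF assms] ..
  have eq: "op_sqrt A = S" by (rule op_sqrt_eqI[OF conjunct1[OF S] conjunct1[OF conjunct2[OF S]]])
  show "op_pos (op_sqrt A)" "op_sqrt A o\<^sub>L op_sqrt A = A"
    unfolding eq by (rule conjunct1[OF S], rule conjunct1[OF conjunct2[OF S]])
  show "C o\<^sub>L op_sqrt A = op_sqrt A o\<^sub>L C" if "C o\<^sub>L A = A o\<^sub>L C"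
    unfolding eq by (rule conjunct2[OF conjunct2[OF S], rule_format, OF that])
qed

lemma op_abs_eq_sqrt: "op_abs X = op_sqrt (op_adj X o\<^sub>L X)"
  by (simp add: op_abs_def op_sqrt_def)

lemma op_abs:
  assumes "X \<in> bops"
  shows "op_pos (op_abs X)" "op_abs X o\<^sub>L op_abs X = op_adj X o\<^sub>L X"
  by (simp_all add: op_abs_eq_sqrt op_sqrt(1,2) op_pos_adj_compose assms)

lemma op_abs_pos: "op_pos A \<Longrightarrow> op_abs A = A"
  unfolding op_abs_eq_sqrt by (rule op_sqrt_eqI) (simp_all add: op_posD)

section \<open>Von Neumann algebras\<close>

lemma op_eqI: "(\<And>x y. cinner (blinfun_apply A x) y = cinner (blinfun_apply B x) y) \<Longrightarrow> A = B"
  by (rule blinfun_eqI) (metis cinner_commute cinner_ext_right)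

locale von_neumann =
  fixes M :: "'h::chilbert_space oper set"
  assumes vN: "von_neumann_algebra M"
begin

lemma M_bops [simp]: "A \<in> M \<Longrightarrow> A \<in> bops"
  using vN by (auto simp: von_neumann_algebra_def)

lemma M_adj [simp]: "A \<in> M \<Longrightarrow> op_adj A \<in> M"
  using vN by (auto simp: von_neumann_algebra_def)

lemma M_I: "A \<in> bops \<Longrightarrow> (\<And>B. B \<in> commutant M \<Longrightarrow> A o\<^sub>L B = B o\<^sub>L A) \<Longrightarrow> A \<in> M"
  using vN by (auto simp: von_neumann_algebra_def commutant_def[of "commutant M"])

lemma commutant_bops: "B \<in> commutant M \<Longrightarrow> B \<in> bops"
  by (simp add: commutant_def)

lemma commutantD: "B \<in> commutant M \<Longrightarrow> A \<in> M \<Longrightarrow> B (A x) = A (B x)"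
  by (rule op_compose_eq_apply) (simp add: commutant_def)

lemma commutant_adj:
  assumes "B \<in> commutant M"
  shows "op_adj B \<in> commutant M"
proof -
  have "op_adj B o\<^sub>L A = A o\<^sub>L op_adj B" if A: "A \<in> M" for A
  proof -
    have "B o\<^sub>L op_adj A = op_adj A o\<^sub>L B"
      using assms A by (simp add: commutant_def)
    then have "op_adj (B o\<^sub>L op_adj A) = op_adj (op_adj A o\<^sub>L B)" by simp
    with A commutant_bops[OF assms] show ?thesis by simp
  qed
  then show ?thesis
    using commutant_bops[OF assms] by (simp add: commutant_def)
qed

lemma M_I_pointwise:
  assumes "A \<in> bops"
    and "\<And>B x. B \<in> bops \<Longrightarrow> (\<And>C y. C \<in> M \<Longrightarrow> B (C y) = C (B y)) \<Longrightarrow> A (B x) = B (A x)"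
  shows "A \<in> M"
proof (rule M_I[OF assms(1)], rule blinfun_eqI)
  show "(A o\<^sub>L B) x = (B o\<^sub>L A) x" if "B \<in> commutant M" for B x
    using assms(2)[OF commutant_bops[OF that] commutantD[OF that]] by simp
qed

lemma M_closed [simp]:
  shows "0 \<in> M" "id_blinfun \<in> M"
    and "A \<in> M \<Longrightarrow> B \<in> M \<Longrightarrow> A + B \<in> M"
    and "A \<in> M \<Longrightarrow> B \<in> M \<Longrightarrow> A - B \<in> M"
    and "A \<in> M \<Longrightarrow> - A \<in> M"
    and "A \<in> M \<Longrightarrow> B \<in> M \<Longrightarrow> A o\<^sub>L B \<in> M"
    and "A \<in> M \<Longrightarrow> r *\<^sub>R A \<in> M"
    and "A \<in> M \<Longrightarrow> op_scaleC c A \<in> M"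
  by (rule M_I_pointwise; simp add: blinfun.bilinear_simps bops_apply)+

lemma M_sum [simp]: "(\<And>i. i \<in> I \<Longrightarrow> f i \<in> M) \<Longrightarrow> sum f I \<in> M"
  by (induction I rule: infinite_finite_induct) auto

lemma op_sqrt_M [simp]:
  assumes "A \<in> M" "op_pos A"
  shows "op_sqrt A \<in> M"
proof (rule M_I)
  show "op_sqrt A o\<^sub>L B = B o\<^sub>L op_sqrt A" if "B \<in> commutant M" for B
    by (rule op_sqrt(3)[OF assms(2), symmetric]) (use that assms in \<open>simp add: commutant_def\<close>)
qed (rule op_posD(1)[OF op_sqrt(1)[OF assms(2)]])

lemma op_abs_M [simp]: "X \<in> M \<Longrightarrow> op_abs X \<in> M"
  by (simp add: op_abs_eq_sqrt op_pos_adj_compose)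

text \<open>Here \<open>T\<close> is the adjoint of the usual partial isometry. It lies in \<open>M\<close> because \<open>B\<close> in the commutant
  commutes with \<open>|X|\<close> and \<open>X\<close>, so that \<open>T B y\<close> and \<open>B T y\<close> are characterized by the same inner
  products within the closure of the range of \<open>|X|\<close>.\<close>

lemma polar_decomposition:
  assumes X: "X \<in> M"
  shows "\<exists>T\<in>M. norm T \<le> 1 \<and> T o\<^sub>L X = op_abs X \<and> op_adj T o\<^sub>L op_abs X = X"
proof -
  define R where "R = op_abs X"
  have Xb: "X \<in> bops" and RM: "R \<in> M" and R: "op_pos R" "op_adj R = R"
    using X op_abs(1)[of X] by (simp_all add: R_def op_posD)
  have RR: "op_adj R o\<^sub>L R = op_adj X o\<^sub>L X"
    using op_abs(2)[OF Xb] R(2) by (simp add: R_def)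
  have RX: "cinner (R x) (R y) = cinner (X x) (X y)" for x y
    using op_compose_eq_apply[OF RR, of x] Xb RM by (metis M_bops cinner_op_adj_left)
  have "norm (X x) = norm (R x)" for x
    by (simp add: norm_eq_sqrt_inner inner_eq_Re_cinner RX)
  then obtain T where Tb: "T \<in> bops" and nT: "norm T \<le> 1"
    and Tcl: "\<And>y. blinfun_apply T y \<in> closure (range R)"
    and TRX: "\<And>x y. cinner (R x) (T y) = cinner (X x) y"
    using weak_factorization_bops[of R X 1] Xb M_bops[OF RM] by auto
  have T_in: "T \<in> M"
  proof (rule M_I[OF Tb], rule blinfun_eqI)
    fix B y assume B: "B \<in> commutant M"
    have "T (B y) = B (T y)"
    proof (rule closure_range_unique[of _ R])
      have "blinfun_apply B ` closure (range R) \<subseteq> closure (range R)"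
      proof (rule image_closure_subset)
        show "blinfun_apply B ` range R \<subseteq> closure (range R)"
          using closure_subset[of "range R"] by (auto simp: commutantD[OF B RM])
      qed (auto intro: continuous_intros)
      then show "B (T y) \<in> closure (range R)" using Tcl by blast
      fix x
      have "cinner (R x) (B (T y)) = cinner (op_adj B (R x)) (T y)"
        by (simp add: cinner_op_adj_left commutant_bops[OF B])
      also have "\<dots> = cinner (X (op_adj B x)) y"
        by (simp add: commutantD[OF commutant_adj[OF B]] RM TRX)
      also have "\<dots> = cinner (op_adj B (X x)) y"
        by (simp add: commutantD[OF commutant_adj[OF B]] X)
      also have "\<dots> = cinner (R x) (T (B y))"
        by (simp add: cinner_op_adj_left commutant_bops[OF B] TRX)
      finally show "inner (R x) (T (B y)) = inner (R x) (B (T y))"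
        by (simp add: inner_eq_Re_cinner)
    qed (rule Tcl)
    then show "(T o\<^sub>L B) y = (B o\<^sub>L T) y" by simp
  qed
  have "T o\<^sub>L X = R"
  proof (rule blinfun_eqI)
    fix x
    have "T (X x) = R x"
    proof (rule closure_range_unique[of _ R])
      show "R x \<in> closure (range R)"
        by (rule subsetD[OF closure_subset]) simp
    qed (simp_all add: Tcl inner_eq_Re_cinner TRX RX)
    then show "(T o\<^sub>L X) x = R x" by simp
  qed
  moreover have "op_adj T o\<^sub>L R = X"
    by (rule op_eqI) (simp add: cinner_op_adj_left Tb TRX)
  ultimately show ?thesis
    using T_in nT by (auto simp: R_def)
qed

end

section \<open>The trace as a linear functional\<close>

locale vn_trace = von_neumann M for M :: "'h::chilbert_space oper set" +
  fixes \<rho> :: "'h oper \<Rightarrow> ennreal"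
  assumes trace: "is_trace M \<rho>"
begin

definition fin_pos :: "'h oper set" where
  "fin_pos = {A \<in> M. op_pos A \<and> \<rho> A < \<infinity>}"

definition rtr :: "'h oper \<Rightarrow> real" where
  "rtr A = enn2real (\<rho> A)"

lemma rtr_nonneg [simp]: "0 \<le> rtr A"
  by (simp add: rtr_def)

lemma rho_add: "A \<in> M \<Longrightarrow> op_pos A \<Longrightarrow> B \<in> M \<Longrightarrow> op_pos B \<Longrightarrow> \<rho> (A + B) = \<rho> A + \<rho> B"
  using trace by (auto simp: is_trace_def pos_part_def)

lemma rho_scale: "A \<in> M \<Longrightarrow> op_pos A \<Longrightarrow> 0 \<le> r \<Longrightarrow> \<rho> (r *\<^sub>R A) = ennreal r * \<rho> A"
  using trace by (auto simp: is_trace_def pos_part_def)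

lemma rho_comm: "A \<in> M \<Longrightarrow> \<rho> (op_adj A o\<^sub>L A) = \<rho> (A o\<^sub>L op_adj A)"
  using trace by (auto simp: is_trace_def)

lemma rtr_comm: "A \<in> M \<Longrightarrow> rtr (op_adj A o\<^sub>L A) = rtr (A o\<^sub>L op_adj A)"
  by (simp add: rtr_def rho_comm)

lemma rho_mono:
  assumes "A \<in> M" "op_pos A" "B \<in> M" "op_pos (B - A)"
  shows "\<rho> A \<le> \<rho> B"
  using rho_add[of A "B - A"] assms by simp

lemma fin_posD: "A \<in> fin_pos \<Longrightarrow> A \<in> M" "A \<in> fin_pos \<Longrightarrow> op_pos A" "A \<in> fin_pos \<Longrightarrow> \<rho> A < top"
  by (simp_all add: fin_pos_def)

lemma fin_pos_le:
  assumes "A \<in> M" "op_pos A" "B \<in> fin_pos" "op_pos (B - A)"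
  shows "A \<in> fin_pos" "rtr A \<le> rtr B"
proof -
  have "\<rho> A \<le> \<rho> B" using assms by (intro rho_mono) (auto simp: fin_posD)
  then show "A \<in> fin_pos" "rtr A \<le> rtr B"
    using assms fin_posD(3)[OF assms(3)]
    by (auto simp: fin_pos_def rtr_def enn2real_mono intro: order.strict_trans1)
qed

lemma fin_pos_add:
  assumes "A \<in> fin_pos" "B \<in> fin_pos"
  shows "A + B \<in> fin_pos" "rtr (A + B) = rtr A + rtr B"
  using assms by (auto simp: fin_pos_def rtr_def rho_add op_pos_add enn2real_plus)

lemma fin_pos_scaleR:
  assumes "A \<in> fin_pos" "0 \<le> r"
  shows "r *\<^sub>R A \<in> fin_pos" "rtr (r *\<^sub>R A) = r * rtr A"
  using assms by (auto simp: fin_pos_def rtr_def rho_scale op_pos_scaleR ennreal_mult_less_top enn2real_mult)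

lemma fin_pos_0: "0 \<in> fin_pos" "rtr 0 = 0"
  using rho_scale[of 0 0] by (auto simp: fin_pos_def rtr_def)

text \<open>\<open>X\<close> is decomposed into its real and imaginary parts, each a difference of positive elements of finite trace;
  \<open>c\<close> is the resulting value of the trace, which \<open>decomp_unique\<close> shows to be independent of the
  decomposition.\<close>

definition decomp :: "'h oper \<Rightarrow> complex \<Rightarrow> bool" where
  "decomp X c \<longleftrightarrow> (\<exists>A\<in>fin_pos. \<exists>B\<in>fin_pos. \<exists>C\<in>fin_pos. \<exists>D\<in>fin_pos.
     X = (A - B) + op_scaleC \<i> (C - D) \<and> c = Complex (rtr A - rtr B) (rtr C - rtr D))"

definition trace_class :: "'h oper set" where
  "trace_class = {X. \<exists>c. decomp X c}"

definition tr :: "'h oper \<Rightarrow> complex" where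
  "tr X = (THE c. decomp X c)"

lemma decompI:
  assumes "A \<in> fin_pos" "B \<in> fin_pos" "C \<in> fin_pos" "D \<in> fin_pos"
    and "X = (A - B) + op_scaleC \<i> (C - D)" "c = Complex (rtr A - rtr B) (rtr C - rtr D)"
  shows "decomp X c"
  using assms unfolding decomp_def by blast

lemma diff_fin_pos_unique:
  assumes "A \<in> fin_pos" "B \<in> fin_pos" "A' \<in> fin_pos" "B' \<in> fin_pos" "A - B = A' - B'"
  shows "rtr A - rtr B = rtr A' - rtr B'"
proof -
  have "A + B' = A' + B" using assms(5) by (simp add: algebra_simps)
  then have "rtr (A + B') = rtr (A' + B)" by simp
  with assms show ?thesis by (simp add: fin_pos_add)
qed

lemma decomp_unique:
  assumes "decomp X c" "decomp X c'"
  shows "c = c'"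
proof -
  obtain A B C D where P: "A \<in> fin_pos" "B \<in> fin_pos" "C \<in> fin_pos" "D \<in> fin_pos"
    and X: "X = (A - B) + op_scaleC \<i> (C - D)" and c: "c = Complex (rtr A - rtr B) (rtr C - rtr D)"
    using assms(1) by (auto simp: decomp_def)
  obtain A' B' C' D' where P': "A' \<in> fin_pos" "B' \<in> fin_pos" "C' \<in> fin_pos" "D' \<in> fin_pos"
    and X': "X = (A' - B') + op_scaleC \<i> (C' - D')"
    and c': "c' = Complex (rtr A' - rtr B') (rtr C' - rtr D')"
    using assms(2) by (auto simp: decomp_def)
  note posD = fin_posD(1,2) op_posD(2)
  have re: "cinner (A x) y - cinner (B x) y = (cinner (X x) y + cinner (op_adj X x) y) / 2"
    and im: "cinner (C x) y - cinner (D x) y = (cinner (X x) y - cinner (op_adj X x) y) / (2 * \<i>)" for x y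
    using P by (simp_all add: X posD blinfun.bilinear_simps cinner_simps field_simps)
  have re': "cinner (A' x) y - cinner (B' x) y = (cinner (X x) y + cinner (op_adj X x) y) / 2"
    and im': "cinner (C' x) y - cinner (D' x) y = (cinner (X x) y - cinner (op_adj X x) y) / (2 * \<i>)" for x y
    using P' by (simp_all add: X' posD blinfun.bilinear_simps cinner_simps field_simps)
  have "A - B = A' - B'" "C - D = C' - D'"
    by (rule op_eqI, simp add: blinfun.bilinear_simps cinner_simps re re' im im')+
  then have "rtr A - rtr B = rtr A' - rtr B'" "rtr C - rtr D = rtr C' - rtr D'"
    using diff_fin_pos_unique P P' by blast+
  then show ?thesis
    by (simp add: c c')
qed

lemma tr_eqI:
  assumes "decomp X c"
  shows "X \<in> trace_class \<and> tr X = c"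
proof
  show "X \<in> trace_class" using assms by (auto simp: trace_class_def)
  show "tr X = c"
    unfolding tr_def by (rule the_equality) (simp_all add: assms decomp_unique[OF _ assms])
qed

lemma decomp_tr: "X \<in> trace_class \<Longrightarrow> decomp X (tr X)"
  unfolding trace_class_def using tr_eqI by blast

lemma trace_class_M: "X \<in> trace_class \<Longrightarrow> X \<in> M"
  by (auto simp: trace_class_def decomp_def fin_posD)

lemma tr_fin_pos: "A \<in> fin_pos \<Longrightarrow> A \<in> trace_class \<and> tr A = rtr A"
  by (rule tr_eqI, rule decompI[of A 0 0 0])
    (auto simp: fin_pos_0 complex_eq_iff intro!: blinfun_eqI)

lemma tr_add:
  assumes "X \<in> trace_class" "Y \<in> trace_class"
  shows "X + Y \<in> trace_class \<and> tr (X + Y) = tr X + tr Y"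
proof (rule tr_eqI)
  obtain A B C D where P: "A \<in> fin_pos" "B \<in> fin_pos" "C \<in> fin_pos" "D \<in> fin_pos"
    and X: "X = (A - B) + op_scaleC \<i> (C - D)" and c: "tr X = Complex (rtr A - rtr B) (rtr C - rtr D)"
    using decomp_tr[OF assms(1)] by (auto simp: decomp_def)
  obtain A' B' C' D' where P': "A' \<in> fin_pos" "B' \<in> fin_pos" "C' \<in> fin_pos" "D' \<in> fin_pos"
    and Y: "Y = (A' - B') + op_scaleC \<i> (C' - D')"
    and c': "tr Y = Complex (rtr A' - rtr B') (rtr C' - rtr D')"
    using decomp_tr[OF assms(2)] by (auto simp: decomp_def)
  show "decomp (X + Y) (tr X + tr Y)"
  proof (rule decompI)
    show "X + Y = (A + A') - (B + B') + op_scaleC \<i> ((C + C') - (D + D'))"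
      unfolding X Y by (rule op_eqI) (simp add: blinfun.bilinear_simps cinner_simps algebra_simps)
  qed (use P P' in \<open>simp_all add: c c' fin_pos_add complex_eq_iff\<close>)
qed

lemma tr_scaleR_nonneg:
  assumes "X \<in> trace_class" "0 \<le> r"
  shows "r *\<^sub>R X \<in> trace_class \<and> tr (r *\<^sub>R X) = r * tr X"
proof (rule tr_eqI)
  obtain A B C D where P: "A \<in> fin_pos" "B \<in> fin_pos" "C \<in> fin_pos" "D \<in> fin_pos"
    and X: "X = (A - B) + op_scaleC \<i> (C - D)" and c: "tr X = Complex (rtr A - rtr B) (rtr C - rtr D)"
    using decomp_tr[OF assms(1)] by (auto simp: decomp_def)
  show "decomp (r *\<^sub>R X) (r * tr X)"
  proof (rule decompI)
    show "r *\<^sub>R X = (r *\<^sub>R A - r *\<^sub>R B) + op_scaleC \<i> (r *\<^sub>R C - r *\<^sub>R D)"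
      unfolding X by (rule op_eqI) (simp add: blinfun.bilinear_simps cinner_simps algebra_simps)
  qed (use P assms(2) in \<open>simp_all add: c fin_pos_scaleR complex_eq_iff algebra_simps\<close>)
qed

lemma tr_ii:
  assumes "X \<in> trace_class"
  shows "op_scaleC \<i> X \<in> trace_class \<and> tr (op_scaleC \<i> X) = \<i> * tr X"
proof (rule tr_eqI)
  obtain A B C D where P: "A \<in> fin_pos" "B \<in> fin_pos" "C \<in> fin_pos" "D \<in> fin_pos"
    and X: "X = (A - B) + op_scaleC \<i> (C - D)" and c: "tr X = Complex (rtr A - rtr B) (rtr C - rtr D)"
    using decomp_tr[OF assms(1)] by (auto simp: decomp_def)
  show "decomp (op_scaleC \<i> X) (\<i> * tr X)"
  proof (rule decompI)
    show "op_scaleC \<i> X = (D - C) + op_scaleC \<i> (A - B)"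
      unfolding X by (rule op_eqI) (simp add: blinfun.bilinear_simps cinner_simps algebra_simps)
  qed (use P in \<open>simp_all add: c complex_eq_iff\<close>)
qed

lemma tr_scaleC:
  assumes X: "X \<in> trace_class"
  shows "op_scaleC c X \<in> trace_class \<and> tr (op_scaleC c X) = c * tr X"
proof -
  have neg: "- Y \<in> trace_class \<and> tr (- Y) = - tr Y" if "Y \<in> trace_class" for Y
  proof -
    have "op_scaleC \<i> (op_scaleC \<i> Y) = - Y"
      by (rule op_eqI) (simp add: blinfun.bilinear_simps cinner_simps)
    with tr_ii[of Y] tr_ii[of "op_scaleC \<i> Y"] that show ?thesis by simp
  qed
  have real: "r *\<^sub>R Y \<in> trace_class \<and> tr (r *\<^sub>R Y) = r * tr Y" if "Y \<in> trace_class" for r Y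
    using tr_scaleR_nonneg[OF that, of r] tr_scaleR_nonneg[OF that, of "- r"]
      neg[of "(- r) *\<^sub>R Y"] by (cases "0 \<le> r") auto
  have eq: "op_scaleC c X = Re c *\<^sub>R X + Im c *\<^sub>R op_scaleC \<i> X"
    by (rule op_eqI, subst complex_eq[of c])
      (simp only: op_scaleC_apply blinfun.bilinear_simps cinner_simps, simp add: algebra_simps)
  have "tr (Re c *\<^sub>R X + Im c *\<^sub>R op_scaleC \<i> X) = (Re c + \<i> * Im c) * tr X"
    using tr_add real tr_ii X by (simp add: algebra_simps)
  with eq show ?thesis
    using tr_add real tr_ii X by (simp flip: complex_eq)
qed

lemma tr_minus: "X \<in> trace_class \<Longrightarrow> - X \<in> trace_class \<and> tr (- X) = - tr X"
proof -
  have "op_scaleC (-1) X = - X"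
    by (rule op_eqI) (simp add: blinfun.bilinear_simps cinner_simps)
  then show "X \<in> trace_class \<Longrightarrow> ?thesis" using tr_scaleC[of X "-1"] by simp
qed

lemma tr_diff: "X \<in> trace_class \<Longrightarrow> Y \<in> trace_class \<Longrightarrow> X - Y \<in> trace_class \<and> tr (X - Y) = tr X - tr Y"
  using tr_add[of X "- Y"] tr_minus[of Y] by simp

lemma tr_adj:
  assumes "X \<in> trace_class"
  shows "op_adj X \<in> trace_class \<and> tr (op_adj X) = cnj (tr X)"
proof (rule tr_eqI)
  obtain A B C D where P: "A \<in> fin_pos" "B \<in> fin_pos" "C \<in> fin_pos" "D \<in> fin_pos"
    and X: "X = (A - B) + op_scaleC \<i> (C - D)" and c: "tr X = Complex (rtr A - rtr B) (rtr C - rtr D)"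
    using decomp_tr[OF assms(1)] by (auto simp: decomp_def)
  show "decomp (op_adj X) (cnj (tr X))"
  proof (rule decompI)
    show "op_adj X = (A - B) + op_scaleC \<i> (D - C)"
      unfolding X by (rule op_eqI) (use P in \<open>simp add: fin_posD op_posD(2) blinfun.bilinear_simps cinner_simps algebra_simps\<close>)
  qed (use P in \<open>simp_all add: c complex_eq_iff\<close>)
qed

text \<open>A positive \<open>X\<close> equals its real part \<open>A - B\<close> and is therefore dominated by \<open>A\<close>.\<close>

lemma trace_class_pos:
  assumes "X \<in> trace_class" "op_pos X"
  shows "X \<in> fin_pos"
proof -
  obtain A B C D where P: "A \<in> fin_pos" "B \<in> fin_pos" "C \<in> fin_pos" "D \<in> fin_pos"
    and X: "X = (A - B) + op_scaleC \<i> (C - D)"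
    using assms(1) by (auto simp: trace_class_def decomp_def)
  have "A - X = B"
  proof (rule op_eqI)
    fix x y
    have "cinner (X x) y = cinner (op_adj X x) y" using op_posD(2)[OF assms(2)] by simp
    then have "cinner (C x) y = cinner (D x) y"
      using P by (simp add: X fin_posD op_posD(2) blinfun.bilinear_simps cinner_simps algebra_simps)
    then show "cinner ((A - X) x) y = cinner (B x) y"
      by (simp add: X blinfun.bilinear_simps cinner_simps)
  qed
  then show ?thesis
    using fin_pos_le(1)[OF trace_class_M[OF assms(1)] assms(2) P(1)] P(2) by (simp add: fin_posD)
qed

section \<open>Hilbert--Schmidt operators\<close>

definition HS :: "'h oper set" where
  "HS = {X \<in> M. op_adj X o\<^sub>L X \<in> fin_pos}"

definition hs_norm :: "'h oper \<Rightarrow> real" where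
  "hs_norm X = sqrt (rtr (op_adj X o\<^sub>L X))"

lemma HS_M: "X \<in> HS \<Longrightarrow> X \<in> M"
  by (simp add: HS_def)

lemma HS_fin_pos: "X \<in> HS \<Longrightarrow> op_adj X o\<^sub>L X \<in> fin_pos"
  by (simp add: HS_def)

lemma hs_norm_nonneg [simp]: "0 \<le> hs_norm X"
  by (simp add: hs_norm_def)

lemma hs_norm_sq: "(hs_norm X)\<^sup>2 = rtr (op_adj X o\<^sub>L X)"
  by (simp add: hs_norm_def)

lemma HS_adj:
  assumes "X \<in> HS"
  shows "op_adj X \<in> HS" "hs_norm (op_adj X) = hs_norm X"
proof -
  have X: "X \<in> M" using assms by (rule HS_M)
  then have "op_pos (X o\<^sub>L op_adj X)"
    using op_pos_adj_compose[of "op_adj X"] by simp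
  with assms X show "op_adj X \<in> HS" "hs_norm (op_adj X) = hs_norm X"
    by (simp_all add: HS_def fin_pos_def hs_norm_def rtr_def rho_comm)
qed

lemma HS_add:
  assumes "X \<in> HS" "Y \<in> HS"
  shows "X + Y \<in> HS"
proof -
  have M: "X \<in> M" "Y \<in> M" using assms by (simp_all add: HS_M)
  let ?U = "2 *\<^sub>R (op_adj X o\<^sub>L X) + 2 *\<^sub>R (op_adj Y o\<^sub>L Y)"
  have "op_adj (X + Y) o\<^sub>L (X + Y) \<in> fin_pos"
  proof (rule fin_pos_le(1))
    show "?U \<in> fin_pos"
      using assms by (intro fin_pos_add fin_pos_scaleR HS_fin_pos) auto
    \<comment> \<open>The parallelogram law dominates the square of the sum.\<close>
    have "?U - (op_adj (X + Y) o\<^sub>L (X + Y)) = op_adj (X - Y) o\<^sub>L (X - Y)"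
      by (rule op_eqI) (use M in \<open>simp add: blinfun.bilinear_simps cinner_simps cinner_op_adj_left algebra_simps\<close>)
    moreover have "op_pos (op_adj (X - Y) o\<^sub>L (X - Y))"
      by (rule op_pos_adj_compose) (use M in simp)
    ultimately show "op_pos (?U - (op_adj (X + Y) o\<^sub>L (X + Y)))" by simp
    show "op_pos (op_adj (X + Y) o\<^sub>L (X + Y))"
      by (rule op_pos_adj_compose) (use M in simp)
  qed (use M in simp)
  then show ?thesis using M by (simp add: HS_def)
qed

lemma HS_left:
  assumes X: "X \<in> HS" and Z: "Z \<in> M"
  shows "Z o\<^sub>L X \<in> HS" "hs_norm (Z o\<^sub>L X) \<le> norm Z * hs_norm X"
proof -
  have M: "X \<in> M" using X by (simp add: HS_M)
  let ?U = "(norm Z)\<^sup>2 *\<^sub>R (op_adj X o\<^sub>L X)" and ?V = "op_adj (Z o\<^sub>L X) o\<^sub>L (Z o\<^sub>L X)"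
  have U: "?U \<in> fin_pos" "rtr ?U = (norm Z)\<^sup>2 * rtr (op_adj X o\<^sub>L X)"
    using fin_pos_scaleR[OF HS_fin_pos[OF X]] by simp_all
  have V: "op_pos ?V" by (rule op_pos_adj_compose) (use M Z in simp)
  have "op_pos (?U - ?V)"
  proof (rule op_posI)
    fix x
    have "norm (Z (X x)) \<le> norm Z * norm (X x)" by (rule norm_blinfun)
    then have "(norm (Z (X x)))\<^sup>2 \<le> (norm Z * norm (X x))\<^sup>2" by (intro power_mono) auto
    then show "0 \<le> inner ((?U - ?V) x) x"
      using M Z by (simp add: blinfun.bilinear_simps inner_diff_left inner_diff_right inner_op_adj_right[symmetric]
          power2_norm_eq_inner power_mult_distrib inner_commute)
  qed (use M Z in \<open>simp_all add: op_compose_assoc\<close>)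
  with fin_pos_le[OF _ V U(1)] M Z have *: "?V \<in> fin_pos" "rtr ?V \<le> rtr ?U" by simp_all
  then show "Z o\<^sub>L X \<in> HS" using M Z by (simp add: HS_def)
  have "sqrt (rtr ?V) \<le> sqrt ((norm Z)\<^sup>2 * rtr (op_adj X o\<^sub>L X))"
    using * U by simp
  then show "hs_norm (Z o\<^sub>L X) \<le> norm Z * hs_norm X"
    by (simp add: hs_norm_def real_sqrt_mult)
qed

lemma HS_right:
  assumes X: "X \<in> HS" and Z: "Z \<in> M"
  shows "X o\<^sub>L Z \<in> HS" "hs_norm (X o\<^sub>L Z) \<le> norm Z * hs_norm X"
proof -
  have M: "X \<in> M" using X by (simp add: HS_M)
  have "op_adj Z o\<^sub>L op_adj X \<in> HS" "hs_norm (op_adj Z o\<^sub>L op_adj X) \<le> norm (op_adj Z) * hs_norm (op_adj X)"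
    using HS_left[of "op_adj X" "op_adj Z"] HS_adj X Z by simp_all
  then have "op_adj (op_adj Z o\<^sub>L op_adj X) \<in> HS"
    "hs_norm (op_adj (op_adj Z o\<^sub>L op_adj X)) \<le> norm (op_adj Z) * hs_norm (op_adj X)"
    using HS_adj by simp_all
  then show "X o\<^sub>L Z \<in> HS" "hs_norm (X o\<^sub>L Z) \<le> norm Z * hs_norm X"
    using M Z X by (simp_all add: norm_op_adj HS_adj)
qed

lemma HS_scaleC:
  assumes "X \<in> HS"
  shows "op_scaleC c X \<in> HS"
proof -
  have "op_scaleC c id_blinfun o\<^sub>L X = op_scaleC c X"
    by (rule blinfun_eqI) simp
  with HS_left(1)[OF assms, of "op_scaleC c id_blinfun"] show ?thesis by simp
qed

lemma HS_diff:
  assumes "X \<in> HS" "Y \<in> HS"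
  shows "X - Y \<in> HS"
proof -
  have eq: "X - Y = X + op_scaleC (-1) Y"
    by (rule blinfun_eqI) (simp add: blinfun.bilinear_simps scaleC_minus_one)
  show ?thesis unfolding eq by (intro HS_add HS_scaleC assms)
qed

text \<open>Polarization writes \<open>Y\<^sup>* X\<close> and \<open>X Y\<^sup>*\<close> with the same coefficients as combinations of \<open>Z\<^sup>* Z\<close>
  and \<open>Z Z\<^sup>*\<close> with \<open>Z = X + i\<^sup>k Y\<close>, and the trace property identifies these terms one by one.\<close>

lemma HS_product:
  assumes X: "X \<in> HS" and Y: "Y \<in> HS"
  shows "op_adj Y o\<^sub>L X \<in> trace_class" "tr (op_adj Y o\<^sub>L X) = tr (X o\<^sub>L op_adj Y)"
proof -
  have M: "X \<in> M" "Y \<in> M" using X Y by (simp_all add: HS_M)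
  define S where "S c = (1/4) *\<^sub>R (op_adj (X + op_scaleC c Y) o\<^sub>L (X + op_scaleC c Y))" for c
  define S' where "S' c = (1/4) *\<^sub>R ((X + op_scaleC c Y) o\<^sub>L op_adj (X + op_scaleC c Y))" for c
  have Z: "X + op_scaleC c Y \<in> HS" for c
    using X Y by (intro HS_add HS_scaleC)
  have S: "S c \<in> fin_pos" for c
    unfolding S_def by (intro fin_pos_scaleR HS_fin_pos Z) simp
  have S': "S' c \<in> fin_pos" for c
    unfolding S'_def using HS_fin_pos[OF HS_adj(1)[OF Z[of c]]] HS_M[OF Z[of c]]
    by (intro fin_pos_scaleR) auto
  have rS: "rtr (S c) = rtr (S' c)" for c
    unfolding S_def S'_def using HS_fin_pos[OF HS_adj(1)[OF Z[of c]]] HS_fin_pos[OF Z[of c]]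
      HS_M[OF Z[of c]] by (simp add: fin_pos_scaleR rtr_comm del: op_adj_simps(4))
  define c where "c = Complex (rtr (S 1) - rtr (S (-1))) (rtr (S \<i>) - rtr (S (-\<i>)))"
  have "decomp (op_adj Y o\<^sub>L X) c"
  proof (rule decompI[OF S S S S _ c_def])
    show "op_adj Y o\<^sub>L X = (S 1 - S (-1)) + op_scaleC \<i> (S \<i> - S (-\<i>))"
      by (rule op_eqI) (use M in \<open>simp add: S_def blinfun.bilinear_simps bops_apply cinner_simps cinner_op_adj_left field_simps\<close>)
  qed
  moreover have "decomp (X o\<^sub>L op_adj Y) c"
  proof (rule decompI[OF S' S' S' S'])
    show "X o\<^sub>L op_adj Y = (S' 1 - S' (-1)) + op_scaleC \<i> (S' \<i> - S' (-\<i>))"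
      by (rule op_eqI) (use M in \<open>simp add: S'_def blinfun.bilinear_simps bops_apply cinner_simps field_simps\<close>)
  qed (simp add: c_def rS)
  ultimately show "op_adj Y o\<^sub>L X \<in> trace_class" "tr (op_adj Y o\<^sub>L X) = tr (X o\<^sub>L op_adj Y)"
    using tr_eqI by auto
qed

lemma HS_compose:
  assumes X: "X \<in> HS" and Y: "Y \<in> HS"
  shows "Y o\<^sub>L X \<in> trace_class" "tr (Y o\<^sub>L X) = tr (X o\<^sub>L Y)"
  using HS_product[OF X HS_adj(1)[OF Y]] HS_M[OF Y] by simp_all

end

text \<open>Testing with \<open>c = - t z\<close> for real \<open>t\<close> reduces this to the discriminant of a real quadratic.\<close>

lemma quadratic_form_bound:
  fixes z :: complex
  assumes "\<And>c. 0 \<le> a + 2 * Re (c * cnj z) + (cmod c)\<^sup>2 * b" "0 \<le> b"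
  shows "cmod z \<le> sqrt a * sqrt b"
proof -
  have *: "0 \<le> a - 2 * t * (cmod z)\<^sup>2 + t\<^sup>2 * (cmod z)\<^sup>2 * b" for t :: real
  proof -
    have "Re (- of_real t * z * cnj z) = - t * (cmod z)\<^sup>2"
      by (subst cmod_power2) (simp add: power2_eq_square algebra_simps)
    with assms(1)[of "- of_real t * z"] show ?thesis
      by (simp only: norm_mult norm_minus_cancel norm_of_real power_mult_distrib power2_abs)
  qed
  have "0 \<le> a" using *[of 0] by simp
  have "(cmod z)\<^sup>2 \<le> a * b"
  proof (cases "b = 0")
    case True
    have "z = 0"
    proof (rule ccontr)
      assume "z \<noteq> 0"
      then have "0 < (cmod z)\<^sup>2" by simp
      with *[of "(a + 1) / (cmod z)\<^sup>2"] True \<open>0 \<le> a\<close> show False by simp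
    qed
    with True show ?thesis by simp
  next
    case False
    with assms(2) have b: "0 < b" by simp
    have "0 \<le> b * (a - 2 * (1/b) * (cmod z)\<^sup>2 + (1/b)\<^sup>2 * (cmod z)\<^sup>2 * b)"
      using b *[of "1/b"] by simp
    also have "\<dots> = a * b - (cmod z)\<^sup>2"
      using b by (simp add: field_simps power2_eq_square)
    finally show ?thesis by simp
  qed
  then have "sqrt ((cmod z)\<^sup>2) \<le> sqrt (a * b)" by (rule real_sqrt_le_mono)
  then show ?thesis by (simp add: real_sqrt_mult)
qed

context vn_trace
begin

lemma HS_Cauchy_Schwarz_adj:
  assumes X: "X \<in> HS" and Y: "Y \<in> HS"
  shows "cmod (tr (op_adj Y o\<^sub>L X)) \<le> hs_norm X * hs_norm Y"
proof -
  have M: "X \<in> M" "Y \<in> M" using X Y by (simp_all add: HS_M)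
  define z where "z = tr (op_adj Y o\<^sub>L X)"
  have z': "tr (op_adj X o\<^sub>L Y) = cnj z"
    using tr_adj[OF HS_product(1)[OF X Y]] M by (simp add: z_def)
  have "0 \<le> rtr (op_adj X o\<^sub>L X) + 2 * Re (c * cnj z) + (cmod c)\<^sup>2 * rtr (op_adj Y o\<^sub>L Y)" for c
  proof -
    let ?Z = "X + op_scaleC c Y"
    have Z: "?Z \<in> HS" using X Y by (intro HS_add HS_scaleC)
    have "op_adj ?Z o\<^sub>L ?Z = ((op_adj X o\<^sub>L X) + op_scaleC c (op_adj X o\<^sub>L Y)) +
        (op_scaleC (cnj c) (op_adj Y o\<^sub>L X) + op_scaleC (c * cnj c) (op_adj Y o\<^sub>L Y))"
      by (rule op_eqI) (use M in \<open>simp add: blinfun.bilinear_simps bops_apply cinner_simps cinner_op_adj_left algebra_simps\<close>)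
    then have "tr (op_adj ?Z o\<^sub>L ?Z) = (tr (op_adj X o\<^sub>L X) + c * cnj z) + (cnj c * z + (c * cnj c) * tr (op_adj Y o\<^sub>L Y))"
      using X Y HS_product(1) by (simp only: tr_add tr_scaleC z' z_def)
    then have "of_real (rtr (op_adj ?Z o\<^sub>L ?Z)) = (of_real (rtr (op_adj X o\<^sub>L X)) + c * cnj z) +
        (cnj c * z + (c * cnj c) * of_real (rtr (op_adj Y o\<^sub>L Y)))"
      using tr_fin_pos HS_fin_pos X Y Z by metis
    also have "c * cnj c = of_real ((cmod c)\<^sup>2)"
      by (rule complex_norm_square[symmetric])
    finally have eq: "complex_of_real (rtr (op_adj ?Z o\<^sub>L ?Z)) = (of_real (rtr (op_adj X o\<^sub>L X)) + c * cnj z) +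
        (cnj c * z + of_real ((cmod c)\<^sup>2) * of_real (rtr (op_adj Y o\<^sub>L Y)))" .
    from arg_cong[OF eq, of Re] have "rtr (op_adj ?Z o\<^sub>L ?Z) =
       rtr (op_adj X o\<^sub>L X) + 2 * Re (c * cnj z) + (cmod c)\<^sup>2 * rtr (op_adj Y o\<^sub>L Y)"
      by (simp del: of_real_power)
    then show ?thesis by (metis rtr_nonneg)
  qed
  from quadratic_form_bound[OF this] show ?thesis
    by (simp add: hs_norm_def z_def)
qed

lemma HS_Cauchy_Schwarz:
  assumes X: "X \<in> HS" and Y: "Y \<in> HS"
  shows "cmod (tr (Y o\<^sub>L X)) \<le> hs_norm Y * hs_norm X"
  using HS_Cauchy_Schwarz_adj[OF X HS_adj(1)[OF Y]] HS_M[OF Y] HS_adj(2)[OF Y] by (simp add: mult.commute)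

lemma hs_norm_triangle:
  assumes X: "X \<in> HS" and Y: "Y \<in> HS"
  shows "hs_norm (X + Y) \<le> hs_norm X + hs_norm Y"
proof (rule power2_le_imp_le)
  have M: "X \<in> M" "Y \<in> M" using X Y by (simp_all add: HS_M)
  have "op_adj (X + Y) o\<^sub>L (X + Y) = ((op_adj X o\<^sub>L X) + (op_adj X o\<^sub>L Y)) +
      ((op_adj Y o\<^sub>L X) + (op_adj Y o\<^sub>L Y))"
    by (rule op_eqI) (use M in \<open>simp add: blinfun.bilinear_simps cinner_simps cinner_op_adj_left algebra_simps\<close>)
  then have "tr (op_adj (X + Y) o\<^sub>L (X + Y)) = (tr (op_adj X o\<^sub>L X) + tr (op_adj X o\<^sub>L Y)) +
      (tr (op_adj Y o\<^sub>L X) + tr (op_adj Y o\<^sub>L Y))"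
    using X Y HS_product(1) by (simp only: tr_add)
  then have "of_real (rtr (op_adj (X + Y) o\<^sub>L (X + Y))) = (of_real (rtr (op_adj X o\<^sub>L X)) + tr (op_adj X o\<^sub>L Y)) +
      (tr (op_adj Y o\<^sub>L X) + of_real (rtr (op_adj Y o\<^sub>L Y)))"
    using tr_fin_pos HS_fin_pos X Y HS_add[OF X Y] by metis
  from arg_cong[OF this, of Re] have "(hs_norm (X + Y))\<^sup>2 =
     (hs_norm X)\<^sup>2 + (Re (tr (op_adj X o\<^sub>L Y)) + Re (tr (op_adj Y o\<^sub>L X))) + (hs_norm Y)\<^sup>2"
    by (simp add: hs_norm_sq)
  moreover have "Re (tr (op_adj X o\<^sub>L Y)) \<le> hs_norm Y * hs_norm X" "Re (tr (op_adj Y o\<^sub>L X)) \<le> hs_norm X * hs_norm Y"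
    using HS_Cauchy_Schwarz_adj X Y complex_Re_le_cmod order_trans by blast+
  ultimately show "(hs_norm (X + Y))\<^sup>2 \<le> (hs_norm X + hs_norm Y)\<^sup>2"
    by (simp add: power2_sum mult.commute[of "hs_norm Y"])
qed simp

lemma hs_norm_minus: "X \<in> HS \<Longrightarrow> hs_norm (- X) = hs_norm X"
proof -
  have "(- Y) o\<^sub>L (- X) = Y o\<^sub>L X" for X Y :: "'h oper"
    by (rule blinfun_eqI) (simp add: blinfun.bilinear_simps)
  then show "X \<in> HS \<Longrightarrow> ?thesis" by (simp add: hs_norm_def HS_M)
qed

section \<open>The trace norm\<close>

definition L1 :: "'h oper set" where
  "L1 = {X \<in> M. op_abs X \<in> fin_pos}"

definition tr_norm :: "'h oper \<Rightarrow> real" where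
  "tr_norm X = rtr (op_abs X)"

lemma tr_norm_nonneg [simp]: "0 \<le> tr_norm X"
  by (simp add: tr_norm_def)

lemma fin_pos_sqrt:
  assumes "A \<in> fin_pos"
  shows "op_sqrt A \<in> HS" "hs_norm (op_sqrt A) = sqrt (rtr A)" "op_sqrt A o\<^sub>L op_sqrt A = A"
proof -
  note A = fin_posD(1,2)[OF assms]
  show SS: "op_sqrt A o\<^sub>L op_sqrt A = A"
    by (rule op_sqrt(2)[OF A(2)])
  have "op_adj (op_sqrt A) = op_sqrt A"
    by (rule op_posD(2)[OF op_sqrt(1)[OF A(2)]])
  with SS show "op_sqrt A \<in> HS" "hs_norm (op_sqrt A) = sqrt (rtr A)"
    using A assms by (simp_all add: HS_def hs_norm_def)
qed

text \<open>With \<open>X = T\<^sup>* |X|\<close> and \<open>S = |X|\<^sup>1\<^sup>/\<^sup>2\<close>, the product \<open>Z X = (Z T\<^sup>* S) S\<close> has two Hilbert--Schmidt factors.\<close>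

lemma tr_L1:
  assumes X: "X \<in> L1" and Z: "Z \<in> M"
  shows "Z o\<^sub>L X \<in> trace_class" "cmod (tr (Z o\<^sub>L X)) \<le> norm Z * tr_norm X"
proof -
  have XM: "X \<in> M" and A: "op_abs X \<in> fin_pos" using X by (simp_all add: L1_def)
  obtain T where T: "T \<in> M" "norm T \<le> 1" "op_adj T o\<^sub>L op_abs X = X"
    using polar_decomposition[OF XM] by blast
  define S where "S = op_sqrt (op_abs X)"
  note S = fin_pos_sqrt[OF A, folded S_def]
  have ZT: "Z o\<^sub>L op_adj T \<in> M" using Z T by simp
  have eq: "Z o\<^sub>L X = ((Z o\<^sub>L op_adj T) o\<^sub>L S) o\<^sub>L S"
    by (simp add: op_compose_assoc S(3) T(3))
  show "Z o\<^sub>L X \<in> trace_class"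
    unfolding eq by (rule HS_compose(1)[OF S(1) HS_left(1)[OF S(1) ZT]])
  have "cmod (tr (Z o\<^sub>L X)) \<le> hs_norm ((Z o\<^sub>L op_adj T) o\<^sub>L S) * hs_norm S"
    unfolding eq by (rule HS_Cauchy_Schwarz[OF S(1) HS_left(1)[OF S(1) ZT]])
  also have "\<dots> \<le> (norm (Z o\<^sub>L op_adj T) * hs_norm S) * hs_norm S"
    by (intro mult_right_mono HS_left(2)[OF S(1) ZT]) simp
  also have "\<dots> = norm (Z o\<^sub>L op_adj T) * tr_norm X"
    by (simp add: S(2) tr_norm_def)
  also have "\<dots> \<le> (norm Z * norm (op_adj T)) * tr_norm X"
    by (intro mult_right_mono norm_blinfun_compose) simp
  also have "\<dots> \<le> (norm Z * 1) * tr_norm X"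
    using T by (intro mult_right_mono mult_left_mono) (auto simp: norm_op_adj)
  finally show "cmod (tr (Z o\<^sub>L X)) \<le> norm Z * tr_norm X" by simp
qed

text \<open>Together with \<open>tr_L1\<close> this is the duality formula for the trace norm. The hypothesis makes
  \<open>|X| = T X\<close> an element of the trace class, so its trace is finite; thus the lemma also
  serves to prove that products and sums belong to \<open>L\<^sup>1\<close>.\<close>

lemma tr_norm_attained:
  assumes X: "X \<in> M" and tc: "\<And>Z. Z \<in> M \<Longrightarrow> Z o\<^sub>L X \<in> trace_class"
  shows "X \<in> L1" "\<exists>T\<in>M. norm T \<le> 1 \<and> tr (T o\<^sub>L X) = tr_norm X"
proof -
  obtain T where T: "T \<in> M" "norm T \<le> 1" "T o\<^sub>L X = op_abs X"
    using polar_decomposition[OF X] by blast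
  have A: "op_abs X \<in> fin_pos"
    using tc[OF T(1)] T(3) X by (intro trace_class_pos) (auto simp: op_abs)
  then show "X \<in> L1" using X by (simp add: L1_def)
  show "\<exists>T\<in>M. norm T \<le> 1 \<and> tr (T o\<^sub>L X) = tr_norm X"
    using T tr_fin_pos[OF A] by (auto simp: tr_norm_def)
qed

lemma HS_compose_L1:
  assumes X: "X \<in> HS" and Y: "Y \<in> HS"
  shows "Y o\<^sub>L X \<in> L1" "tr_norm (Y o\<^sub>L X) \<le> hs_norm Y * hs_norm X"
proof -
  have M: "X \<in> M" "Y \<in> M" using X Y by (simp_all add: HS_M)
  have *: "Z o\<^sub>L (Y o\<^sub>L X) \<in> trace_class" if "Z \<in> M" for Z
    using HS_compose(1)[OF X HS_left(1)[OF Y that]] by (simp add: op_compose_assoc)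
  have YX: "Y o\<^sub>L X \<in> M" using M by simp
  show "Y o\<^sub>L X \<in> L1" by (rule tr_norm_attained(1)[OF YX *])
  obtain T where T: "T \<in> M" "norm T \<le> 1" "tr (T o\<^sub>L (Y o\<^sub>L X)) = tr_norm (Y o\<^sub>L X)"
    using tr_norm_attained(2)[OF YX *] by blast
  have "tr_norm (Y o\<^sub>L X) = cmod (tr ((T o\<^sub>L Y) o\<^sub>L X))"
    by (simp add: op_compose_assoc T(3))
  also have "\<dots> \<le> hs_norm (T o\<^sub>L Y) * hs_norm X"
    by (rule HS_Cauchy_Schwarz[OF X HS_left(1)[OF Y T(1)]])
  also have "\<dots> \<le> (norm T * hs_norm Y) * hs_norm X"
    by (intro mult_right_mono HS_left(2) Y T) simp
  also have "\<dots> \<le> (1 * hs_norm Y) * hs_norm X"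
    by (intro mult_right_mono T) auto
  finally show "tr_norm (Y o\<^sub>L X) \<le> hs_norm Y * hs_norm X" by simp
qed

lemma tr_norm_triangle:
  assumes X: "X \<in> L1" and Y: "Y \<in> L1"
  shows "X + Y \<in> L1" "tr_norm (X + Y) \<le> tr_norm X + tr_norm Y"
proof -
  have M: "X \<in> M" "Y \<in> M" using X Y by (simp_all add: L1_def)
  have eq: "Z o\<^sub>L (X + Y) = (Z o\<^sub>L X) + (Z o\<^sub>L Y)" for Z
    by (rule blinfun_eqI) (simp add: blinfun.bilinear_simps)
  have *: "Z o\<^sub>L (X + Y) \<in> trace_class" if "Z \<in> M" for Z
    unfolding eq using tr_add tr_L1(1) X Y that by blast
  have XY: "X + Y \<in> M" using M by simp
  show "X + Y \<in> L1" by (rule tr_norm_attained(1)[OF XY *])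
  obtain T where T: "T \<in> M" "norm T \<le> 1" "tr (T o\<^sub>L (X + Y)) = tr_norm (X + Y)"
    using tr_norm_attained(2)[OF XY *] by blast
  have "tr (T o\<^sub>L (X + Y)) = tr (T o\<^sub>L X) + tr (T o\<^sub>L Y)"
    unfolding eq using tr_add tr_L1(1) X Y T by blast
  then have "tr_norm (X + Y) = cmod (tr (T o\<^sub>L X) + tr (T o\<^sub>L Y))"
    using T(3) by (metis norm_of_real abs_of_nonneg tr_norm_nonneg)
  also have "\<dots> \<le> cmod (tr (T o\<^sub>L X)) + cmod (tr (T o\<^sub>L Y))" by (rule norm_triangle_ineq)
  also have "\<dots> \<le> norm T * tr_norm X + norm T * tr_norm Y"
    by (intro add_mono tr_L1(2) X Y T)
  also have "\<dots> \<le> 1 * tr_norm X + 1 * tr_norm Y"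
    by (intro add_mono mult_right_mono T) auto
  finally show "tr_norm (X + Y) \<le> tr_norm X + tr_norm Y" by simp
qed

lemma tr_norm_minus: "X \<in> M \<Longrightarrow> tr_norm (- X) = tr_norm X" "X \<in> L1 \<Longrightarrow> - X \<in> L1"
proof -
  have "(- Y) o\<^sub>L (- X) = Y o\<^sub>L X" for X Y :: "'h oper"
    by (rule blinfun_eqI) (simp add: blinfun.bilinear_simps)
  then have "X \<in> M \<Longrightarrow> op_abs (- X) = op_abs X" by (simp add: op_abs_def)
  then show "X \<in> M \<Longrightarrow> tr_norm (- X) = tr_norm X" "X \<in> L1 \<Longrightarrow> - X \<in> L1"
    by (simp_all add: tr_norm_def L1_def)
qed

end

section \<open>Fejer kernels of a contraction\<close>

text \<open>The angles at which the Fejer means are sampled. Sampling at roots of unity of large enough order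
  makes the averages of the occurring powers exactly \<open>0\<close> or \<open>1\<close>.\<close>

definition unity_root :: "nat \<Rightarrow> nat \<Rightarrow> complex" where
  "unity_root K m = exp (2 * of_real pi * \<i> * of_nat m / of_nat K)"

lemma norm_unity_root [simp]: "cmod (unity_root K m) = 1"
  by (simp add: unity_root_def norm_exp_eq_Re)

lemma unity_root_cnj: "cnj (unity_root K m) * unity_root K m = 1"
  using complex_norm_square[of "unity_root K m"] by (simp add: mult.commute)

lemma sum_unity_root_power:
  assumes "k < K"
  shows "(\<Sum>m<K. unity_root K m ^ k) = (if k = 0 then of_nat K else 0)"
proof (cases "k = 0")
  case False
  have K: "1 \<le> K" using assms by simp
  have ne: "unity_root K k \<noteq> 1"
    using complex_root_unity_eq_1[OF K, of k] assms False nat_dvd_not_less[of k K]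
    by (simp add: unity_root_def)
  have "unity_root K m ^ k = unity_root K k ^ m" for m
    unfolding unity_root_def exp_of_nat_mult[symmetric] by (simp add: ac_simps)
  then have "(\<Sum>m<K. unity_root K m ^ k) = (\<Sum>m<K. unity_root K k ^ m)" by simp
  also have "\<dots> = (unity_root K k ^ K - 1) / (unity_root K k - 1)"
    by (rule geometric_sum[OF ne])
  also have "unity_root K k ^ K = 1"
    using complex_root_unity[of K k] K by (simp add: unity_root_def)
  finally show ?thesis using False by simp
qed simp

lemma sum_cnj_unity_root_power:
  "k < K \<Longrightarrow> (\<Sum>m<K. cnj (unity_root K m) ^ k) = (if k = 0 then of_nat K else 0)"
  using arg_cong[OF sum_unity_root_power, of k K cnj] by (simp split: if_splits)

lemma sum_unity_root_power_shift:
  assumes "k < K" "1 < K"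
  shows "(\<Sum>m<K. cnj (unity_root K m) * unity_root K m ^ k) = (if k = 1 then of_nat K else 0)"
proof (cases k)
  case 0
  then show ?thesis
    using sum_cnj_unity_root_power[of 1 K] assms by simp
next
  case (Suc l)
  have "cnj (unity_root K m) * unity_root K m ^ k = unity_root K m ^ l" for m
    by (simp only: Suc power_Suc mult.assoc[symmetric] unity_root_cnj mult_1_left)
  then have "(\<Sum>m<K. cnj (unity_root K m) * unity_root K m ^ k) = (\<Sum>m<K. unity_root K m ^ l)"
    by (rule sum.cong[OF refl])
  then show ?thesis
    using sum_unity_root_power[of l K] assms Suc by auto
qed

definition partial_sum :: "'h::chilbert_space oper \<Rightarrow> nat \<Rightarrow> 'h oper" where
  "partial_sum A j = (\<Sum>k\<le>j. op_power A k)"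

text \<open>With \<open>A\<^sub>j = A\<^sup>j\<close> and \<open>A\<^sub>-\<^sub>j = (A\<^sup>*)\<^sup>j\<close> for \<open>j \<ge> 0\<close>, this is \<open>\<Sum>\<^sub>|\<^sub>j\<^sub>|\<^sub><\<^sub>N (N - |j|) A\<^sub>j\<close>, that is \<open>N\<close> times the
  Fejer mean, written as the sum of the Dirichlet sums \<open>\<Sum>\<^sub>|\<^sub>k\<^sub>|\<^sub>\<le>\<^sub>j A\<^sub>k\<close> for \<open>j < N\<close>.\<close>

definition fejer_sum :: "'h::chilbert_space oper \<Rightarrow> nat \<Rightarrow> 'h oper" where
  "fejer_sum A N = (\<Sum>j<N. (partial_sum A j + op_adj (partial_sum A j)) - id_blinfun)"

lemma op_power_simps: "op_power A 0 = id_blinfun" "op_power A (Suc k) = A o\<^sub>L op_power A k"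
  by (simp_all add: op_power_def)

lemma op_power_bops [simp]: "A \<in> bops \<Longrightarrow> op_power A k \<in> bops"
  by (induction k) (simp_all add: op_power_simps)

lemma bops_sum [simp]: "(\<And>i. i \<in> I \<Longrightarrow> f i \<in> bops) \<Longrightarrow> sum f I \<in> bops"
  by (induction I rule: infinite_finite_induct) auto

lemma op_adj_sum: "(\<And>i. i \<in> I \<Longrightarrow> f i \<in> bops) \<Longrightarrow> op_adj (sum f I) = (\<Sum>i\<in>I. op_adj (f i))"
  by (induction I rule: infinite_finite_induct) auto

lemma partial_sum_bops [simp]: "A \<in> bops \<Longrightarrow> partial_sum A j \<in> bops"
  by (simp add: partial_sum_def)

lemma partial_sum_simps:
  "partial_sum A 0 = id_blinfun" "partial_sum A (Suc j) = id_blinfun + (A o\<^sub>L partial_sum A j)"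
proof -
  show "partial_sum A 0 = id_blinfun" by (simp add: partial_sum_def op_power_simps)
  have "partial_sum A (Suc j) = op_power A 0 + (\<Sum>k\<le>j. op_power A (Suc k))"
    unfolding partial_sum_def by (rule sum.atMost_Suc_shift)
  also have "(\<Sum>k\<le>j. op_power A (Suc k)) = A o\<^sub>L partial_sum A j"
    unfolding partial_sum_def op_power_simps
    by (simp add: bounded_bilinear.sum_right[OF bounded_bilinear_blinfun_compose])
  finally show "partial_sum A (Suc j) = id_blinfun + (A o\<^sub>L partial_sum A j)"
    by (simp add: op_power_simps)
qed

text \<open>Put \<open>y\<^sub>j = (1 + A + \<dots> + A\<^sup>j) x\<close>, so that \<open>x = y\<^sub>j - A y\<^sub>j\<^sub>-\<^sub>1\<close>. Expanding gives
  \<open>2 Re \<langle>y\<^sub>j, x\<rangle> - \<parallel>x\<parallel>\<^sup>2 = \<parallel>y\<^sub>j\<parallel>\<^sup>2 - \<parallel>A y\<^sub>j\<^sub>-\<^sub>1\<parallel>\<^sup>2 \<ge> \<parallel>y\<^sub>j\<parallel>\<^sup>2 - \<parallel>y\<^sub>j\<^sub>-\<^sub>1\<parallel>\<^sup>2\<close>, and the sum over \<open>j\<close> telescopes.\<close>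

lemma fejer_sum_pos:
  fixes A :: "'h::chilbert_space oper"
  assumes A: "A \<in> bops" and nA: "norm A \<le> 1"
  shows "op_pos (fejer_sum A N)"
proof (rule op_posI)
  fix x
  let ?y = "\<lambda>j. partial_sum A j x"
  have q: "inner (fejer_sum A N x) x = (\<Sum>j<N. 2 * inner (?y j) x - (norm x)\<^sup>2)"
    using A by (simp add: fejer_sum_def blinfun.sum_left blinfun.bilinear_simps inner_commute[of _ x]
        inner_sum_right inner_diff_right inner_add_right inner_op_adj_right dot_square_norm)
  have "(norm (?y N))\<^sup>2 \<le> (\<Sum>j<Suc N. 2 * inner (?y j) x - (norm x)\<^sup>2)" for N
  proof (induction N)
    case 0
    then show ?case by (simp add: partial_sum_simps dot_square_norm)
  next
    case (Suc N)
    define w where "w = A (?y N)"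
    have x: "x = ?y (Suc N) - w"
      by (simp add: partial_sum_simps w_def blinfun.bilinear_simps)
    have "norm w \<le> norm A * norm (?y N)" unfolding w_def by (rule norm_blinfun)
    also have "\<dots> \<le> 1 * norm (?y N)" by (rule mult_right_mono[OF nA]) simp
    finally have w: "(norm w)\<^sup>2 \<le> (norm (?y N))\<^sup>2" by simp
    have "2 * inner y (y - w) - (norm (y - w))\<^sup>2 = (norm y)\<^sup>2 - (norm w)\<^sup>2" for y
      by (simp add: power2_norm_eq_inner inner_diff_left inner_diff_right inner_commute algebra_simps)
    from this[of "?y (Suc N)"] have "2 * inner (?y (Suc N)) x - (norm x)\<^sup>2 = (norm (?y (Suc N)))\<^sup>2 - (norm w)\<^sup>2"
      unfolding x[symmetric] .
    with Suc.IH w show ?case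
      unfolding sum.lessThan_Suc[of _ "Suc N"] by linarith
  qed
  from order_trans[OF zero_le_power2 this] show "0 \<le> inner (fejer_sum A N x) x"
    unfolding q by (cases N) simp_all
next
  show "fejer_sum A N \<in> bops" using A by (simp add: fejer_sum_def)
  show "op_adj (fejer_sum A N) = fejer_sum A N"
    using A by (simp add: fejer_sum_def op_adj_sum add.commute)
qed

lemma op_power_scaleC:
  assumes "A \<in> bops"
  shows "op_power (op_scaleC c A) k = op_scaleC (c ^ k) (op_power A k)"
proof (induction k)
  case (Suc k)
  then show ?case
    using assms by (intro blinfun_eqI) (simp add: op_power_simps bops_apply scaleC_scaleC)
qed (simp add: op_power_simps, rule blinfun_eqI, simp)

lemma cinner_sum_left: "cinner (sum f I) y = (\<Sum>i\<in>I. cinner (f i) (y::'h::chilbert_space))"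
  by (induction I rule: infinite_finite_induct) (auto simp: cinner_add_left)

lemma cinner_fejer_sum:
  assumes V: "V \<in> bops"
  shows "cinner (fejer_sum (op_scaleC c V) N x) y =
    (\<Sum>j<N. (\<Sum>k\<le>j. c ^ k * cinner (op_power V k x) y) +
      (\<Sum>k\<le>j. cnj c ^ k * cinner (op_adj (op_power V k) x) y) - cinner x y)"
  using V by (simp add: fejer_sum_def partial_sum_def op_power_scaleC op_adj_sum blinfun.sum_left
      blinfun.bilinear_simps cinner_sum_left cinner_simps)

text \<open>The coefficients of \<open>V\<^sup>k\<close> and \<open>(V\<^sup>*)\<^sup>k\<close> in a weighted average of Fejer sums are the moments of the
  weights.\<close>

lemma sum_fejer_swap:
  fixes w l a b :: "nat \<Rightarrow> complex"
  shows "(\<Sum>m<K. w m * (\<Sum>j<N. (\<Sum>k\<le>j. l m ^ k * a k) + (\<Sum>k\<le>j. cnj (l m) ^ k * b k) - c)) =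
    (\<Sum>j<N. (\<Sum>k\<le>j. (\<Sum>m<K. w m * l m ^ k) * a k) +
      (\<Sum>k\<le>j. (\<Sum>m<K. w m * cnj (l m) ^ k) * b k) - (\<Sum>m<K. w m) * c)"
proof -
  have *: "(\<Sum>m<K. w m * (\<Sum>k\<le>j. g m k * a k)) = (\<Sum>k\<le>j. (\<Sum>m<K. w m * g m k) * a k)"
    for g j and a :: "nat \<Rightarrow> complex"
    by (simp only: sum_distrib_left sum_distrib_right sum.swap[of _ "{..<K}"] mult.assoc)
  have "(\<Sum>m<K. w m * (\<Sum>j<N. (\<Sum>k\<le>j. l m ^ k * a k) + (\<Sum>k\<le>j. cnj (l m) ^ k * b k) - c)) =
    (\<Sum>m<K. \<Sum>j<N. w m * (\<Sum>k\<le>j. l m ^ k * a k) + w m * (\<Sum>k\<le>j. cnj (l m) ^ k * b k) - w m * c)"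
    by (simp only: sum_distrib_left[of _ _ "{..<N}"] distrib_left right_diff_distrib)
  also have "\<dots> = (\<Sum>j<N. \<Sum>m<K. w m * (\<Sum>k\<le>j. l m ^ k * a k) + w m * (\<Sum>k\<le>j. cnj (l m) ^ k * b k) - w m * c)"
    by (rule sum.swap)
  also have "\<dots> = (\<Sum>j<N. (\<Sum>k\<le>j. (\<Sum>m<K. w m * l m ^ k) * a k) +
      (\<Sum>k\<le>j. (\<Sum>m<K. w m * cnj (l m) ^ k) * b k) - (\<Sum>m<K. w m) * c)"
    by (simp only: sum.distrib sum_subtractf *[of "\<lambda>m k. l m ^ k"] *[of "\<lambda>m k. cnj (l m) ^ k"] sum_distrib_right)
  finally show ?thesis .
qed

text \<open>Only \<open>|k| \<le> n\<close> occurs as an exponent. The order \<open>K = n + 2\<close> is large enough for the \<open>K\<close>-th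
  roots of unity to separate the exponent \<open>0\<close> from these, and, after multiplication by the conjugate root, the
  exponent \<open>1\<close> as well: the shifted exponents lie between \<open>- n - 1\<close> and \<open>n - 1\<close>. The operator \<open>V\<close> itself
  occurs in all but the first of the \<open>n + 1\<close> Dirichlet sums, whence the factor \<open>n / (n + 1)\<close>.\<close>

lemma fejer_decomposition:
  fixes V :: "'h::chilbert_space oper"
  assumes V: "V \<in> bops" and n: "0 < n"
  defines "K \<equiv> Suc (Suc n)"
  defines "Q \<equiv> \<lambda>m. (1 / (real K * real (Suc n))) *\<^sub>R fejer_sum (op_scaleC (unity_root K m) V) (Suc n)"
  shows "(\<Sum>m<K. Q m) = id_blinfun"
    and "(\<Sum>m<K. op_scaleC (cnj (unity_root K m)) (Q m)) = (real n / real (Suc n)) *\<^sub>R V"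
proof -
  let ?l = "unity_root K"
  have K: "1 < K" "K \<noteq> 0" by (simp_all add: K_def)
  have lt: "k < K" "Suc k < K" if "k \<le> j" "j < Suc n" for j k
    using that by (simp_all add: K_def)
  have Qc: "cinner (Q m x) y = of_real (1 / (real K * real (Suc n))) * (\<Sum>j<Suc n. (\<Sum>k\<le>j. ?l m ^ k * cinner (op_power V k x) y) +
      (\<Sum>k\<le>j. cnj (?l m) ^ k * cinner (op_adj (op_power V k) x) y) - cinner x y)" for m x y
    unfolding Q_def blinfun.scaleR_left cinner_scaleR_left cinner_fejer_sum[OF V] ..
  show "(\<Sum>m<K. Q m) = id_blinfun"
  proof (rule op_eqI)
    fix x y
    let ?a = "\<lambda>k. cinner (op_power V k x) y" and ?b = "\<lambda>k. cinner (op_adj (op_power V k) x) y"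
    have "cinner ((\<Sum>m<K. Q m) x) y = of_real (1 / (real K * real (Suc n))) * (\<Sum>m<K. 1 * (\<Sum>j<Suc n. (\<Sum>k\<le>j. ?l m ^ k * ?a k) +
        (\<Sum>k\<le>j. cnj (?l m) ^ k * ?b k) - cinner x y))"
      unfolding blinfun.sum_left cinner_sum_left Qc sum_distrib_left[symmetric] mult_1_left ..
    also have "(\<Sum>m<K. 1 * (\<Sum>j<Suc n. (\<Sum>k\<le>j. ?l m ^ k * ?a k) + (\<Sum>k\<le>j. cnj (?l m) ^ k * ?b k) - cinner x y)) =
        (\<Sum>j<Suc n. (\<Sum>k\<le>j. (\<Sum>m<K. 1 * ?l m ^ k) * ?a k) + (\<Sum>k\<le>j. (\<Sum>m<K. 1 * cnj (?l m) ^ k) * ?b k) - (\<Sum>m<K. 1) * cinner x y)"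
      by (rule sum_fejer_swap)
    also have "\<dots> = (\<Sum>j<Suc n. of_nat K * cinner x y)"
    proof (rule sum.cong[OF refl])
      fix j assume "j \<in> {..<Suc n}"
      then have j: "j < Suc n" by simp
      have "(\<Sum>k\<le>j. (\<Sum>m<K. 1 * ?l m ^ k) * ?a k) = (\<Sum>k\<le>j. if k = 0 then of_nat K * ?a k else 0)"
        by (rule sum.cong[OF refl]) (simp add: sum_unity_root_power lt[OF _ j])
      moreover have "(\<Sum>k\<le>j. (\<Sum>m<K. 1 * cnj (?l m) ^ k) * ?b k) = (\<Sum>k\<le>j. if k = 0 then of_nat K * ?b k else 0)"
        by (rule sum.cong[OF refl]) (simp add: sum_cnj_unity_root_power lt[OF _ j])
      ultimately show "(\<Sum>k\<le>j. (\<Sum>m<K. 1 * ?l m ^ k) * ?a k) + (\<Sum>k\<le>j. (\<Sum>m<K. 1 * cnj (?l m) ^ k) * ?b k) - (\<Sum>m<K. 1) * cinner x y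
          = of_nat K * cinner x y"
        by (simp add: op_power_simps)
    qed
    also have "of_real (1 / (real K * real (Suc n))) * \<dots> = cinner x y"
      using K by (simp add: field_simps del: of_nat_Suc)
    finally show "cinner ((\<Sum>m<K. Q m) x) y = cinner (id_blinfun x) y" by simp
  qed
  show "(\<Sum>m<K. op_scaleC (cnj (?l m)) (Q m)) = (real n / real (Suc n)) *\<^sub>R V"
  proof (rule op_eqI)
    fix x y
    let ?a = "\<lambda>k. cinner (op_power V k x) y" and ?b = "\<lambda>k. cinner (op_adj (op_power V k) x) y"
    have "cinner ((\<Sum>m<K. op_scaleC (cnj (?l m)) (Q m)) x) y = of_real (1 / (real K * real (Suc n))) *
       (\<Sum>m<K. cnj (?l m) * (\<Sum>j<Suc n. (\<Sum>k\<le>j. ?l m ^ k * ?a k) +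
        (\<Sum>k\<le>j. cnj (?l m) ^ k * ?b k) - cinner x y))"
      unfolding blinfun.sum_left cinner_sum_left op_scaleC_apply cinner_scaleC_left Qc
        mult.left_commute[of "cnj _"] sum_distrib_left[symmetric] ..
    also have "(\<Sum>m<K. cnj (?l m) * (\<Sum>j<Suc n. (\<Sum>k\<le>j. ?l m ^ k * ?a k) + (\<Sum>k\<le>j. cnj (?l m) ^ k * ?b k) - cinner x y)) =
        (\<Sum>j<Suc n. (\<Sum>k\<le>j. (\<Sum>m<K. cnj (?l m) * ?l m ^ k) * ?a k) + (\<Sum>k\<le>j. (\<Sum>m<K. cnj (?l m) * cnj (?l m) ^ k) * ?b k)
          - (\<Sum>m<K. cnj (?l m)) * cinner x y)"
      by (rule sum_fejer_swap)
    also have "\<dots> = (\<Sum>j<Suc n. if j = 0 then 0 else of_nat K * cinner (V x) y)"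
    proof (rule sum.cong[OF refl])
      fix j assume "j \<in> {..<Suc n}"
      then have j: "j < Suc n" by simp
      have "(\<Sum>k\<le>j. (\<Sum>m<K. cnj (?l m) * ?l m ^ k) * ?a k) = (\<Sum>k\<le>j. if k = 1 then of_nat K * ?a k else 0)"
        by (rule sum.cong[OF refl]) (simp add: sum_unity_root_power_shift lt[OF _ j] K)
      also have "\<dots> = (if j = 0 then 0 else of_nat K * cinner (V x) y)"
        by (auto simp: op_power_simps)
      finally have 1: "(\<Sum>k\<le>j. (\<Sum>m<K. cnj (?l m) * ?l m ^ k) * ?a k) = (if j = 0 then 0 else of_nat K * cinner (V x) y)" .
      have "(\<Sum>m<K. cnj (?l m) * cnj (?l m) ^ k) = 0" if "k \<le> j" for k
        using sum_cnj_unity_root_power[OF lt(2)[OF that j]] by simp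
      then have 2: "(\<Sum>k\<le>j. (\<Sum>m<K. cnj (?l m) * cnj (?l m) ^ k) * ?b k) = 0" by simp
      have 3: "(\<Sum>m<K. cnj (?l m)) = 0"
        using sum_cnj_unity_root_power[of 1 K] K by simp
      show "(\<Sum>k\<le>j. (\<Sum>m<K. cnj (?l m) * ?l m ^ k) * ?a k) + (\<Sum>k\<le>j. (\<Sum>m<K. cnj (?l m) * cnj (?l m) ^ k) * ?b k)
          - (\<Sum>m<K. cnj (?l m)) * cinner x y = (if j = 0 then 0 else of_nat K * cinner (V x) y)"
        unfolding 1 2 3 by simp
    qed
    also have "\<dots> = of_nat n * (of_nat K * cinner (V x) y)"
      by (subst sum.lessThan_Suc_shift) simp
    also have "of_real (1 / (real K * real (Suc n))) * \<dots> = of_real (real n / real (Suc n)) * cinner (V x) y"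
      using K by (simp add: field_simps del: of_nat_Suc)
    finally show "cinner ((\<Sum>m<K. op_scaleC (cnj (?l m)) (Q m)) x) y = cinner (((real n / real (Suc n)) *\<^sub>R V) x) y"
      by (simp add: blinfun.bilinear_simps cinner_simps)
  qed
qed

context von_neumann
begin

lemma op_power_M [simp]: "A \<in> M \<Longrightarrow> op_power A k \<in> M"
  by (induction k) (simp_all add: op_power_simps)

lemma fejer_sum_M [simp]: "A \<in> M \<Longrightarrow> fejer_sum A N \<in> M"
  by (simp add: fejer_sum_def partial_sum_def)

text \<open>A bound on positive elements extends to contractions with the same constant. The
  Fejer decomposition \<open>V \<approx> \<Sum> \<lambda>\<^sub>m Q\<^sub>m\<close> with \<open>\<Sum> Q\<^sub>m = 1\<close> reduces the claim to
  \<open>\<Sum> \<alpha>(Q\<^sub>m)\<^sup>1\<^sup>/\<^sup>2 \<beta>(Q\<^sub>m)\<^sup>1\<^sup>/\<^sup>2 \<le> \<alpha>(1)\<^sup>1\<^sup>/\<^sup>2 \<beta>(1)\<^sup>1\<^sup>/\<^sup>2\<close>.\<close>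

lemma functional_domination:
  fixes \<phi> :: "'h oper \<Rightarrow> complex" and \<alpha> \<beta> :: "'h oper \<Rightarrow> real"
  assumes \<phi>_add: "\<And>A B. A \<in> M \<Longrightarrow> B \<in> M \<Longrightarrow> \<phi> (A + B) = \<phi> A + \<phi> B"
    and \<phi>_scale: "\<And>c A. A \<in> M \<Longrightarrow> \<phi> (op_scaleC c A) = c * \<phi> A"
    and \<alpha>_add: "\<And>A B. A \<in> M \<Longrightarrow> B \<in> M \<Longrightarrow> \<alpha> (A + B) = \<alpha> A + \<alpha> B"
    and \<beta>_add: "\<And>A B. A \<in> M \<Longrightarrow> B \<in> M \<Longrightarrow> \<beta> (A + B) = \<beta> A + \<beta> B"
    and pos: "\<And>Q. Q \<in> M \<Longrightarrow> op_pos Q \<Longrightarrow> 0 \<le> \<alpha> Q \<and> 0 \<le> \<beta> Q \<and> cmod (\<phi> Q) \<le> sqrt (\<alpha> Q) * sqrt (\<beta> Q)"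
    and V: "V \<in> M" "norm V \<le> 1"
  shows "cmod (\<phi> V) \<le> sqrt (\<alpha> id_blinfun) * sqrt (\<beta> id_blinfun)"
proof -
  define B where "B = sqrt (\<alpha> id_blinfun) * sqrt (\<beta> id_blinfun)"
  have "\<phi> 0 = 0" "\<alpha> 0 = 0" "\<beta> 0 = 0"
    using \<phi>_add[of 0 0] \<alpha>_add[of 0 0] \<beta>_add[of 0 0] by simp_all
  then have \<phi>_sum: "\<phi> (sum F I) = (\<Sum>i\<in>I. \<phi> (F i))" and \<alpha>_sum: "\<alpha> (sum F I) = (\<Sum>i\<in>I. \<alpha> (F i))"
    and \<beta>_sum: "\<beta> (sum F I) = (\<Sum>i\<in>I. \<beta> (F i))" if "\<And>i. F i \<in> M" for F :: "nat \<Rightarrow> 'h oper" and I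
    using that by (induction I rule: infinite_finite_induct) (simp_all add: \<phi>_add \<alpha>_add \<beta>_add)
  have bd: "real n / real (Suc n) * cmod (\<phi> V) \<le> B" if n: "0 < n" for n
  proof -
    define K where "K = Suc (Suc n)"
    define Q where "Q m = (1 / (real K * real (Suc n))) *\<^sub>R fejer_sum (op_scaleC (unity_root K m) V) (Suc n)" for m
    have QM: "Q m \<in> M" for m using V by (simp add: Q_def)
    have Qpos: "op_pos (Q m)" for m
    proof -
      have "norm (op_scaleC (unity_root K m) V) \<le> 1"
      proof (rule norm_blinfun_bound)
        show "norm (op_scaleC (unity_root K m) V x) \<le> 1 * norm x" for x
          using norm_blinfun[of V x] mult_right_mono[OF V(2), of "norm x"] by (simp add: norm_scaleC)
      qed simp
      then show ?thesis
        using V unfolding Q_def by (intro op_pos_scaleR fejer_sum_pos) auto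
    qed
    have Vb: "V \<in> bops" using V by simp
    note dec = fejer_decomposition[OF Vb n, folded K_def, folded Q_def]
    have "of_real (real n / real (Suc n)) * \<phi> V = \<phi> ((real n / real (Suc n)) *\<^sub>R V)"
    proof -
      have "(real n / real (Suc n)) *\<^sub>R V = op_scaleC (of_real (real n / real (Suc n))) V"
        by (rule blinfun_eqI) (simp add: blinfun.bilinear_simps scaleR_scaleC)
      then show ?thesis using \<phi>_scale[OF V(1)] by metis
    qed
    also have "\<dots> = (\<Sum>m<K. cnj (unity_root K m) * \<phi> (Q m))"
      unfolding dec(2)[symmetric] using QM by (simp add: \<phi>_sum \<phi>_scale)
    finally have "real n / real (Suc n) * cmod (\<phi> V) = cmod (\<Sum>m<K. cnj (unity_root K m) * \<phi> (Q m))"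
      using norm_mult[of "of_real (real n / real (Suc n))" "\<phi> V"] by (simp only: norm_of_real) simp
    also have "\<dots> \<le> (\<Sum>m<K. cmod (\<phi> (Q m)))"
      by (rule order_trans[OF norm_sum]) (simp add: norm_mult)
    also have "\<dots> \<le> (\<Sum>m<K. \<bar>sqrt (\<alpha> (Q m))\<bar> * \<bar>sqrt (\<beta> (Q m))\<bar>)"
      using pos[OF QM Qpos] by (intro sum_mono) simp
    also have "\<dots> \<le> L2_set (\<lambda>m. sqrt (\<alpha> (Q m))) {..<K} * L2_set (\<lambda>m. sqrt (\<beta> (Q m))) {..<K}"
      by (rule L2_set_mult_ineq)
    also have "\<dots> = sqrt (\<alpha> (\<Sum>m<K. Q m)) * sqrt (\<beta> (\<Sum>m<K. Q m))"
      using pos[OF QM Qpos] QM by (simp add: L2_set_def \<alpha>_sum \<beta>_sum)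
    finally show ?thesis by (simp add: dec(1) B_def)
  qed
  have le: "real (Suc n) / real (Suc (Suc n)) * cmod (\<phi> V) \<le> B" for n
    by (rule bd) simp
  have "(\<lambda>n. real (Suc n) / real (Suc (Suc n))) \<longlonglongrightarrow> 1"
    using LIMSEQ_n_over_Suc_n by (rule LIMSEQ_Suc)
  then have "(\<lambda>n. real (Suc n) / real (Suc (Suc n)) * cmod (\<phi> V)) \<longlonglongrightarrow> 1 * cmod (\<phi> V)"
    by (intro tendsto_mult tendsto_const)
  then have "1 * cmod (\<phi> V) \<le> B"
    by (rule LIMSEQ_le_const2) (use le in blast)
  then show ?thesis by (simp add: B_def)
qed

end

context vn_trace
begin

section \<open>Functionals on Cauchy sequences\<close>

lemma op_power_abs_2: "X \<in> bops \<Longrightarrow> op_power (op_abs X) 2 = op_adj X o\<^sub>L X"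
  by (simp add: numeral_2_eq_2 op_power_simps op_abs)

lemma Lp_core_2: "Lp_core M \<rho> 2 = HS"
  by (auto simp: Lp_core_def HS_def fin_pos_def op_power_abs_2 op_pos_adj_compose)

lemma core_norm_2: "X \<in> M \<Longrightarrow> core_norm \<rho> 2 X = hs_norm X"
  by (simp add: core_norm_def hs_norm_def rtr_def op_power_abs_2 sqrt_def)

lemma Lp_core_1: "Lp_core M \<rho> 1 = L1"
  by (auto simp: Lp_core_def L1_def fin_pos_def op_power_simps op_abs)

lemma core_norm_1: "core_norm \<rho> 1 X = tr_norm X"
  by (simp add: core_norm_def tr_norm_def rtr_def op_power_simps)

lemma L1_M: "X \<in> L1 \<Longrightarrow> X \<in> M"
  by (simp add: L1_def)

lemma L1_diff: "X \<in> L1 \<Longrightarrow> Y \<in> L1 \<Longrightarrow> X - Y \<in> L1"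
  using tr_norm_triangle(1)[of X "- Y"] tr_norm_minus(2)[of Y] by simp

lemma tr_norm_commute: "X \<in> L1 \<Longrightarrow> Y \<in> L1 \<Longrightarrow> tr_norm (X - Y) = tr_norm (Y - X)"
  using tr_norm_minus(1)[of "X - Y"] by (simp add: L1_M)

lemma tr_norm_diff_triangle:
  "X \<in> L1 \<Longrightarrow> Y \<in> L1 \<Longrightarrow> Z \<in> L1 \<Longrightarrow> tr_norm (X - Z) \<le> tr_norm (X - Y) + tr_norm (Y - Z)"
  using tr_norm_triangle(2)[of "X - Y" "Y - Z"] by (simp add: L1_diff)

lemma tr_norm_diff_le:
  assumes "X \<in> L1" "Y \<in> L1"
  shows "\<bar>tr_norm X - tr_norm Y\<bar> \<le> tr_norm (X - Y)"
proof -
  have "tr_norm X \<le> tr_norm (X - Y) + tr_norm Y" "tr_norm Y \<le> tr_norm (Y - X) + tr_norm X"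
    using tr_norm_triangle(2)[of "X - Y" Y] tr_norm_triangle(2)[of "Y - X" X] assms
    by (simp_all add: L1_diff)
  with tr_norm_commute[OF assms] show ?thesis by linarith
qed

lemma hs_norm_commute: "X \<in> HS \<Longrightarrow> Y \<in> HS \<Longrightarrow> hs_norm (X - Y) = hs_norm (Y - X)"
  using hs_norm_minus[of "X - Y"] by (simp add: HS_diff)

lemma hs_norm_diff_triangle:
  "X \<in> HS \<Longrightarrow> Y \<in> HS \<Longrightarrow> Z \<in> HS \<Longrightarrow> hs_norm (X - Z) \<le> hs_norm (X - Y) + hs_norm (Y - Z)"
  using hs_norm_triangle[of "X - Y" "Y - Z"] by (simp add: HS_diff)

lemma hs_norm_diff_le:
  assumes "X \<in> HS" "Y \<in> HS"
  shows "\<bar>hs_norm X - hs_norm Y\<bar> \<le> hs_norm (X - Y)"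
proof -
  have "hs_norm X \<le> hs_norm (X - Y) + hs_norm Y" "hs_norm Y \<le> hs_norm (Y - X) + hs_norm X"
    using hs_norm_triangle[of "X - Y" Y] hs_norm_triangle[of "Y - X" X] assms
    by (simp_all add: HS_diff)
  with hs_norm_commute[OF assms] show ?thesis by linarith
qed

lemma hs_norm_scaleC_le:
  assumes "X \<in> HS"
  shows "hs_norm (op_scaleC c X) \<le> cmod c * hs_norm X"
proof -
  have eq: "op_scaleC c id_blinfun o\<^sub>L X = op_scaleC c X"
    by (rule blinfun_eqI) simp
  have "norm (op_scaleC c id_blinfun :: 'h oper) \<le> cmod c"
    by (rule norm_blinfun_bound) (simp_all add: norm_scaleC)
  then have "norm (op_scaleC c id_blinfun :: 'h oper) * hs_norm X \<le> cmod c * hs_norm X"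
    by (rule mult_right_mono) simp
  with HS_left(2)[OF assms, of "op_scaleC c id_blinfun"] show ?thesis
    by (simp add: eq)
qed

lemma Lp_Cauchy_2_iff: "f \<in> Lp_Cauchy M \<rho> 2 \<longleftrightarrow>
   (\<forall>n. f n \<in> HS) \<and> (\<forall>e>0. \<exists>N. \<forall>m\<ge>N. \<forall>n\<ge>N. hs_norm (f m - f n) < e)"
proof -
  have "core_norm \<rho> 2 (f m - f n) = hs_norm (f m - f n)" if "\<forall>n. f n \<in> HS" for m n
    using that by (simp add: core_norm_2 HS_M)
  then show ?thesis
    by (auto simp: Lp_Cauchy_def Lp_core_2)
qed

lemma Lp_Cauchy_2D: "f \<in> Lp_Cauchy M \<rho> 2 \<Longrightarrow> f n \<in> HS"
  by (simp add: Lp_Cauchy_2_iff)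

lemma Lp_Cauchy_2E:
  assumes "f \<in> Lp_Cauchy M \<rho> 2" "0 < e"
  obtains N where "\<And>m n. N \<le> m \<Longrightarrow> N \<le> n \<Longrightarrow> hs_norm (f m - f n) < e"
  using assms unfolding Lp_Cauchy_2_iff by blast

lemma Lp_Cauchy_2_bounded:
  assumes f: "f \<in> Lp_Cauchy M \<rho> 2"
  shows "\<exists>B. 0 \<le> B \<and> (\<forall>n. hs_norm (f n) \<le> B)"
proof -
  have "Cauchy (\<lambda>n. hs_norm (f n))"
  proof (rule metric_CauchyI)
    fix e :: real assume "0 < e"
    with f obtain N where N: "\<And>m n. N \<le> m \<Longrightarrow> N \<le> n \<Longrightarrow> hs_norm (f m - f n) < e"
      by (rule Lp_Cauchy_2E) blast
    have "dist (hs_norm (f m)) (hs_norm (f n)) < e" if "N \<le> m" "N \<le> n" for m n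
      using hs_norm_diff_le[of "f m" "f n"] N[OF that] f by (simp add: Lp_Cauchy_2D dist_real_def)
    then show "\<exists>N. \<forall>m\<ge>N. \<forall>n\<ge>N. dist (hs_norm (f m)) (hs_norm (f n)) < e" by blast
  qed
  then have "Bseq (\<lambda>n. hs_norm (f n))" by (rule Cauchy_Bseq)
  then obtain B where "0 < B" "\<And>n. norm (hs_norm (f n)) \<le> B" by (auto elim: BseqE)
  then show ?thesis by (intro exI[of _ B]) auto
qed

lemma sandwich_trace_class:
  assumes "B \<in> HS" "X \<in> HS" "A \<in> M"
  shows "B o\<^sub>L (X o\<^sub>L A) \<in> trace_class"
  by (rule HS_compose(1)[OF HS_right(1)]) fact+

lemma cmod_tr_sandwich_le:
  assumes "B \<in> HS" "X \<in> HS" "A \<in> M"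
  shows "cmod (tr (B o\<^sub>L (X o\<^sub>L A))) \<le> hs_norm B * (norm A * hs_norm X)"
  by (rule order_trans[OF HS_Cauchy_Schwarz mult_left_mono[OF HS_right(2)]])
    (simp_all add: assms HS_right(1))

lemma tr_sandwich_diff:
  assumes "B \<in> HS" "X \<in> HS" "Y \<in> HS" "A \<in> M"
  shows "tr (B o\<^sub>L ((X - Y) o\<^sub>L A)) = tr (B o\<^sub>L (X o\<^sub>L A)) - tr (B o\<^sub>L (Y o\<^sub>L A))"
proof -
  have "B o\<^sub>L ((X - Y) o\<^sub>L A) = (B o\<^sub>L (X o\<^sub>L A)) - (B o\<^sub>L (Y o\<^sub>L A))"
    by (rule blinfun_eqI) (simp add: blinfun.bilinear_simps)
  then show ?thesis
    using tr_diff[OF sandwich_trace_class sandwich_trace_class] assms by simp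
qed

text \<open>For a sequence \<open>f\<close> representing \<open>F \<in> L\<^sup>2\<close> this is the trace of \<open>B F A\<close>.\<close>

definition lim_tr :: "(nat \<Rightarrow> 'h oper) \<Rightarrow> 'h oper \<Rightarrow> 'h oper \<Rightarrow> complex" where
  "lim_tr f B A = lim (\<lambda>n. tr (B o\<^sub>L (f n o\<^sub>L A)))"

lemma lim_tr:
  assumes f: "f \<in> Lp_Cauchy M \<rho> 2" and B: "B \<in> HS" and A: "A \<in> M"
  shows "(\<lambda>n. tr (B o\<^sub>L (f n o\<^sub>L A))) \<longlonglongrightarrow> lim_tr f B A"
proof -
  define c where "c = hs_norm B * norm A"
  have c: "0 \<le> c" by (simp add: c_def)
  have "Cauchy (\<lambda>n. tr (B o\<^sub>L (f n o\<^sub>L A)))"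
  proof (rule metric_CauchyI)
    fix e :: real assume e: "0 < e"
    have "0 < e / (c + 1)" using e c by simp
    with f obtain N where N: "\<And>m n. N \<le> m \<Longrightarrow> N \<le> n \<Longrightarrow> hs_norm (f m - f n) < e / (c + 1)"
      by (rule Lp_Cauchy_2E) blast
    have "dist (tr (B o\<^sub>L (f m o\<^sub>L A))) (tr (B o\<^sub>L (f n o\<^sub>L A))) < e" if "N \<le> m" "N \<le> n" for m n
    proof -
      have "dist (tr (B o\<^sub>L (f m o\<^sub>L A))) (tr (B o\<^sub>L (f n o\<^sub>L A))) = cmod (tr (B o\<^sub>L ((f m - f n) o\<^sub>L A)))"
        using f B A by (simp add: dist_norm tr_sandwich_diff Lp_Cauchy_2D)
      also have "\<dots> \<le> hs_norm B * (norm A * hs_norm (f m - f n))"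
        by (intro cmod_tr_sandwich_le HS_diff Lp_Cauchy_2D[OF f] B A)
      also have "\<dots> \<le> (c + 1) * hs_norm (f m - f n)"
        by (simp add: c_def algebra_simps)
      also have "\<dots> < e" using N[OF that] c by (simp add: field_simps)
      finally show ?thesis .
    qed
    then show "\<exists>N. \<forall>m\<ge>N. \<forall>n\<ge>N. dist (tr (B o\<^sub>L (f m o\<^sub>L A))) (tr (B o\<^sub>L (f n o\<^sub>L A))) < e"
      by blast
  qed
  then show ?thesis
    unfolding lim_tr_def by (simp add: Cauchy_convergent_iff convergent_LIMSEQ_iff)
qed

text \<open>Uniformity in \<open>Z\<close> matters because the contraction that computes the trace norm of \<open>W f\<^sub>m W\<close>
  changes with \<open>m\<close>.\<close>

lemma lim_tr_uniform:
  assumes f: "f \<in> Lp_Cauchy M \<rho> 2" and W: "W \<in> HS" and e: "0 < e"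
  shows "\<exists>N. \<forall>m\<ge>N. \<forall>Z\<in>M. norm Z \<le> 1 \<longrightarrow>
    cmod (tr ((Z o\<^sub>L W) o\<^sub>L (f m o\<^sub>L W)) - lim_tr f (Z o\<^sub>L W) W) \<le> e"
proof -
  have WM: "W \<in> M" using W by (rule HS_M)
  define c where "c = hs_norm W * norm W"
  have c: "0 \<le> c" by (simp add: c_def)
  have "0 < e / (c + 1)" using e c by simp
  with f obtain N where N: "\<And>m n. N \<le> m \<Longrightarrow> N \<le> n \<Longrightarrow> hs_norm (f m - f n) < e / (c + 1)"
    by (rule Lp_Cauchy_2E) blast
  have "cmod (tr ((Z o\<^sub>L W) o\<^sub>L (f m o\<^sub>L W)) - lim_tr f (Z o\<^sub>L W) W) \<le> e"
    if m: "N \<le> m" and Z: "Z \<in> M" "norm Z \<le> 1" for m Z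
  proof -
    have ZW: "Z o\<^sub>L W \<in> HS" by (rule HS_left(1)[OF W Z(1)])
    have "hs_norm (Z o\<^sub>L W) \<le> norm Z * hs_norm W" by (rule HS_left(2)[OF W Z(1)])
    also have "\<dots> \<le> 1 * hs_norm W" by (rule mult_right_mono[OF Z(2)]) simp
    finally have nZW: "hs_norm (Z o\<^sub>L W) \<le> hs_norm W" by simp
    have le: "cmod (tr ((Z o\<^sub>L W) o\<^sub>L (f m o\<^sub>L W)) - tr ((Z o\<^sub>L W) o\<^sub>L (f n o\<^sub>L W))) \<le> e" if "N \<le> n" for n
    proof -
      have "cmod (tr ((Z o\<^sub>L W) o\<^sub>L (f m o\<^sub>L W)) - tr ((Z o\<^sub>L W) o\<^sub>L (f n o\<^sub>L W))) =
          cmod (tr ((Z o\<^sub>L W) o\<^sub>L ((f m - f n) o\<^sub>L W)))"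
        using f ZW WM by (simp add: tr_sandwich_diff Lp_Cauchy_2D)
      also have "\<dots> \<le> hs_norm (Z o\<^sub>L W) * (norm W * hs_norm (f m - f n))"
        by (intro cmod_tr_sandwich_le HS_diff Lp_Cauchy_2D[OF f] ZW WM)
      also have "\<dots> \<le> hs_norm W * (norm W * hs_norm (f m - f n))"
        by (rule mult_right_mono[OF nZW]) simp
      also have "\<dots> \<le> (c + 1) * hs_norm (f m - f n)"
        by (simp add: c_def algebra_simps)
      also have "\<dots> \<le> e" using N[OF m that] c by (simp add: field_simps)
      finally show ?thesis .
    qed
    have "(\<lambda>n. cmod (tr ((Z o\<^sub>L W) o\<^sub>L (f m o\<^sub>L W)) - tr ((Z o\<^sub>L W) o\<^sub>L (f n o\<^sub>L W))))
        \<longlonglongrightarrow> cmod (tr ((Z o\<^sub>L W) o\<^sub>L (f m o\<^sub>L W)) - lim_tr f (Z o\<^sub>L W) W)"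
      by (intro tendsto_intros lim_tr f ZW WM)
    then show ?thesis
      by (rule LIMSEQ_le_const2) (use le in blast)
  qed
  then show ?thesis by blast
qed

lemma Lp_Cauchy_2_add:
  assumes f: "f \<in> Lp_Cauchy M \<rho> 2" and g: "g \<in> Lp_Cauchy M \<rho> 2"
  shows "(\<lambda>n. f n + g n) \<in> Lp_Cauchy M \<rho> 2"
  unfolding Lp_Cauchy_2_iff
proof (intro conjI allI impI)
  show "f n + g n \<in> HS" for n using f g by (intro HS_add Lp_Cauchy_2D)
  fix e :: real assume "0 < e"
  then have e: "0 < e / 2" by simp
  from f e obtain N where N: "\<And>m n. N \<le> m \<Longrightarrow> N \<le> n \<Longrightarrow> hs_norm (f m - f n) < e / 2"
    by (rule Lp_Cauchy_2E) blast
  from g e obtain N' where N': "\<And>m n. N' \<le> m \<Longrightarrow> N' \<le> n \<Longrightarrow> hs_norm (g m - g n) < e / 2"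
    by (rule Lp_Cauchy_2E) blast
  have "hs_norm ((f m + g m) - (f n + g n)) < e" if "max N N' \<le> m" "max N N' \<le> n" for m n
  proof -
    have "hs_norm ((f m - f n) + (g m - g n)) \<le> hs_norm (f m - f n) + hs_norm (g m - g n)"
      using f g by (intro hs_norm_triangle HS_diff Lp_Cauchy_2D)
    also have "\<dots> < e / 2 + e / 2" using that by (intro add_strict_mono N N') auto
    finally show ?thesis by (simp add: algebra_simps)
  qed
  then show "\<exists>N. \<forall>m\<ge>N. \<forall>n\<ge>N. hs_norm ((f m + g m) - (f n + g n)) < e" by blast
qed

lemma Lp_Cauchy_2_scaleC:
  assumes f: "f \<in> Lp_Cauchy M \<rho> 2"
  shows "(\<lambda>n. op_scaleC c (f n)) \<in> Lp_Cauchy M \<rho> 2"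
  unfolding Lp_Cauchy_2_iff
proof (intro conjI allI impI)
  show "op_scaleC c (f n) \<in> HS" for n using f by (intro HS_scaleC Lp_Cauchy_2D)
  fix e :: real assume e: "0 < e"
  have c: "0 < cmod c + 1" by (simp add: add_nonneg_pos)
  have "0 < e / (cmod c + 1)" using e c by simp
  with f obtain N where N: "\<And>m n. N \<le> m \<Longrightarrow> N \<le> n \<Longrightarrow> hs_norm (f m - f n) < e / (cmod c + 1)"
    by (rule Lp_Cauchy_2E) blast
  have "hs_norm (op_scaleC c (f m) - op_scaleC c (f n)) < e" if "N \<le> m" "N \<le> n" for m n
  proof -
    have "op_scaleC c (f m) - op_scaleC c (f n) = op_scaleC c (f m - f n)"
      by (rule blinfun_eqI) (simp add: blinfun.bilinear_simps scaleC_diff_right)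
    then have "hs_norm (op_scaleC c (f m) - op_scaleC c (f n)) \<le> cmod c * hs_norm (f m - f n)"
      using hs_norm_scaleC_le[of "f m - f n" c] f by (simp add: HS_diff Lp_Cauchy_2D)
    also have "\<dots> \<le> (cmod c + 1) * hs_norm (f m - f n)"
      by (simp add: algebra_simps)
    also have "\<dots> < e" using N[OF that] c by (simp add: field_simps)
    finally show ?thesis .
  qed
  then show "\<exists>N. \<forall>m\<ge>N. \<forall>n\<ge>N. hs_norm (op_scaleC c (f m) - op_scaleC c (f n)) < e" by blast
qed

lemma lim_tr_add:
  assumes f: "f \<in> Lp_Cauchy M \<rho> 2" and g: "g \<in> Lp_Cauchy M \<rho> 2" and B: "B \<in> HS" and A: "A \<in> M"
  shows "lim_tr (\<lambda>n. f n + g n) B A = lim_tr f B A + lim_tr g B A"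
proof (rule LIMSEQ_unique[OF lim_tr[OF Lp_Cauchy_2_add[OF f g] B A]])
  have "B o\<^sub>L ((f n + g n) o\<^sub>L A) = (B o\<^sub>L (f n o\<^sub>L A)) + (B o\<^sub>L (g n o\<^sub>L A))" for n
    by (rule blinfun_eqI) (simp add: blinfun.bilinear_simps)
  then have "tr (B o\<^sub>L ((f n + g n) o\<^sub>L A)) = tr (B o\<^sub>L (f n o\<^sub>L A)) + tr (B o\<^sub>L (g n o\<^sub>L A))" for n
    using tr_add[OF sandwich_trace_class sandwich_trace_class] B A f g by (simp add: Lp_Cauchy_2D)
  then show "(\<lambda>n. tr (B o\<^sub>L ((f n + g n) o\<^sub>L A))) \<longlonglongrightarrow> lim_tr f B A + lim_tr g B A"
    using tendsto_add[OF lim_tr[OF f B A] lim_tr[OF g B A]] by simp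
qed

lemma lim_tr_scaleC:
  assumes f: "f \<in> Lp_Cauchy M \<rho> 2" and B: "B \<in> HS" and A: "A \<in> M"
  shows "lim_tr (\<lambda>n. op_scaleC c (f n)) B A = c * lim_tr f B A"
proof (rule LIMSEQ_unique[OF lim_tr[OF Lp_Cauchy_2_scaleC[OF f] B A]])
  have "B o\<^sub>L (op_scaleC c (f n) o\<^sub>L A) = op_scaleC c (B o\<^sub>L (f n o\<^sub>L A))" for n
    by (rule blinfun_eqI) (use HS_M[OF B] in \<open>simp add: bops_apply\<close>)
  then have "tr (B o\<^sub>L (op_scaleC c (f n) o\<^sub>L A)) = c * tr (B o\<^sub>L (f n o\<^sub>L A))" for n
    using tr_scaleC[OF sandwich_trace_class] B A f by (simp add: Lp_Cauchy_2D)
  then show "(\<lambda>n. tr (B o\<^sub>L (op_scaleC c (f n) o\<^sub>L A))) \<longlonglongrightarrow> c * lim_tr f B A"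
    using tendsto_mult_left[OF lim_tr[OF f B A]] by simp
qed

lemma lim_tr_left_add:
  assumes f: "f \<in> Lp_Cauchy M \<rho> 2" and B: "B \<in> HS" "B' \<in> HS" and A: "A \<in> M"
  shows "lim_tr f (B + B') A = lim_tr f B A + lim_tr f B' A"
proof (rule LIMSEQ_unique[OF lim_tr[OF f HS_add[OF B] A]])
  have "(B + B') o\<^sub>L (f n o\<^sub>L A) = (B o\<^sub>L (f n o\<^sub>L A)) + (B' o\<^sub>L (f n o\<^sub>L A))" for n
    by (rule blinfun_eqI) (simp add: blinfun.bilinear_simps)
  then have "tr ((B + B') o\<^sub>L (f n o\<^sub>L A)) = tr (B o\<^sub>L (f n o\<^sub>L A)) + tr (B' o\<^sub>L (f n o\<^sub>L A))" for n
    using tr_add[OF sandwich_trace_class sandwich_trace_class] B A f by (simp add: Lp_Cauchy_2D)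
  then show "(\<lambda>n. tr ((B + B') o\<^sub>L (f n o\<^sub>L A))) \<longlonglongrightarrow> lim_tr f B A + lim_tr f B' A"
    using tendsto_add[OF lim_tr[OF f B(1) A] lim_tr[OF f B(2) A]] by simp
qed

lemma lim_tr_left_scaleC:
  assumes f: "f \<in> Lp_Cauchy M \<rho> 2" and B: "B \<in> HS" and A: "A \<in> M"
  shows "lim_tr f (op_scaleC c B) A = c * lim_tr f B A"
proof (rule LIMSEQ_unique[OF lim_tr[OF f HS_scaleC[OF B] A]])
  have "op_scaleC c B o\<^sub>L (f n o\<^sub>L A) = op_scaleC c (B o\<^sub>L (f n o\<^sub>L A))" for n
    by (rule blinfun_eqI) simp
  then have "tr (op_scaleC c B o\<^sub>L (f n o\<^sub>L A)) = c * tr (B o\<^sub>L (f n o\<^sub>L A))" for n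
    using tr_scaleC[OF sandwich_trace_class] B A f by (simp add: Lp_Cauchy_2D)
  then show "(\<lambda>n. tr (op_scaleC c B o\<^sub>L (f n o\<^sub>L A))) \<longlonglongrightarrow> c * lim_tr f B A"
    using tendsto_mult_left[OF lim_tr[OF f B A]] by simp
qed

text \<open>For \<open>Q = C\<^sup>2\<close> cyclicity of the trace turns \<open>tr (Q W X W)\<close> into \<open>tr (A\<^sup>* X A)\<close> with \<open>A = W C\<close>.\<close>

lemma lim_tr_symmetrize:
  assumes f: "f \<in> Lp_Cauchy M \<rho> 2" and W: "W \<in> HS" "op_pos W" and Q: "Q \<in> M" "op_pos Q"
  shows "lim_tr f (Q o\<^sub>L W) W = lim_tr f (op_adj (W o\<^sub>L op_sqrt Q)) (W o\<^sub>L op_sqrt Q)"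
proof (rule LIMSEQ_unique)
  let ?C = "op_sqrt Q"
  have C: "?C \<in> M" "op_adj ?C = ?C" "?C o\<^sub>L ?C = Q"
    using Q op_sqrt(1,2)[OF Q(2)] by (auto intro: op_posD(2))
  have WM: "W \<in> M" "op_adj W = W" using W by (simp_all add: HS_M op_posD(2))
  have CW: "?C o\<^sub>L W \<in> HS" and WC: "W o\<^sub>L ?C \<in> HS"
    using W C by (simp_all add: HS_left HS_right)
  have A: "op_adj (W o\<^sub>L ?C) = ?C o\<^sub>L W" using C WM by simp
  show "(\<lambda>n. tr ((Q o\<^sub>L W) o\<^sub>L (f n o\<^sub>L W))) \<longlonglongrightarrow> lim_tr f (Q o\<^sub>L W) W"
    by (rule lim_tr[OF f HS_left(1)[OF W(1) Q(1)] WM(1)])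
  have "tr ((Q o\<^sub>L W) o\<^sub>L (f n o\<^sub>L W)) = tr (op_adj (W o\<^sub>L ?C) o\<^sub>L (f n o\<^sub>L (W o\<^sub>L ?C)))" for n
  proof -
    have fn: "f n \<in> HS" using f by (rule Lp_Cauchy_2D)
    have fW: "f n o\<^sub>L W \<in> HS" by (rule HS_right(1)[OF fn WM(1)])
    have "(Q o\<^sub>L W) o\<^sub>L (f n o\<^sub>L W) = (?C o\<^sub>L (?C o\<^sub>L W)) o\<^sub>L (f n o\<^sub>L W)"
      using C(3) by (simp add: op_compose_assoc[symmetric])
    also have "tr \<dots> = tr ((f n o\<^sub>L W) o\<^sub>L (?C o\<^sub>L (?C o\<^sub>L W)))"
      by (rule HS_compose(2)[OF fW HS_left(1)[OF CW C(1)]])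
    also have "(f n o\<^sub>L W) o\<^sub>L (?C o\<^sub>L (?C o\<^sub>L W)) = ((f n o\<^sub>L W) o\<^sub>L ?C) o\<^sub>L (?C o\<^sub>L W)"
      by (simp add: op_compose_assoc)
    also have "tr \<dots> = tr ((?C o\<^sub>L W) o\<^sub>L ((f n o\<^sub>L W) o\<^sub>L ?C))"
      by (rule HS_compose(2)[OF CW HS_right(1)[OF fW C(1)]])
    finally show ?thesis by (simp only: A op_compose_assoc)
  qed
  moreover have "(\<lambda>n. tr (op_adj (W o\<^sub>L ?C) o\<^sub>L (f n o\<^sub>L (W o\<^sub>L ?C)))) \<longlonglongrightarrow>
      lim_tr f (op_adj (W o\<^sub>L ?C)) (W o\<^sub>L ?C)"
    by (rule lim_tr[OF f HS_adj(1)[OF WC] HS_M[OF WC]])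
  ultimately show "(\<lambda>n. tr ((Q o\<^sub>L W) o\<^sub>L (f n o\<^sub>L W))) \<longlonglongrightarrow>
      lim_tr f (op_adj (W o\<^sub>L ?C)) (W o\<^sub>L ?C)"
    by simp
qed

section \<open>Positivity\<close>

text \<open>\<open>Z + Z\<^sup>* + 2e\<close> is positive, hence so is its conjugate by \<open>A\<close>, whose trace is evaluated by linearity.\<close>

lemma Re_tr_conj_ge:
  assumes Z: "Z \<in> M" and A: "A \<in> HS" and bd: "\<And>x. - e * (norm x)\<^sup>2 \<le> Re (cinner (Z x) x)"
  shows "- e * (hs_norm A)\<^sup>2 \<le> Re (tr (op_adj A o\<^sub>L (Z o\<^sub>L A)))"
proof -
  have AM: "A \<in> M" using A by (rule HS_M)
  define Y where "Y = Z + op_adj Z + (2 * e) *\<^sub>R id_blinfun"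
  have Y: "op_pos Y"
  proof (rule op_posI)
    show "Y \<in> bops" "op_adj Y = Y" using Z by (simp_all add: Y_def add.commute)
    fix x
    have "inner (Y x) x = 2 * Re (cinner (Z x) x) + 2 * e * (norm x)\<^sup>2"
    proof -
      have "Re (cinner x (Z x)) = Re (cinner (Z x) x)"
        by (subst cinner_commute) simp
      moreover have "Re (cinner x x) = (norm x)\<^sup>2"
        by (simp add: cinner_self dot_square_norm)
      ultimately show ?thesis
        using Z by (simp add: inner_eq_Re_cinner Y_def blinfun.bilinear_simps cinner_simps
            cinner_op_adj_left)
    qed
    with bd[of x] show "0 \<le> inner (Y x) x" by simp
  qed
  let ?T = "op_adj A o\<^sub>L (Z o\<^sub>L A)"
  have T: "?T \<in> trace_class"
    by (rule HS_compose(1)[OF HS_left(1)[OF A Z] HS_adj(1)[OF A]])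
  have eq: "op_adj A o\<^sub>L Y o\<^sub>L A = (?T + op_adj ?T) + op_scaleC (2 * e) (op_adj A o\<^sub>L A)"
    by (rule op_eqI) (use AM Z in \<open>simp add: Y_def blinfun.bilinear_simps cinner_simps
        cinner_op_adj_left\<close>)
  have AA: "op_adj A o\<^sub>L A \<in> fin_pos" using A by (rule HS_fin_pos)
  have *: "op_adj A o\<^sub>L Y o\<^sub>L A \<in> trace_class"
    "tr (op_adj A o\<^sub>L Y o\<^sub>L A) = (tr ?T + cnj (tr ?T)) + 2 * e * (hs_norm A)\<^sup>2"
    unfolding eq using tr_add tr_adj[OF T] tr_scaleC tr_fin_pos[OF AA] T
    by (simp_all add: hs_norm_sq)
  have "op_adj A o\<^sub>L Y o\<^sub>L A \<in> fin_pos"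
    by (rule trace_class_pos[OF *(1) op_pos_conj[OF Y]]) (use AM in simp)
  then have "tr (op_adj A o\<^sub>L Y o\<^sub>L A) = rtr (op_adj A o\<^sub>L Y o\<^sub>L A)"
    using tr_fin_pos by blast
  then have "0 \<le> Re (tr (op_adj A o\<^sub>L Y o\<^sub>L A))" by simp
  then show ?thesis unfolding *(2) by simp
qed

lemma norm_projection_le:
  assumes "P \<in> projections M"
  shows "norm P \<le> 1"
proof (rule norm_blinfun_bound)
  fix x
  have P: "P \<in> M" "op_adj P = P" "P (P x) = P x"
    using assms op_compose_eq_apply[of P P P id_blinfun x] by (auto simp: projections_def)
  have "(norm (P x))\<^sup>2 = inner (P x) x"
    using inner_op_adj_right[of P "P x" x] P by (simp add: power2_norm_eq_inner)
  also have "\<dots> \<le> norm (P x) * norm x" by (rule norm_cauchy_schwarz)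
  finally show "norm (P x) \<le> 1 * norm x"
    by (cases "P x = 0") (simp_all add: power2_eq_square)
qed simp

text \<open>With \<open>R = 1 - P\<close> the difference splits as \<open>A\<^sup>* R X A + A\<^sup>* P X R A\<close>. Each term contains \<open>R\<close>, whose
  Hilbert--Schmidt norm is at most \<open>d\<^sup>1\<^sup>/\<^sup>2\<close>, next to a bounded operator.\<close>

lemma compression_error:
  assumes P: "P \<in> projections M" and small: "\<rho> (id_blinfun - P) \<le> ennreal d" and d: "0 \<le> d"
    and X: "X \<in> HS" "hs_norm X \<le> B" and A: "A \<in> HS"
  shows "cmod (tr (op_adj A o\<^sub>L (X o\<^sub>L A)) - tr (op_adj A o\<^sub>L ((P o\<^sub>L X o\<^sub>L P) o\<^sub>L A)))
    \<le> 2 * (norm A)\<^sup>2 * B * sqrt d"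
proof -
  have AM: "A \<in> M" and XM: "X \<in> M" using A X by (simp_all add: HS_M)
  have PM: "P \<in> M" "op_adj P = P" "P o\<^sub>L P = P" using P by (auto simp: projections_def)
  have B: "0 \<le> B" using X(2) hs_norm_nonneg[of X] by linarith
  have nA: "norm (op_adj A) = norm A" using AM by (simp add: norm_op_adj)
  define R where "R = id_blinfun - P"
  have RM: "R \<in> M" using PM by (simp add: R_def)
  have RR: "op_adj R o\<^sub>L R = R"
    using PM op_compose_eq_apply[of P P P id_blinfun]
    by (intro blinfun_eqI) (simp add: R_def blinfun.bilinear_simps)
  have Rpos: "op_pos R" using op_pos_adj_compose[of R] RM by (simp add: RR)
  have Rfin: "R \<in> fin_pos"
    using small Rpos RM by (auto simp: fin_pos_def R_def intro: order.strict_trans1)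
  then have R: "R \<in> HS" using RM by (simp add: HS_def RR)
  have "rtr R \<le> d"
    using enn2real_mono[OF small] d by (simp add: rtr_def R_def)
  then have hsR: "hs_norm R \<le> sqrt d" by (simp add: hs_norm_def RR)
  have HAs: "op_adj A \<in> HS" using A by (rule HS_adj)
  let ?S = "op_adj A o\<^sub>L R" and ?U = "X o\<^sub>L A" and ?S' = "(op_adj A o\<^sub>L P) o\<^sub>L X" and ?U' = "R o\<^sub>L A"
  have mem: "?S \<in> HS" "?U \<in> HS" "?S' \<in> HS" "?U' \<in> HS"
    using HS_left(1)[OF R, of "op_adj A"] HS_right(1)[OF X(1) AM] HS_left(1)[OF X(1), of "op_adj A o\<^sub>L P"]
      HS_right(1)[OF R AM] AM PM by simp_all
  have "hs_norm ?S \<le> norm A * sqrt d"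
    using HS_left(2)[OF R, of "op_adj A"] AM nA mult_left_mono[OF hsR norm_ge_zero[of A]] by simp
  moreover have "hs_norm ?U \<le> norm A * B"
    using HS_right(2)[OF X(1) AM] mult_left_mono[OF X(2) norm_ge_zero[of A]] by simp
  ultimately have 1: "cmod (tr (?S o\<^sub>L ?U)) \<le> (norm A * sqrt d) * (norm A * B)"
    using HS_Cauchy_Schwarz[OF mem(2,1)] by (rule_tac order_trans[OF _ mult_mono]) (auto simp: d B)
  have "norm (op_adj A o\<^sub>L P) \<le> norm (op_adj A) * norm P" by (rule norm_blinfun_compose)
  also have "\<dots> \<le> norm A * 1" unfolding nA by (intro mult_left_mono norm_projection_le P) simp
  finally have "norm (op_adj A o\<^sub>L P) * hs_norm X \<le> norm A * B"
    using X(2) by (intro mult_mono) auto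
  then have "hs_norm ?S' \<le> norm A * B"
    using HS_left(2)[OF X(1), of "op_adj A o\<^sub>L P"] AM PM by simp
  moreover have "hs_norm ?U' \<le> norm A * sqrt d"
    using HS_right(2)[OF R AM] mult_left_mono[OF hsR norm_ge_zero[of A]] by simp
  ultimately have 2: "cmod (tr (?S' o\<^sub>L ?U')) \<le> (norm A * B) * (norm A * sqrt d)"
    using HS_Cauchy_Schwarz[OF mem(4,3)] by (rule_tac order_trans[OF _ mult_mono]) (auto simp: d B)
  have PXP: "P o\<^sub>L X o\<^sub>L P \<in> HS" using X PM by (intro HS_left HS_right)
  have "(op_adj A o\<^sub>L (X o\<^sub>L A)) - (op_adj A o\<^sub>L ((P o\<^sub>L X o\<^sub>L P) o\<^sub>L A)) = (?S o\<^sub>L ?U) + (?S' o\<^sub>L ?U')"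
    by (rule blinfun_eqI) (simp add: R_def blinfun.bilinear_simps)
  then have "tr (op_adj A o\<^sub>L (X o\<^sub>L A)) - tr (op_adj A o\<^sub>L ((P o\<^sub>L X o\<^sub>L P) o\<^sub>L A)) =
      tr (?S o\<^sub>L ?U) + tr (?S' o\<^sub>L ?U')"
    using tr_diff[OF sandwich_trace_class[OF HAs X(1) AM] sandwich_trace_class[OF HAs PXP AM]]
      tr_add[OF HS_compose(1)[OF mem(2,1)] HS_compose(1)[OF mem(4,3)]] by simp
  then have "cmod (tr (op_adj A o\<^sub>L (X o\<^sub>L A)) - tr (op_adj A o\<^sub>L ((P o\<^sub>L X o\<^sub>L P) o\<^sub>L A)))
      \<le> cmod (tr (?S o\<^sub>L ?U)) + cmod (tr (?S' o\<^sub>L ?U'))"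
    by (simp add: norm_triangle_ineq)
  with 1 2 show ?thesis by (simp add: power2_eq_square algebra_simps)
qed

text \<open>The form of \<open>P X P\<close> is within \<open>e \<parallel>x\<parallel>\<^sup>2\<close> of the nonnegative numbers \<open>\<langle>y, P x\<rangle>\<close>. The imaginary part
  is controlled by applying \<open>Re_tr_conj_ge\<close> to \<open>i P X P\<close> and \<open>- i P X P\<close>.\<close>

lemma tr_compression_bounds:
  assumes P: "P \<in> projections M" and X: "X \<in> HS" and A: "A \<in> HS" and e: "0 \<le> e"
    and approx: "\<And>x. \<exists>y. cinner y (P x) \<in> \<real>\<^sub>\<ge>\<^sub>0 \<and> norm (y - X (P x)) \<le> e * norm x"
  shows "- e * (hs_norm A)\<^sup>2 \<le> Re (tr (op_adj A o\<^sub>L ((P o\<^sub>L X o\<^sub>L P) o\<^sub>L A)))"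
    and "\<bar>Im (tr (op_adj A o\<^sub>L ((P o\<^sub>L X o\<^sub>L P) o\<^sub>L A)))\<bar> \<le> e * (hs_norm A)\<^sup>2"
proof -
  have AM: "A \<in> M" and XM: "X \<in> M" using A X by (simp_all add: HS_M)
  have PM: "P \<in> M" "op_adj P = P" using P by (auto simp: projections_def)
  let ?Z = "P o\<^sub>L X o\<^sub>L P"
  have ZH: "?Z \<in> HS" using X PM by (intro HS_left HS_right)
  then have Z: "?Z \<in> M" by (rule HS_M)
  have form: "- e * (norm x)\<^sup>2 \<le> Re (cinner (?Z x) x)" "\<bar>Im (cinner (?Z x) x)\<bar> \<le> e * (norm x)\<^sup>2" for x
  proof -
    obtain y where y: "cinner y (P x) \<in> \<real>\<^sub>\<ge>\<^sub>0" "norm (y - X (P x)) \<le> e * norm x"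
      using approx[of x] by blast
    have Px: "norm (P x) \<le> norm x"
      using norm_blinfun[of P x] mult_right_mono[OF norm_projection_le[OF P], of "norm x"] by simp
    have "cmod (cinner (y - X (P x)) (P x)) \<le> norm (y - X (P x)) * norm (P x)"
      by (rule cinner_Cauchy_Schwarz)
    also have "\<dots> \<le> (e * norm x) * norm x"
      using y(2) Px e by (intro mult_mono) auto
    finally have small: "cmod (cinner (y - X (P x)) (P x)) \<le> e * (norm x)\<^sup>2"
      by (simp add: power2_eq_square)
    have "cinner (?Z x) x = cinner (X (P x)) (P x)"
      using cinner_op_adj_left[of P "X (P x)" x] PM by simp
    then have eq: "cinner (?Z x) x = cinner y (P x) - cinner (y - X (P x)) (P x)"
      by (simp add: cinner_diff_left)
    have "0 \<le> Re (cinner y (P x))" "Im (cinner y (P x)) = 0"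
      using y(1) by (auto simp: complex_nonneg_Reals_iff)
    moreover have "\<bar>Re (cinner (y - X (P x)) (P x))\<bar> \<le> e * (norm x)\<^sup>2"
      "\<bar>Im (cinner (y - X (P x)) (P x))\<bar> \<le> e * (norm x)\<^sup>2"
      using small abs_Re_le_cmod abs_Im_le_cmod order_trans by blast+
    ultimately show "- e * (norm x)\<^sup>2 \<le> Re (cinner (?Z x) x)" "\<bar>Im (cinner (?Z x) x)\<bar> \<le> e * (norm x)\<^sup>2"
      unfolding eq minus_complex.sel by linarith+
  qed
  show "- e * (hs_norm A)\<^sup>2 \<le> Re (tr (op_adj A o\<^sub>L (?Z o\<^sub>L A)))"
    by (rule Re_tr_conj_ge[OF Z A form(1)])
  have scale: "tr (op_adj A o\<^sub>L (op_scaleC c ?Z o\<^sub>L A)) = c * tr (op_adj A o\<^sub>L (?Z o\<^sub>L A))" for c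
  proof -
    have "op_adj A o\<^sub>L (op_scaleC c ?Z o\<^sub>L A) = op_scaleC c (op_adj A o\<^sub>L (?Z o\<^sub>L A))"
      by (rule blinfun_eqI) (use AM in \<open>simp add: bops_apply\<close>)
    then show ?thesis
      using tr_scaleC[OF sandwich_trace_class[OF HS_adj(1)[OF A] ZH AM]] by simp
  qed
  have "- e * (hs_norm A)\<^sup>2 \<le> Re (tr (op_adj A o\<^sub>L (op_scaleC (- \<i>) ?Z o\<^sub>L A)))"
  proof (rule Re_tr_conj_ge[OF _ A])
    show "- e * (norm x)\<^sup>2 \<le> Re (cinner (op_scaleC (- \<i>) ?Z x) x)" for x
      using form(2)[of x] by (simp add: cinner_scaleC_left)
  qed (use Z in simp)
  moreover have "- e * (hs_norm A)\<^sup>2 \<le> Re (tr (op_adj A o\<^sub>L (op_scaleC \<i> ?Z o\<^sub>L A)))"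
  proof (rule Re_tr_conj_ge[OF _ A])
    show "- e * (norm x)\<^sup>2 \<le> Re (cinner (op_scaleC \<i> ?Z x) x)" for x
      using form(2)[of x] by (simp add: cinner_scaleC_left)
  qed (use Z in simp)
  ultimately show "\<bar>Im (tr (op_adj A o\<^sub>L (?Z o\<^sub>L A)))\<bar> \<le> e * (hs_norm A)\<^sup>2"
    unfolding scale by simp
qed

text \<open>The third hypothesis is what convergence in measure to a positive affiliated operator gives: on the
  range of \<open>P\<close> the sequence is close to that operator, whose form is nonnegative there. The part of \<open>f\<^sub>n\<close>
  outside \<open>P\<close> is negligible by \<open>compression_error\<close> and the boundedness of the sequence in \<open>L\<^sup>2\<close>.\<close>

lemma lim_tr_positive:
  assumes f: "f \<in> Lp_Cauchy M \<rho> 2" and A: "A \<in> HS"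
    and approx: "\<And>e d. 0 < e \<Longrightarrow> 0 < d \<Longrightarrow> \<exists>N. \<forall>n\<ge>N. \<exists>P\<in>projections M.
        \<rho> (id_blinfun - P) \<le> ennreal d \<and>
        (\<forall>x. \<exists>y. cinner y (P x) \<in> \<real>\<^sub>\<ge>\<^sub>0 \<and> norm (y - f n (P x)) \<le> e * norm x)"
  shows "0 \<le> Re (lim_tr f (op_adj A) A)" "Im (lim_tr f (op_adj A) A) = 0"
proof -
  have AM: "A \<in> M" using A by (rule HS_M)
  let ?L = "lim_tr f (op_adj A) A"
  obtain B where B: "0 \<le> B" "\<And>n. hs_norm (f n) \<le> B"
    using Lp_Cauchy_2_bounded[OF f] by blast
  have main: "- h \<le> Re ?L \<and> \<bar>Im ?L\<bar> \<le> h" if h: "0 < h" for h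
  proof -
    \<comment> \<open>The total error \<open>h\<close> is split into three equal parts; the summands \<open>1\<close> keep the denominators positive.\<close>
    define e where "e = h / 3 / ((hs_norm A)\<^sup>2 + 1)"
    define s where "s = h / 3 / (2 * (norm A)\<^sup>2 * B + 1)"
    have e: "0 < e" unfolding e_def using h by (intro divide_pos_pos add_nonneg_pos) auto
    have s: "0 < s" unfolding s_def using h B(1) by (intro divide_pos_pos add_nonneg_pos) auto
    have div: "h / 3 / u * u = h / 3" if "0 < u" for u :: real
      using that by simp
    have e_le: "e * (hs_norm A)\<^sup>2 \<le> h / 3"
    proof -
      have "e * (hs_norm A)\<^sup>2 \<le> e * ((hs_norm A)\<^sup>2 + 1)" using e by (intro mult_left_mono) auto
      also have "0 < (hs_norm A)\<^sup>2 + 1" by (simp add: add_nonneg_pos)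
      then have "e * ((hs_norm A)\<^sup>2 + 1) = h / 3"
        unfolding e_def by (rule div)
      finally show ?thesis .
    qed
    have s_le: "2 * (norm A)\<^sup>2 * B * s \<le> h / 3"
    proof -
      have "2 * (norm A)\<^sup>2 * B * s = s * (2 * (norm A)\<^sup>2 * B)" by (rule mult.commute)
      also have "\<dots> \<le> s * (2 * (norm A)\<^sup>2 * B + 1)" using s by (intro mult_left_mono) auto
      also have "0 < 2 * (norm A)\<^sup>2 * B + 1" using B(1) by (intro add_nonneg_pos) auto
      then have "s * (2 * (norm A)\<^sup>2 * B + 1) = h / 3"
        unfolding s_def by (rule div)
      finally show ?thesis .
    qed
    have "0 < s\<^sup>2" using s by simp
    from approx[OF e this] obtain N where N: "\<forall>n\<ge>N. \<exists>P\<in>projections M.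
        \<rho> (id_blinfun - P) \<le> ennreal (s\<^sup>2) \<and>
        (\<forall>x. \<exists>y. cinner y (P x) \<in> \<real>\<^sub>\<ge>\<^sub>0 \<and> norm (y - f n (P x)) \<le> e * norm x)" ..
    have "0 < h / 3" using h by simp
    from LIMSEQ_D[OF lim_tr[OF f HS_adj(1)[OF A] AM] this] obtain N' where
      N': "\<And>n. N' \<le> n \<Longrightarrow> cmod (tr (op_adj A o\<^sub>L (f n o\<^sub>L A)) - ?L) < h / 3" by blast
    define n where "n = max N N'"
    have "N \<le> n" by (simp add: n_def)
    from N[rule_format, OF this] obtain P where P: "P \<in> projections M" "\<rho> (id_blinfun - P) \<le> ennreal (s\<^sup>2)"
      "\<forall>x. \<exists>y. cinner y (P x) \<in> \<real>\<^sub>\<ge>\<^sub>0 \<and> norm (y - f n (P x)) \<le> e * norm x"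
      by (elim bexE conjE)
    have fn: "f n \<in> HS" using f by (rule Lp_Cauchy_2D)
    let ?t = "tr (op_adj A o\<^sub>L (f n o\<^sub>L A))" and ?c = "tr (op_adj A o\<^sub>L ((P o\<^sub>L f n o\<^sub>L P) o\<^sub>L A))"
    have 1: "cmod (?t - ?L) < h / 3" by (rule N') (simp add: n_def)
    have "cmod (?t - ?c) \<le> 2 * (norm A)\<^sup>2 * B * sqrt (s\<^sup>2)"
      by (rule compression_error[OF P(1,2) _ fn B(2) A]) simp
    then have 2: "cmod (?t - ?c) \<le> h / 3" using s s_le by simp
    have "- (h / 3) \<le> Re ?c" "\<bar>Im ?c\<bar> \<le> h / 3"
      using tr_compression_bounds[OF P(1) fn A less_imp_le[OF e] spec[OF P(3)]] e_le by simp_all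
    with 1 2 show ?thesis
      using abs_Re_le_cmod[of "?t - ?L"] abs_Re_le_cmod[of "?t - ?c"]
        abs_Im_le_cmod[of "?t - ?L"] abs_Im_le_cmod[of "?t - ?c"]
      unfolding minus_complex.sel abs_le_iff by linarith
  qed
  show "0 \<le> Re ?L"
  proof (rule field_le_epsilon)
    show "0 \<le> Re ?L + h" if "0 < h" for h using main[OF that] by linarith
  qed
  have "\<bar>Im ?L\<bar> \<le> 0"
  proof (rule field_le_epsilon)
    show "\<bar>Im ?L\<bar> \<le> 0 + h" if "0 < h" for h using main[OF that] by linarith
  qed
  then show "Im ?L = 0" by simp
qed

section \<open>Classes of Cauchy sequences\<close>

lemma hs_norm_0 [simp]: "hs_norm 0 = 0"
  by (simp add: hs_norm_def fin_pos_0)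

lemma Lp_rel_2_refl: "f \<in> Lp_Cauchy M \<rho> 2 \<Longrightarrow> (f, f) \<in> Lp_rel M \<rho> 2"
  by (simp add: Lp_rel_def core_norm_2)

lemma Lp_2_class:
  assumes "F \<in> Lp M \<rho> 2"
  obtains f where "f \<in> Lp_Cauchy M \<rho> 2" "F = Lp_rel M \<rho> 2 `` {f}"
  using assms unfolding Lp_def by (rule quotientE) (rule that)

lemma Lp_2_representative:
  assumes "F \<in> Lp M \<rho> 2"
  obtains f where "f \<in> F"
proof -
  obtain f where "f \<in> Lp_Cauchy M \<rho> 2" "F = Lp_rel M \<rho> 2 `` {f}"
    using assms by (rule Lp_2_class)
  then have "f \<in> F" using Lp_rel_2_refl by simp
  then show ?thesis by (rule that)
qed

lemma Lp_2_Cauchy: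
  assumes "F \<in> Lp M \<rho> 2" "f \<in> F"
  shows "f \<in> Lp_Cauchy M \<rho> 2"
proof -
  obtain h where "F = Lp_rel M \<rho> 2 `` {h}"
    using assms(1) by (rule Lp_2_class)
  with assms(2) show ?thesis by (simp add: Lp_rel_def)
qed

lemma Lp_2_related:
  assumes F: "F \<in> Lp M \<rho> 2" and f: "f \<in> F" and g: "g \<in> F"
  shows "(\<lambda>n. hs_norm (f n - g n)) \<longlonglongrightarrow> 0"
proof -
  obtain h where h: "h \<in> Lp_Cauchy M \<rho> 2" "F = Lp_rel M \<rho> 2 `` {h}"
    using F by (rule Lp_2_class)
  have H: "f n \<in> HS" "g n \<in> HS" "h n \<in> HS" for n
    by (rule Lp_Cauchy_2D, rule Lp_2_Cauchy[OF F f] Lp_2_Cauchy[OF F g] h(1))+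
  have lim: "(\<lambda>n. hs_norm (h n - f n)) \<longlonglongrightarrow> 0" "(\<lambda>n. hs_norm (h n - g n)) \<longlonglongrightarrow> 0"
    using f g H unfolding h(2) by (simp_all add: Lp_rel_def core_norm_2 HS_M)
  have le: "norm (hs_norm (f n - g n)) \<le> hs_norm (h n - f n) + hs_norm (h n - g n)" for n
    using hs_norm_diff_triangle[of "f n" "h n" "g n"] hs_norm_commute[of "f n" "h n"] H by simp
  have "(\<lambda>n. hs_norm (h n - f n) + hs_norm (h n - g n)) \<longlonglongrightarrow> 0"
    using tendsto_add[OF lim] by simp
  then show ?thesis
    by (rule Lim_null_comparison[OF always_eventually[OF allI[OF le]]])
qed

lemma Lp_add_representative:
  assumes "f \<in> F" "g \<in> G" "f \<in> Lp_Cauchy M \<rho> 2" "g \<in> Lp_Cauchy M \<rho> 2"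
  shows "(\<lambda>n. f n + g n) \<in> Lp_add M \<rho> 2 F G"
  unfolding Lp_add_def
  by (intro UN_I[OF assms(1)] UN_I[OF assms(2)])
    (simp add: Lp_rel_2_refl[OF Lp_Cauchy_2_add[OF assms(3,4)]])

lemma Lp_scaleC_representative:
  assumes "f \<in> F" "f \<in> Lp_Cauchy M \<rho> 2"
  shows "(\<lambda>n. op_scaleC c (f n)) \<in> Lp_scaleC M \<rho> 2 c F"
  unfolding Lp_scaleC_def
  by (intro UN_I[OF assms(1)]) (simp add: Lp_rel_2_refl[OF Lp_Cauchy_2_scaleC[OF assms(2)]])

lemma sandwich_L1:
  assumes W: "W \<in> HS" and X: "X \<in> HS"
  shows "W o\<^sub>L X o\<^sub>L W \<in> L1" "tr_norm (W o\<^sub>L X o\<^sub>L W) \<le> (hs_norm W * norm W) * hs_norm X"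
proof -
  have XW: "X o\<^sub>L W \<in> HS" by (rule HS_right(1)[OF X HS_M[OF W]])
  show "W o\<^sub>L X o\<^sub>L W \<in> L1"
    unfolding op_compose_assoc by (rule HS_compose_L1(1)[OF XW W])
  have "tr_norm (W o\<^sub>L X o\<^sub>L W) \<le> hs_norm W * hs_norm (X o\<^sub>L W)"
    unfolding op_compose_assoc by (rule HS_compose_L1(2)[OF XW W])
  also have "\<dots> \<le> hs_norm W * (norm W * hs_norm X)"
    by (intro mult_left_mono HS_right(2)[OF X HS_M[OF W]]) simp
  finally show "tr_norm (W o\<^sub>L X o\<^sub>L W) \<le> (hs_norm W * norm W) * hs_norm X"
    by (simp add: mult.assoc)
qed

lemma sandwich_diff_le:
  assumes W: "W \<in> HS" and X: "X \<in> HS" and Y: "Y \<in> HS"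
  shows "tr_norm ((W o\<^sub>L X o\<^sub>L W) - (W o\<^sub>L Y o\<^sub>L W)) \<le> (hs_norm W * norm W) * hs_norm (X - Y)"
proof -
  have "(W o\<^sub>L X o\<^sub>L W) - (W o\<^sub>L Y o\<^sub>L W) = W o\<^sub>L (X - Y) o\<^sub>L W"
    by (rule blinfun_eqI) (simp add: blinfun.bilinear_simps)
  then show ?thesis using sandwich_L1(2)[OF W HS_diff[OF X Y]] by simp
qed

lemma sandwich_Cauchy:
  assumes W: "W \<in> HS" and f: "f \<in> Lp_Cauchy M \<rho> 2"
  shows "(\<lambda>n. W o\<^sub>L f n o\<^sub>L W) \<in> Lp_Cauchy M \<rho> 1"
proof -
  define c where "c = hs_norm W * norm W"
  have c: "0 \<le> c" by (simp add: c_def)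
  have fH: "f n \<in> HS" for n using f by (rule Lp_Cauchy_2D)
  have "\<exists>N. \<forall>m\<ge>N. \<forall>n\<ge>N. tr_norm ((W o\<^sub>L f m o\<^sub>L W) - (W o\<^sub>L f n o\<^sub>L W)) < e" if e: "0 < e" for e
  proof -
    have "0 < e / (c + 1)" using e c by simp
    with f obtain N where N: "\<And>m n. N \<le> m \<Longrightarrow> N \<le> n \<Longrightarrow> hs_norm (f m - f n) < e / (c + 1)"
      by (rule Lp_Cauchy_2E) blast
    have "tr_norm ((W o\<^sub>L f m o\<^sub>L W) - (W o\<^sub>L f n o\<^sub>L W)) < e" if "N \<le> m" "N \<le> n" for m n
    proof -
      have "tr_norm ((W o\<^sub>L f m o\<^sub>L W) - (W o\<^sub>L f n o\<^sub>L W)) \<le> c * hs_norm (f m - f n)"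
        unfolding c_def by (intro sandwich_diff_le W fH)
      also have "\<dots> \<le> (c + 1) * hs_norm (f m - f n)" by (simp add: algebra_simps)
      also have "\<dots> < e" using N[OF that] c by (simp add: field_simps)
      finally show ?thesis .
    qed
    then show ?thesis by blast
  qed
  then show ?thesis
    by (simp add: Lp_Cauchy_def Lp_core_1 core_norm_1 sandwich_L1(1)[OF W fH] del: One_nat_def)
qed

text \<open>The description of the norm in the completion is consistent: all members of the class
  \<open>W F W\<close> have trace norms with one and the same limit, which any representative of \<open>F\<close> computes.\<close>

lemma Lp_norm_sandwich:
  assumes F: "F \<in> Lp M \<rho> 2" and f: "f \<in> F" and W: "W \<in> HS"
  shows "(\<lambda>n. tr_norm (W o\<^sub>L f n o\<^sub>L W)) \<longlonglongrightarrow> Lp_norm \<rho> 1 (L2_sandwich M \<rho> W F)"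
proof -
  define c where "c = hs_norm W * norm W"
  have fC: "f \<in> Lp_Cauchy M \<rho> 2" using F f by (rule Lp_2_Cauchy)
  let ?g = "\<lambda>n. W o\<^sub>L f n o\<^sub>L W"
  have fH: "f n \<in> HS" for n using fC by (rule Lp_Cauchy_2D)
  have gC: "?g \<in> Lp_Cauchy M \<rho> 1" by (rule sandwich_Cauchy[OF W fC])
  have gL: "?g n \<in> L1" for n by (rule sandwich_L1(1)[OF W fH])
  have "Cauchy (\<lambda>n. tr_norm (?g n))"
  proof (rule metric_CauchyI)
    fix e :: real assume "0 < e"
    with gC obtain N where N: "\<And>m n. N \<le> m \<Longrightarrow> N \<le> n \<Longrightarrow> tr_norm (?g m - ?g n) < e"
      unfolding Lp_Cauchy_def core_norm_1 by blast
    have "dist (tr_norm (?g m)) (tr_norm (?g n)) < e" if "N \<le> m" "N \<le> n" for m n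
      using tr_norm_diff_le[OF gL[of m] gL[of n]] N[OF that] by (simp add: dist_real_def)
    then show "\<exists>N. \<forall>m\<ge>N. \<forall>n\<ge>N. dist (tr_norm (?g m)) (tr_norm (?g n)) < e" by blast
  qed
  then obtain r where r: "(\<lambda>n. tr_norm (?g n)) \<longlonglongrightarrow> r"
    using Cauchy_convergent convergentD by blast
  have all: "(\<lambda>n. core_norm \<rho> 1 (k n)) \<longlonglongrightarrow> r" if k: "k \<in> L2_sandwich M \<rho> W F" for k
  proof -
    obtain f' where f': "f' \<in> F" and rel: "(\<lambda>n. W o\<^sub>L f' n o\<^sub>L W, k) \<in> Lp_rel M \<rho> 1"
      using k unfolding L2_sandwich_def by blast
    have f'H: "f' n \<in> HS" for n using Lp_2_Cauchy[OF F f'] by (rule Lp_Cauchy_2D)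
    let ?g' = "\<lambda>n. W o\<^sub>L f' n o\<^sub>L W"
    have g'L: "?g' n \<in> L1" for n by (rule sandwich_L1(1)[OF W f'H])
    have kL: "k n \<in> L1" for n
      using rel unfolding Lp_rel_def Lp_Cauchy_def Lp_core_1 by blast
    have lim1: "(\<lambda>n. tr_norm (?g' n - k n)) \<longlonglongrightarrow> 0"
      using rel unfolding Lp_rel_def core_norm_1 by blast
    have lim2: "(\<lambda>n. c * hs_norm (f n - f' n)) \<longlonglongrightarrow> 0"
      using tendsto_mult_left[OF Lp_2_related[OF F f f'], of c] by simp
    have le: "norm (tr_norm (?g n) - tr_norm (k n)) \<le> c * hs_norm (f n - f' n) + tr_norm (?g' n - k n)" for n
      using tr_norm_diff_le[OF gL[of n] kL[of n]] tr_norm_diff_triangle[OF gL[of n] g'L[of n] kL[of n]]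
        sandwich_diff_le[OF W fH[of n] f'H[of n]] unfolding c_def real_norm_def by linarith
    have "(\<lambda>n. c * hs_norm (f n - f' n) + tr_norm (?g' n - k n)) \<longlonglongrightarrow> 0"
      using tendsto_add[OF lim2 lim1] by simp
    then have "(\<lambda>n. tr_norm (?g n) - tr_norm (k n)) \<longlonglongrightarrow> 0"
      by (rule Lim_null_comparison[OF always_eventually[OF allI[OF le]]])
    from tendsto_diff[OF r this] show ?thesis unfolding core_norm_1 by simp
  qed
  have mem: "?g \<in> L2_sandwich M \<rho> W F"
  proof -
    have "tr_norm 0 = 0"
      using fin_pos_0 by (simp add: tr_norm_def op_abs_pos)
    then have "(?g, ?g) \<in> Lp_rel M \<rho> 1"
      using gC unfolding Lp_rel_def core_norm_1 by simp
    with f show ?thesis unfolding L2_sandwich_def by blast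
  qed
  have eq: "Lp_norm \<rho> 1 (L2_sandwich M \<rho> W F) = r"
    unfolding Lp_norm_def
  proof (rule the_equality)
    show "\<forall>f\<in>L2_sandwich M \<rho> W F. (\<lambda>n. core_norm \<rho> 1 (f n)) \<longlonglongrightarrow> r" using all by blast
    show "r' = r" if "\<forall>f\<in>L2_sandwich M \<rho> W F. (\<lambda>n. core_norm \<rho> 1 (f n)) \<longlonglongrightarrow> r'" for r'
      using LIMSEQ_unique[OF that[rule_format, OF mem] all[OF mem]] .
  qed
  show ?thesis unfolding eq by (rule r)
qed

lemma Lp_operator_approx:
  assumes F: "Lp_positive M \<rho> F" and f: "f \<in> F" and e: "0 < e" and d: "0 < d"
  shows "\<exists>N. \<forall>n\<ge>N. \<exists>P\<in>projections M. \<rho> (id_blinfun - P) \<le> ennreal d \<and>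
    (\<forall>x. \<exists>y. cinner y (P x) \<in> \<real>\<^sub>\<ge>\<^sub>0 \<and> norm (y - f n (P x)) \<le> e * norm x)"
proof -
  obtain T where T: "Lp_operator M \<rho> F T" "positive_graph T"
    using F by (auto simp: Lp_positive_def)
  have pos: "cinner y x \<in> \<real>\<^sub>\<ge>\<^sub>0" if "(x, y) \<in> T" for x y
    using T(2) that by (auto simp: positive_graph_def)
  obtain N where N: "\<forall>n\<ge>N. \<exists>P\<in>projections M. \<rho> (id_blinfun - P) \<le> ennreal d \<and>
        (\<forall>x. \<exists>y. (blinfun_apply P x, y) \<in> T \<and> norm (y - f n (P x)) \<le> e * norm x)"
    using T(1) f e d unfolding Lp_operator_def by blast
  then show ?thesis using pos by meson
qed

end

section \<open>The Cauchy--Schwarz inequality\<close>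

text \<open>The hypothesis says that a sesquilinear form is nonnegative at \<open>x + c y\<close>. The values \<open>c = 1\<close> and
  \<open>c = i\<close> give the Hermitian symmetry \<open>b' = cnj b\<close>; then the bound is \<open>quadratic_form_bound\<close>.\<close>

lemma hermitian_form_bound:
  fixes a b b' d :: complex
  assumes form: "\<And>c. 0 \<le> Re ((a + cnj c * b) + c * (b' + cnj c * d)) \<and>
      Im ((a + cnj c * b) + c * (b' + cnj c * d)) = 0"
    and d: "0 \<le> Re d" "Im d = 0"
  shows "cmod b \<le> sqrt (Re a) * sqrt (Re d)"
proof (rule quadratic_form_bound)
  have a: "Im a = 0" using form[of 0] by simp
  have "Im b' = - Im b" using form[of 1] a d by simp
  moreover have "Re b' = Re b" using form[of \<i>] a d by simp
  ultimately have b': "b' = cnj b" by (simp add: complex_eq_iff)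
  show "0 \<le> Re a + 2 * Re (c * cnj b) + (cmod c)\<^sup>2 * Re d" for c
  proof -
    have "Re ((a + cnj c * b) + c * (b' + cnj c * d)) = Re a + 2 * Re (c * cnj b) + (cmod c)\<^sup>2 * Re d"
      unfolding b' cmod_power2 by (simp add: power2_eq_square algebra_simps)
    then show ?thesis
      using form[of c] by (simp only:)
  qed
qed (rule d)

context vn_trace
begin

text \<open>The functional \<open>\<psi> r Z\<close> below is the trace of \<open>Z W F W\<close> for the class \<open>F\<close> of \<open>r\<close>. On positive \<open>Z\<close> it
  makes \<open>\<Phi>\<close> a positive scalar form; \<open>functional_domination\<close> passes to contractions, among them the one
  that computes the trace norm.\<close>

lemma Lp_norm_sandwich_Cauchy_Schwarz:
  assumes sq: "sesquilinear_L2 M \<rho> sc \<Phi>" and pos: "positive_L2_map M \<rho> \<Phi>"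
    and W: "W \<in> HS" "op_pos W"
  shows "Lp_norm \<rho> 1 (L2_sandwich M \<rho> W (\<Phi> x y)) \<le>
    sqrt (Lp_norm \<rho> 1 (L2_sandwich M \<rho> W (\<Phi> x x))) * sqrt (Lp_norm \<rho> 1 (L2_sandwich M \<rho> W (\<Phi> y y)))"
proof -
  have WM: "W \<in> M" using W by (simp add: HS_M)
  have L2: "\<Phi> u v \<in> Lp M \<rho> 2" for u v using sq by (simp add: sesquilinear_L2_def)
  have P: "Lp_positive M \<rho> (\<Phi> u u)" for u using pos by (simp add: positive_L2_map_def)
  obtain f g h k where mem: "f \<in> \<Phi> x x" "g \<in> \<Phi> x y" "h \<in> \<Phi> y x" "k \<in> \<Phi> y y"
    using Lp_2_representative[OF L2] by metis
  have C: "f \<in> Lp_Cauchy M \<rho> 2" "g \<in> Lp_Cauchy M \<rho> 2" "h \<in> Lp_Cauchy M \<rho> 2" "k \<in> Lp_Cauchy M \<rho> 2"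
    using mem Lp_2_Cauchy[OF L2] by blast+
  define \<psi> where "\<psi> r Z = lim_tr r (Z o\<^sub>L W) W" for r Z
  have ZW: "Z o\<^sub>L W \<in> HS" if "Z \<in> M" for Z by (rule HS_left(1)[OF W(1) that])
  have \<psi>_add: "\<psi> r (A + B) = \<psi> r A + \<psi> r B"
    if "r \<in> Lp_Cauchy M \<rho> 2" "A \<in> M" "B \<in> M" for r A B
  proof -
    have "(A + B) o\<^sub>L W = (A o\<^sub>L W) + (B o\<^sub>L W)"
      by (rule blinfun_eqI) (simp add: blinfun.bilinear_simps)
    then show ?thesis
      unfolding \<psi>_def using lim_tr_left_add[OF that(1) ZW[OF that(2)] ZW[OF that(3)] WM] by simp
  qed
  have \<psi>_scale: "\<psi> r (op_scaleC c A) = c * \<psi> r A" if "r \<in> Lp_Cauchy M \<rho> 2" "A \<in> M" for r c A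
  proof -
    have "op_scaleC c A o\<^sub>L W = op_scaleC c (A o\<^sub>L W)"
      by (rule blinfun_eqI) simp
    then show ?thesis
      unfolding \<psi>_def using lim_tr_left_scaleC[OF that(1) ZW[OF that(2)] WM] by simp
  qed
  have \<psi>_pos: "0 \<le> Re (\<psi> r Q) \<and> Im (\<psi> r Q) = 0"
    if r: "r \<in> \<Phi> u u" and Q: "Q \<in> M" "op_pos Q" for r u Q
  proof -
    have rC: "r \<in> Lp_Cauchy M \<rho> 2" using Lp_2_Cauchy[OF L2 r] .
    have A: "W o\<^sub>L op_sqrt Q \<in> HS" using W Q by (simp add: HS_right)
    show ?thesis
      unfolding \<psi>_def lim_tr_symmetrize[OF rC W Q]
      using lim_tr_positive[OF rC A Lp_operator_approx[OF P r]] by blast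
  qed
  have \<psi>_CS: "cmod (\<psi> g Q) \<le> sqrt (Re (\<psi> f Q)) * sqrt (Re (\<psi> k Q))" if Q: "Q \<in> M" "op_pos Q" for Q
  proof (rule hermitian_form_bound)
    show "0 \<le> Re (\<psi> k Q)" "Im (\<psi> k Q) = 0" using \<psi>_pos[OF mem(4) Q] by simp_all
    fix c
    \<comment> \<open>\<open>p + c q\<close> represents \<open>\<Phi> (x + c y) (x + c y)\<close>.\<close>
    define p where "p n = f n + op_scaleC (cnj c) (g n)" for n
    define q where "q n = h n + op_scaleC (cnj c) (k n)" for n
    have \<Phi>_expand: "\<Phi> u (x + sc c y) = Lp_add M \<rho> 2 (\<Phi> u x) (Lp_scaleC M \<rho> 2 (cnj c) (\<Phi> u y))"
      "\<Phi> (x + sc c y) u = Lp_add M \<rho> 2 (\<Phi> x u) (Lp_scaleC M \<rho> 2 c (\<Phi> y u))" for u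
      using sq by (simp_all add: sesquilinear_L2_def)
    have pm: "p \<in> \<Phi> x (x + sc c y)" and qm: "q \<in> \<Phi> y (x + sc c y)"
      unfolding \<Phi>_expand(1) p_def q_def
      using mem C by (auto intro!: Lp_add_representative Lp_scaleC_representative Lp_Cauchy_2_scaleC)
    have pC: "p \<in> Lp_Cauchy M \<rho> 2" and qC: "q \<in> Lp_Cauchy M \<rho> 2"
      using Lp_2_Cauchy[OF L2] pm qm by blast+
    have "(\<lambda>n. p n + op_scaleC c (q n)) \<in> \<Phi> (x + sc c y) (x + sc c y)"
      unfolding \<Phi>_expand(2)[of "x + sc c y"]
      using pm qm pC qC by (auto intro!: Lp_add_representative Lp_scaleC_representative Lp_Cauchy_2_scaleC)
    from \<psi>_pos[OF this Q]
    have "0 \<le> Re (\<psi> (\<lambda>n. p n + op_scaleC c (q n)) Q) \<and> Im (\<psi> (\<lambda>n. p n + op_scaleC c (q n)) Q) = 0" .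
    also have "\<psi> (\<lambda>n. p n + op_scaleC c (q n)) Q =
        (\<psi> f Q + cnj c * \<psi> g Q) + c * (\<psi> h Q + cnj c * \<psi> k Q)"
      unfolding \<psi>_def p_def q_def
      using C ZW[OF Q(1)] WM by (simp add: lim_tr_add lim_tr_scaleC Lp_Cauchy_2_add Lp_Cauchy_2_scaleC)
    finally show "0 \<le> Re ((\<psi> f Q + cnj c * \<psi> g Q) + c * (\<psi> h Q + cnj c * \<psi> k Q)) \<and>
        Im ((\<psi> f Q + cnj c * \<psi> g Q) + c * (\<psi> h Q + cnj c * \<psi> k Q)) = 0" .
  qed
  define a where "a = Re (\<psi> f id_blinfun)"
  define b where "b = Re (\<psi> k id_blinfun)"
  have dom: "cmod (\<psi> g V) \<le> sqrt a * sqrt b" if "V \<in> M" "norm V \<le> 1" for V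
    unfolding a_def b_def
  proof (rule functional_domination[where \<phi> = "\<psi> g" and \<alpha> = "\<lambda>A. Re (\<psi> f A)" and \<beta> = "\<lambda>A. Re (\<psi> k A)"])
    show "0 \<le> Re (\<psi> f Q) \<and> 0 \<le> Re (\<psi> k Q) \<and> cmod (\<psi> g Q) \<le> sqrt (Re (\<psi> f Q)) * sqrt (Re (\<psi> k Q))"
      if "Q \<in> M" "op_pos Q" for Q
      using \<psi>_pos[OF mem(1) that] \<psi>_pos[OF mem(4) that] \<psi>_CS[OF that] by blast
  qed (simp_all add: \<psi>_add \<psi>_scale C that)
  have diag: "Re (\<psi> r id_blinfun) \<le> Lp_norm \<rho> 1 (L2_sandwich M \<rho> W (\<Phi> u u))" if r: "r \<in> \<Phi> u u" for r u
  proof -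
    have rC: "r \<in> Lp_Cauchy M \<rho> 2" using Lp_2_Cauchy[OF L2 r] .
    have "(\<lambda>n. Re (tr (W o\<^sub>L (r n o\<^sub>L W)))) \<longlonglongrightarrow> Re (\<psi> r id_blinfun)"
      unfolding \<psi>_def by (intro tendsto_Re) (use lim_tr[OF rC W(1) WM] in simp)
    moreover have "(\<lambda>n. tr_norm (W o\<^sub>L r n o\<^sub>L W)) \<longlonglongrightarrow> Lp_norm \<rho> 1 (L2_sandwich M \<rho> W (\<Phi> u u))"
      by (rule Lp_norm_sandwich[OF L2 r W(1)])
    moreover have "Re (tr (W o\<^sub>L (r n o\<^sub>L W))) \<le> tr_norm (W o\<^sub>L r n o\<^sub>L W)" for n
    proof -
      have "W o\<^sub>L r n o\<^sub>L W \<in> L1" using sandwich_L1(1)[OF W(1) Lp_Cauchy_2D[OF rC]] .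
      from tr_L1(2)[OF this M_closed(2)]
      have "cmod (tr (W o\<^sub>L r n o\<^sub>L W)) \<le> norm (id_blinfun :: 'h oper) * tr_norm (W o\<^sub>L r n o\<^sub>L W)" by simp
      also have "\<dots> \<le> 1 * tr_norm (W o\<^sub>L r n o\<^sub>L W)"
        by (intro mult_right_mono norm_blinfun_id_le) simp
      finally have "cmod (tr (W o\<^sub>L (r n o\<^sub>L W))) \<le> tr_norm (W o\<^sub>L r n o\<^sub>L W)"
        by (simp add: op_compose_assoc)
      then show ?thesis using complex_Re_le_cmod order_trans by blast
    qed
    ultimately show ?thesis by (intro LIMSEQ_le) auto
  qed
  have "Lp_norm \<rho> 1 (L2_sandwich M \<rho> W (\<Phi> x y)) \<le> sqrt a * sqrt b"
  proof (rule field_le_epsilon)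
    fix e :: real assume "0 < e"
    from lim_tr_uniform[OF C(2) W(1) this] obtain N where
      N: "\<And>m Z. N \<le> m \<Longrightarrow> Z \<in> M \<Longrightarrow> norm Z \<le> 1 \<Longrightarrow>
        cmod (tr ((Z o\<^sub>L W) o\<^sub>L (g m o\<^sub>L W)) - \<psi> g Z) \<le> e"
      unfolding \<psi>_def by blast
    have le: "tr_norm (W o\<^sub>L g m o\<^sub>L W) \<le> sqrt a * sqrt b + e" if m: "N \<le> m" for m
    proof -
      have gL: "W o\<^sub>L g m o\<^sub>L W \<in> L1" using sandwich_L1(1)[OF W(1) Lp_Cauchy_2D[OF C(2)]] .
      obtain T where T: "T \<in> M" "norm T \<le> 1" "tr (T o\<^sub>L (W o\<^sub>L g m o\<^sub>L W)) = tr_norm (W o\<^sub>L g m o\<^sub>L W)"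
        using tr_norm_attained(2)[OF L1_M[OF gL] tr_L1(1)[OF gL]] by blast
      have "tr_norm (W o\<^sub>L g m o\<^sub>L W) = cmod (tr (T o\<^sub>L (W o\<^sub>L g m o\<^sub>L W)))"
        by (simp add: T(3))
      also have "\<dots> = cmod (tr ((T o\<^sub>L W) o\<^sub>L (g m o\<^sub>L W)))"
        by (simp add: op_compose_assoc)
      also have "\<dots> \<le> cmod (\<psi> g T) + cmod (tr ((T o\<^sub>L W) o\<^sub>L (g m o\<^sub>L W)) - \<psi> g T)"
        using norm_triangle_ineq[of "\<psi> g T" "tr ((T o\<^sub>L W) o\<^sub>L (g m o\<^sub>L W)) - \<psi> g T"] by simp
      also have "\<dots> \<le> sqrt a * sqrt b + e"
        by (intro add_mono dom N m T)
      finally show ?thesis .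
    qed
    show "Lp_norm \<rho> 1 (L2_sandwich M \<rho> W (\<Phi> x y)) \<le> sqrt a * sqrt b + e"
      by (rule LIMSEQ_le_const2[OF Lp_norm_sandwich[OF L2 mem(2) W(1)]]) (use le in blast)
  qed
  also have "\<dots> \<le> sqrt (Lp_norm \<rho> 1 (L2_sandwich M \<rho> W (\<Phi> x x))) * sqrt (Lp_norm \<rho> 1 (L2_sandwich M \<rho> W (\<Phi> y y)))"
  proof (rule mult_mono)
    show "0 \<le> sqrt b" using \<psi>_pos[OF mem(4) M_closed(2)] by (simp add: b_def)
    have "0 \<le> a" using \<psi>_pos[OF mem(1) M_closed(2)] by (simp add: a_def)
    then show "0 \<le> sqrt (Lp_norm \<rho> 1 (L2_sandwich M \<rho> W (\<Phi> x x)))"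
      using diag[OF mem(1)] by (simp add: a_def)
  qed (use diag mem in \<open>simp_all add: a_def b_def\<close>)
  finally show ?thesis .
qed

text \<open>A supremum of reals dominates its members only if they are bounded; here Hoelder's inequality
  \<open>\<parallel>W f\<^sub>n W\<parallel>\<^sub>1 \<le> \<parallel>W\<parallel>\<^sub>2 \<parallel>W\<parallel> \<parallel>f\<^sub>n\<parallel>\<^sub>2\<close> bounds them by a bound for the representing sequence.\<close>

lemma triple_norm_upper:
  assumes F: "F \<in> Lp M \<rho> 2" and W: "W \<in> HS" "op_pos W" "hs_norm W \<le> 1" "norm W \<le> 1"
  shows "Lp_norm \<rho> 1 (L2_sandwich M \<rho> W F) \<le> triple_norm M \<rho> F"
  unfolding triple_norm_def
proof (rule cSup_upper)
  show "Lp_norm \<rho> 1 (L2_sandwich M \<rho> W F) \<in> {Lp_norm \<rho> 1 (L2_sandwich M \<rho> W F) |W.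
      W \<in> Lp_core M \<rho> 2 \<and> op_pos W \<and> core_norm \<rho> 2 W \<le> 1 \<and> norm W \<le> 1}"
    using W by (auto simp: Lp_core_2 core_norm_2 HS_M)
  obtain f where f: "f \<in> F" using Lp_2_representative[OF F] .
  have fC: "f \<in> Lp_Cauchy M \<rho> 2" using Lp_2_Cauchy[OF F f] .
  obtain B where B: "0 \<le> B" "\<And>n. hs_norm (f n) \<le> B"
    using Lp_Cauchy_2_bounded[OF fC] by blast
  have "Lp_norm \<rho> 1 (L2_sandwich M \<rho> V F) \<le> B"
    if V: "V \<in> HS" "hs_norm V \<le> 1" "norm V \<le> 1" for V
  proof (rule LIMSEQ_le_const2[OF Lp_norm_sandwich[OF F f V(1)]])
    have "tr_norm (V o\<^sub>L f n o\<^sub>L V) \<le> B" for n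
    proof -
      have "tr_norm (V o\<^sub>L f n o\<^sub>L V) \<le> (hs_norm V * norm V) * hs_norm (f n)"
        by (rule sandwich_L1(2)[OF V(1) Lp_Cauchy_2D[OF fC]])
      also have "\<dots> \<le> (1 * 1) * B"
        using V B by (intro mult_mono) auto
      finally show ?thesis by simp
    qed
    then show "\<exists>N. \<forall>n\<ge>N. tr_norm (V o\<^sub>L f n o\<^sub>L V) \<le> B" by blast
  qed
  then show "bdd_above {Lp_norm \<rho> 1 (L2_sandwich M \<rho> W F) |W.
      W \<in> Lp_core M \<rho> 2 \<and> op_pos W \<and> core_norm \<rho> 2 W \<le> 1 \<and> norm W \<le> 1}"
    by (intro bdd_aboveI[of _ B]) (auto simp: Lp_core_2 core_norm_2 HS_M)
qed

lemma triple_norm_Cauchy_Schwarz: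
  assumes sq: "sesquilinear_L2 M \<rho> sc \<Phi>" and pos: "positive_L2_map M \<rho> \<Phi>"
  shows "triple_norm M \<rho> (\<Phi> x y) \<le> sqrt (triple_norm M \<rho> (\<Phi> x x)) * sqrt (triple_norm M \<rho> (\<Phi> y y))"
proof -
  have L2: "\<Phi> u v \<in> Lp M \<rho> 2" for u v using sq by (simp add: sesquilinear_L2_def)
  let ?B = "sqrt (triple_norm M \<rho> (\<Phi> x x)) * sqrt (triple_norm M \<rho> (\<Phi> y y))"
  have nonneg: "0 \<le> Lp_norm \<rho> 1 (L2_sandwich M \<rho> W (\<Phi> u v))" if "W \<in> HS" for W u v
  proof -
    obtain f where "f \<in> \<Phi> u v" using Lp_2_representative[OF L2] .
    from LIMSEQ_le_const[OF Lp_norm_sandwich[OF L2 this that]] show ?thesis by auto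
  qed
  have "Lp_norm \<rho> 1 (L2_sandwich M \<rho> W (\<Phi> x y)) \<le> ?B"
    if W: "W \<in> HS" "op_pos W" "hs_norm W \<le> 1" "norm W \<le> 1" for W
  proof -
    have "0 \<le> triple_norm M \<rho> (\<Phi> x x)"
      using order_trans[OF nonneg[OF W(1)] triple_norm_upper[OF L2 W]] .
    then have "sqrt (Lp_norm \<rho> 1 (L2_sandwich M \<rho> W (\<Phi> x x))) *
        sqrt (Lp_norm \<rho> 1 (L2_sandwich M \<rho> W (\<Phi> y y))) \<le> ?B"
      using triple_norm_upper[OF L2 W] nonneg[OF W(1)] by (intro mult_mono) auto
    with Lp_norm_sandwich_Cauchy_Schwarz[OF sq pos W(1,2)] show ?thesis
      by (rule order_trans)
  qed
  moreover have "0 \<in> HS" "hs_norm 0 \<le> 1"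
    using fin_pos_0 by (simp_all add: HS_def hs_norm_def)
  ultimately show ?thesis
    unfolding triple_norm_def[of M \<rho> "\<Phi> x y"]
    by (intro cSup_least) (auto simp: Lp_core_2 core_norm_2 HS_M intro!: exI[of _ 0])
qed

end

theorem corollary4p7:
  fixes M :: "('h::chilbert_space \<Rightarrow>\<^sub>L 'h) set"
    and \<rho> :: "('h \<Rightarrow>\<^sub>L 'h) \<Rightarrow> ennreal"
    and sc :: "complex \<Rightarrow> 'x::ab_group_add \<Rightarrow> 'x"
    and \<Phi> :: "'x \<Rightarrow> 'x \<Rightarrow> 'h lp_elem"
    and x y :: 'x
  assumes "type_I_factor M \<or> type_II_factor M"
    and "is_trace M \<rho>" and "faithful_trace M \<rho>" and "normal_trace M \<rho>"
    and "semifinite_trace M \<rho>"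
    and "vector_space sc"
    and "sesquilinear_L2 M \<rho> sc \<Phi>"
    and "positive_L2_map M \<rho> \<Phi>"
  shows "triple_norm M \<rho> (\<Phi> x y) \<le>
    sqrt (triple_norm M \<rho> (\<Phi> x x)) * sqrt (triple_norm M \<rho> (\<Phi> y y))"
proof -
  have "von_neumann_algebra M"
    using assms(1) by (auto simp: type_I_factor_def type_II_factor_def factor_def)
  then interpret vn_trace M \<rho>
    using assms(2) by unfold_locales
  show ?thesis
    using assms(7,8) by (rule triple_norm_Cauchy_Schwarz)
qed

end
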